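(* Let $G$ be a finite group, $H \subseteq G$ a subgroup and $R$ an $H$-Tambara functor. Then $I \mapsto \mathrm{CoInd}_H^G I$ is an order-preserving bijection between the Tambara ideals of $R$ and the Tambara ideals of $\mathrm{CoInd}_H^G R$, and it restricts to a bijection between prime ideals. Consequently there is a homeomorphism of Nakaoka spectra $\mathrm{Spec}(\mathrm{CoInd}_H^G R) \cong \mathrm{Spec}(R)$, natural in the $H$-Tambara functor $R$.
   Context: Tambara functors are evaluated on transitive $G$-sets and extended to finite $G$-sets by $R(X \sqcup Y) = R(X) \times R(Y)$. A Tambara ideal $I$ of a $G$-Tambara functor $R$ is a collection of ideals $I(G/H) \subseteq R(G/H)$, one for each subgroup $H \subseteq G$, closed under all transfers $\mathrm{Tr}_K^H$, norms $\mathrm{Nm}_K^H$, restrictions $\mathrm{Res}_K^H$ and conjugations $c_g$. Extend by $I(X \sqcup Y) = I(X) \times I(Y)$. The product $I\cdot J$ of Tambara ideals is the smallest Tambara ideal containing $I(G/H)\cdot J(G/H)$ for every $H$. A Tambara ideal $\mathfrak{p}$ is prime if $\mathfrak{p} \neq R$ and $I \cdot J \subseteq \mathfrak{p}$ implies $I \subseteq \mathfrak{p}$ or $J \subseteq \mathfrak{p}$ for all Tambara ideals $I,J$. The Nakaoka spectrum $\mathrm{Spec}(R)$ is the set of prime Tambara ideals with closed sets $V(I) = \{\mathfrak{p} : I \subseteq \mathfrak{p}\}$, $I$ a Tambara ideal. Coinduction: for an $H$-Tambara functor $R$, $\mathrm{CoInd}_H^G R$ is the $G$-Tambara functor $X \mapsto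 R(\mathrm{Res}_H^G X)$, where $\mathrm{Res}^G_H X$ is the finite $G$-set $X$ regarded as an $H$-set; it is right adjoint to restriction of Tambara functors. For a Tambara ideal $I$ of $R$, $\mathrm{CoInd}_H^G I$ is given by $X \mapsto I(\mathrm{Res}_H^G X) \subseteq R(\mathrm{Res}_H^G X)$. *)

theory Defs
  imports
    "HOL-Algebra.Group_Action"
    "HOL-Algebra.Left_Coset"
    "HOL-Algebra.Ideal_Product"
    "HOL-Algebra.Chinese_Remainder"
    "HOL-Analysis.Abstract_Topology"
begin

section \<open>Finite G-sets\<close>

text \<open>
  Finite \<open>G\<close>-sets have their points in the fixed infinite type \<open>'g set \<times> nat\<close>.  Every finite
  \<open>G\<close>-set has an isomorphic copy there, so this is a small model of the category of finite
  \<open>G\<close>-sets, and the cosets forming \<open>G/K\<close> are points (up to the tag \<open>0\<close>).  Actions and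
  equivariant maps are extensional, so that equality of functions is equality on the carriers.
\<close>

type_synonym 'g point = "'g set \<times> nat"

record 'g gset =
  pts :: "'g point set"
  act :: "'g \<Rightarrow> 'g point \<Rightarrow> 'g point"

definition gsets :: "'g monoid \<Rightarrow> 'g gset set" where
  "gsets G = {X. finite (pts X) \<and> group_action G (pts X) (act X) \<and> act X \<in> extensional (carrier G)}"

definition gmaps :: "'g monoid \<Rightarrow> 'g gset \<Rightarrow> 'g gset \<Rightarrow> ('g point \<Rightarrow> 'g point) set" where
  "gmaps G X Y = {f \<in> pts X \<rightarrow>\<^sub>E pts Y.
     \<forall>g\<in>carrier G. \<forall>x\<in>pts X. f (act X g x) = act Y g (f x)}"

definition gid :: "'g gset \<Rightarrow> 'g point \<Rightarrow> 'g point" where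
  "gid X = (\<lambda>x\<in>pts X. x)"

definition is_coproduct ::
  "'g monoid \<Rightarrow> 'g gset \<Rightarrow> 'g gset \<Rightarrow> 'g gset \<Rightarrow>
   ('g point \<Rightarrow> 'g point) \<Rightarrow> ('g point \<Rightarrow> 'g point) \<Rightarrow> bool" where
  "is_coproduct G X Y Z i j \<longleftrightarrow>
     i \<in> gmaps G X Z \<and> j \<in> gmaps G Y Z \<and> inj_on i (pts X) \<and> inj_on j (pts Y) \<and>
     i ` pts X \<inter> j ` pts Y = {} \<and> i ` pts X \<union> j ` pts Y = pts Z"

text \<open>\<open>P\<close> with projections \<open>p\<close>, \<open>p'\<close> is a pullback of \<open>f : X \<rightarrow> Z\<close> and \<open>h : Y \<rightarrow> Z\<close>.\<close>

definition is_pullback ::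
  "'g monoid \<Rightarrow> 'g gset \<Rightarrow> 'g gset \<Rightarrow> 'g gset \<Rightarrow> 'g gset \<Rightarrow>
   ('g point \<Rightarrow> 'g point) \<Rightarrow> ('g point \<Rightarrow> 'g point) \<Rightarrow>
   ('g point \<Rightarrow> 'g point) \<Rightarrow> ('g point \<Rightarrow> 'g point) \<Rightarrow> bool" where
  "is_pullback G X Y Z P f h p p' \<longleftrightarrow>
     f \<in> gmaps G X Z \<and> h \<in> gmaps G Y Z \<and> p \<in> gmaps G P X \<and> p' \<in> gmaps G P Y \<and>
     bij_betw (\<lambda>w. (p w, p' w)) (pts P) {(x, y). x \<in> pts X \<and> y \<in> pts Y \<and> f x = h y}"

text \<open>
  Exponential diagrams.  For \<open>u : A \<rightarrow> X\<close> and \<open>f : X \<rightarrow> Y\<close>, the \<open>G\<close>-set \<open>D\<close> over \<open>Y\<close> (via \<open>q\<close>) is a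
  copy of the dependent product of \<open>A\<close> along \<open>f\<close>: the points of \<open>D\<close> over \<open>y\<close> correspond, via the
  evaluation map \<open>e\<close> from \<open>P = X \<times>\<^sub>Y D\<close> to \<open>A\<close>, to the sections of \<open>u\<close> over the fibre of \<open>f\<close> at \<open>y\<close>.
\<close>

definition is_exponential ::
  "'g monoid \<Rightarrow> 'g gset \<Rightarrow> 'g gset \<Rightarrow> 'g gset \<Rightarrow> 'g gset \<Rightarrow> 'g gset \<Rightarrow>
   ('g point \<Rightarrow> 'g point) \<Rightarrow> ('g point \<Rightarrow> 'g point) \<Rightarrow> ('g point \<Rightarrow> 'g point) \<Rightarrow>
   ('g point \<Rightarrow> 'g point) \<Rightarrow> ('g point \<Rightarrow> 'g point) \<Rightarrow> ('g point \<Rightarrow> 'g point) \<Rightarrow> bool" where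
  "is_exponential G A X Y P D u f p p' q e \<longleftrightarrow>
     u \<in> gmaps G A X \<and> e \<in> gmaps G P A \<and> is_pullback G X D Y P f q p p' \<and>
     (\<forall>w\<in>pts P. u (e w) = p w) \<and>
     (\<forall>y\<in>pts Y. \<forall>s. (\<forall>x\<in>pts X. f x = y \<longrightarrow> s x \<in> pts A \<and> u (s x) = x) \<longrightarrow>
        (\<exists>!d. d \<in> pts D \<and> q d = y \<and> (\<forall>w\<in>pts P. p' w = d \<longrightarrow> e w = s (p w))))"

definition coset_gset :: "'g monoid \<Rightarrow> 'g set \<Rightarrow> 'g gset" where
  "coset_gset G K = \<lparr>pts = (lcosets\<^bsub>G\<^esub> K) \<times> {0},
     act = (\<lambda>g\<in>carrier G. \<lambda>c\<in>(lcosets\<^bsub>G\<^esub> K) \<times> {0}. (g <#\<^bsub>G\<^esub> fst c, 0))\<rparr>"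

text \<open>The projection \<open>G/K \<rightarrow> G/L\<close>, \<open>aK \<mapsto> aL\<close>, for \<open>K \<subseteq> L\<close>.\<close>

definition coset_proj :: "'g monoid \<Rightarrow> 'g set \<Rightarrow> 'g set \<Rightarrow> 'g point \<Rightarrow> 'g point" where
  "coset_proj G K L = (\<lambda>c\<in>pts (coset_gset G K). (fst c <#>\<^bsub>G\<^esub> L, 0))"

definition conj_subgroup :: "'g monoid \<Rightarrow> 'g \<Rightarrow> 'g set \<Rightarrow> 'g set" where
  "conj_subgroup G g K = (g <#\<^bsub>G\<^esub> K) #>\<^bsub>G\<^esub> inv\<^bsub>G\<^esub> g"

text \<open>The isomorphism \<open>G/gKg\<inverse> \<rightarrow> G/K\<close>, \<open>a gKg\<inverse> \<mapsto> agK\<close>; as a set, \<open>agK = (a gKg\<inverse>)g\<close>.\<close>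

definition coset_conj :: "'g monoid \<Rightarrow> 'g \<Rightarrow> 'g set \<Rightarrow> 'g point \<Rightarrow> 'g point" where
  "coset_conj G g K = (\<lambda>c\<in>pts (coset_gset G (conj_subgroup G g K)). (fst c #>\<^bsub>G\<^esub> g, 0))"

definition res_gset :: "'g set \<Rightarrow> 'g gset \<Rightarrow> 'g gset" where
  "res_gset H X = \<lparr>pts = pts X, act = restrict (act X) H\<rparr>"


section \<open>Tambara functors\<close>

text \<open>
  For \<open>f : X \<rightarrow> Y\<close>, \<open>tres R X Y f : R(Y) \<rightarrow> R(X)\<close> is the restriction and
  \<open>ttr R X Y f, tnm R X Y f : R(X) \<rightarrow> R(Y)\<close> are the transfer and the norm along \<open>f\<close>.
\<close>

record ('g, 'r) tambara =
  tval :: "'g gset \<Rightarrow> 'r ring"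
  tres :: "'g gset \<Rightarrow> 'g gset \<Rightarrow> ('g point \<Rightarrow> 'g point) \<Rightarrow> 'r \<Rightarrow> 'r"
  ttr :: "'g gset \<Rightarrow> 'g gset \<Rightarrow> ('g point \<Rightarrow> 'g point) \<Rightarrow> 'r \<Rightarrow> 'r"
  tnm :: "'g gset \<Rightarrow> 'g gset \<Rightarrow> ('g point \<Rightarrow> 'g point) \<Rightarrow> 'r \<Rightarrow> 'r"

locale tambara_functor =
  fixes G :: "'g monoid" and R :: "('g, 'r) tambara"
  assumes group: "group G"
    and finite_group: "finite (carrier G)"
    and val_cring: "X \<in> gsets G \<Longrightarrow> cring (tval R X)"
    and res_hom: "\<lbrakk>X \<in> gsets G; Y \<in> gsets G; f \<in> gmaps G X Y\<rbrakk>
      \<Longrightarrow> tres R X Y f \<in> ring_hom (tval R Y) (tval R X)"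
    and tr_hom: "\<lbrakk>X \<in> gsets G; Y \<in> gsets G; f \<in> gmaps G X Y\<rbrakk>
      \<Longrightarrow> ttr R X Y f \<in> hom (add_monoid (tval R X)) (add_monoid (tval R Y))"
    and nm_hom: "\<lbrakk>X \<in> gsets G; Y \<in> gsets G; f \<in> gmaps G X Y\<rbrakk>
      \<Longrightarrow> tnm R X Y f \<in> hom (tval R X) (tval R Y)"
    and nm_one: "\<lbrakk>X \<in> gsets G; Y \<in> gsets G; f \<in> gmaps G X Y\<rbrakk>
      \<Longrightarrow> tnm R X Y f \<one>\<^bsub>tval R X\<^esub> = \<one>\<^bsub>tval R Y\<^esub>"
    and res_id: "\<lbrakk>X \<in> gsets G; a \<in> carrier (tval R X)\<rbrakk> \<Longrightarrow> tres R X X (gid X) a = a"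
    and tr_id: "\<lbrakk>X \<in> gsets G; a \<in> carrier (tval R X)\<rbrakk> \<Longrightarrow> ttr R X X (gid X) a = a"
    and nm_id: "\<lbrakk>X \<in> gsets G; a \<in> carrier (tval R X)\<rbrakk> \<Longrightarrow> tnm R X X (gid X) a = a"
    and res_comp: "\<lbrakk>X \<in> gsets G; Y \<in> gsets G; Z \<in> gsets G; f \<in> gmaps G X Y; h \<in> gmaps G Y Z;
        a \<in> carrier (tval R Z)\<rbrakk>
      \<Longrightarrow> tres R X Z (compose (pts X) h f) a = tres R X Y f (tres R Y Z h a)"
    and tr_comp: "\<lbrakk>X \<in> gsets G; Y \<in> gsets G; Z \<in> gsets G; f \<in> gmaps G X Y; h \<in> gmaps G Y Z;
        a \<in> carrier (tval R X)\<rbrakk>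
      \<Longrightarrow> ttr R X Z (compose (pts X) h f) a = ttr R Y Z h (ttr R X Y f a)"
    and nm_comp: "\<lbrakk>X \<in> gsets G; Y \<in> gsets G; Z \<in> gsets G; f \<in> gmaps G X Y; h \<in> gmaps G Y Z;
        a \<in> carrier (tval R X)\<rbrakk>
      \<Longrightarrow> tnm R X Z (compose (pts X) h f) a = tnm R Y Z h (tnm R X Y f a)"
    and val_empty: "\<lbrakk>X \<in> gsets G; pts X = {}\<rbrakk> \<Longrightarrow> carrier (tval R X) = {\<zero>\<^bsub>tval R X\<^esub>}"
    and val_coproduct: "\<lbrakk>X \<in> gsets G; Y \<in> gsets G; Z \<in> gsets G; is_coproduct G X Y Z i j\<rbrakk>
      \<Longrightarrow> (\<lambda>a. (tres R X Z i a, tres R Y Z j a)) \<in> ring_iso (tval R Z) (RDirProd (tval R X) (tval R Y))"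
    and res_tr: "\<lbrakk>X \<in> gsets G; Y \<in> gsets G; Z \<in> gsets G; P \<in> gsets G;
        is_pullback G X Y Z P f h p p'; a \<in> carrier (tval R X)\<rbrakk>
      \<Longrightarrow> tres R Y Z h (ttr R X Z f a) = ttr R P Y p' (tres R P X p a)"
    and res_nm: "\<lbrakk>X \<in> gsets G; Y \<in> gsets G; Z \<in> gsets G; P \<in> gsets G;
        is_pullback G X Y Z P f h p p'; a \<in> carrier (tval R X)\<rbrakk>
      \<Longrightarrow> tres R Y Z h (tnm R X Z f a) = tnm R P Y p' (tres R P X p a)"
    and nm_tr: "\<lbrakk>A \<in> gsets G; X \<in> gsets G; Y \<in> gsets G; P \<in> gsets G; D \<in> gsets G;
        is_exponential G A X Y P D u f p p' q e; a \<in> carrier (tval R A)\<rbrakk>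
      \<Longrightarrow> tnm R X Y f (ttr R A X u a) = ttr R D Y q (tnm R P D p' (tres R P A e a))"

definition tambara_morphism ::
  "'g monoid \<Rightarrow> ('g, 'r) tambara \<Rightarrow> ('g, 's) tambara \<Rightarrow> ('g gset \<Rightarrow> 'r \<Rightarrow> 's) \<Rightarrow> bool" where
  "tambara_morphism G R S \<phi> \<longleftrightarrow>
     (\<forall>X\<in>gsets G. \<phi> X \<in> ring_hom (tval R X) (tval S X)) \<and>
     (\<forall>X\<in>gsets G. \<forall>Y\<in>gsets G. \<forall>f\<in>gmaps G X Y.
        (\<forall>a\<in>carrier (tval R Y). \<phi> X (tres R X Y f a) = tres S X Y f (\<phi> Y a)) \<and>
        (\<forall>a\<in>carrier (tval R X). \<phi> Y (ttr R X Y f a) = ttr S X Y f (\<phi> X a)) \<and>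
        (\<forall>a\<in>carrier (tval R X). \<phi> Y (tnm R X Y f a) = tnm S X Y f (\<phi> X a)))"


section \<open>Tambara ideals\<close>

text \<open>
  A Tambara ideal is a family \<open>K \<mapsto> I(G/K)\<close> indexed by the subgroups of \<open>G\<close>, extensional in \<open>K\<close>;
  inclusion of Tambara ideals is the pointwise order \<open>\<le>\<close> on such families.
\<close>

definition subgroups :: "'g monoid \<Rightarrow> 'g set set" where
  "subgroups G = {K. subgroup K G}"

definition tideals :: "'g monoid \<Rightarrow> ('g, 'r) tambara \<Rightarrow> ('g set \<Rightarrow> 'r set) set" where
  "tideals G R = {I \<in> extensional (subgroups G).
     (\<forall>K\<in>subgroups G. ideal (I K) (tval R (coset_gset G K))) \<and>
     (\<forall>K\<in>subgroups G. \<forall>L\<in>subgroups G. K \<subseteq> L \<longrightarrow>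
        (\<forall>a\<in>I K. ttr R (coset_gset G K) (coset_gset G L) (coset_proj G K L) a \<in> I L) \<and>
        (\<forall>a\<in>I K. tnm R (coset_gset G K) (coset_gset G L) (coset_proj G K L) a \<in> I L) \<and>
        (\<forall>a\<in>I L. tres R (coset_gset G K) (coset_gset G L) (coset_proj G K L) a \<in> I K)) \<and>
     (\<forall>K\<in>subgroups G. \<forall>g\<in>carrier G. \<forall>a\<in>I K.
        tres R (coset_gset G (conj_subgroup G g K)) (coset_gset G K) (coset_conj G g K) a
          \<in> I (conj_subgroup G g K))}"

text \<open>
  The extension of \<open>I\<close> to a finite \<open>G\<close>-set \<open>X\<close> by \<open>I(X \<squnion> Y) = I(X) \<times> I(Y)\<close>: the elements of \<open>R(X)\<close>
  whose component at every orbit of \<open>X\<close>, identified in any way with some \<open>G/K\<close>, lies in \<open>I(G/K)\<close>.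
\<close>

definition ideal_ext ::
  "'g monoid \<Rightarrow> ('g, 'r) tambara \<Rightarrow> ('g set \<Rightarrow> 'r set) \<Rightarrow> 'g gset \<Rightarrow> 'r set" where
  "ideal_ext G R I X = {a \<in> carrier (tval R X).
     \<forall>K\<in>subgroups G. \<forall>f\<in>gmaps G (coset_gset G K) X.
       inj_on f (pts (coset_gset G K)) \<longrightarrow> tres R (coset_gset G K) X f a \<in> I K}"

definition tunit :: "'g monoid \<Rightarrow> ('g, 'r) tambara \<Rightarrow> 'g set \<Rightarrow> 'r set" where
  "tunit G R = (\<lambda>K\<in>subgroups G. carrier (tval R (coset_gset G K)))"

definition tprod ::
  "'g monoid \<Rightarrow> ('g, 'r) tambara \<Rightarrow> ('g set \<Rightarrow> 'r set) \<Rightarrow> ('g set \<Rightarrow> 'r set) \<Rightarrow> 'g set \<Rightarrow> 'r set" where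
  "tprod G R I J = (\<lambda>K\<in>subgroups G. \<Inter>{M K | M. M \<in> tideals G R \<and>
     (\<forall>L\<in>subgroups G. ideal_prod (tval R (coset_gset G L)) (I L) (J L) \<subseteq> M L)})"

definition tprimes :: "'g monoid \<Rightarrow> ('g, 'r) tambara \<Rightarrow> ('g set \<Rightarrow> 'r set) set" where
  "tprimes G R = {\<pp> \<in> tideals G R. \<pp> \<noteq> tunit G R \<and>
     (\<forall>I\<in>tideals G R. \<forall>J\<in>tideals G R. tprod G R I J \<le> \<pp> \<longrightarrow> I \<le> \<pp> \<or> J \<le> \<pp>)}"

text \<open>\<open>V(I)\<close>, and the topology on the prime ideals whose closed sets are the \<open>V(I)\<close>.\<close>

definition tvanish :: "'g monoid \<Rightarrow> ('g, 'r) tambara \<Rightarrow> ('g set \<Rightarrow> 'r set) \<Rightarrow> ('g set \<Rightarrow> 'r set) set" where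
  "tvanish G R I = {\<pp> \<in> tprimes G R. I \<le> \<pp>}"

definition nakaoka_spec :: "'g monoid \<Rightarrow> ('g, 'r) tambara \<Rightarrow> ('g set \<Rightarrow> 'r set) topology" where
  "nakaoka_spec G R = topology (\<lambda>U. \<exists>I\<in>tideals G R. U = tprimes G R - tvanish G R I)"

definition tpreimage ::
  "'g monoid \<Rightarrow> ('g, 'r) tambara \<Rightarrow> ('g gset \<Rightarrow> 'r \<Rightarrow> 's) \<Rightarrow> ('g set \<Rightarrow> 's set) \<Rightarrow> 'g set \<Rightarrow> 'r set" where
  "tpreimage G R \<phi> J =
     (\<lambda>K\<in>subgroups G. {a \<in> carrier (tval R (coset_gset G K)). \<phi> (coset_gset G K) a \<in> J K})"


section \<open>Coinduction\<close>

definition coind :: "'g set \<Rightarrow> ('g, 'r) tambara \<Rightarrow> ('g, 'r) tambara" where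
  "coind H R = \<lparr>
     tval = (\<lambda>X. tval R (res_gset H X)),
     tres = (\<lambda>X Y. tres R (res_gset H X) (res_gset H Y)),
     ttr = (\<lambda>X Y. ttr R (res_gset H X) (res_gset H Y)),
     tnm = (\<lambda>X Y. tnm R (res_gset H X) (res_gset H Y))\<rparr>"

definition coind_morphism :: "'g set \<Rightarrow> ('g gset \<Rightarrow> 'r \<Rightarrow> 's) \<Rightarrow> 'g gset \<Rightarrow> 'r \<Rightarrow> 's" where
  "coind_morphism H \<phi> = (\<lambda>X. \<phi> (res_gset H X))"

definition coind_ideal ::
  "'g monoid \<Rightarrow> 'g set \<Rightarrow> ('g, 'r) tambara \<Rightarrow> ('g set \<Rightarrow> 'r set) \<Rightarrow> 'g set \<Rightarrow> 'r set" where
  "coind_ideal G H R I =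
     (\<lambda>K\<in>subgroups G. ideal_ext (G\<lparr>carrier := H\<rparr>) R I (res_gset H (coset_gset G K)))"


section \<open>Coinduction gives Tambara functors, and the spectrum is a topological space\<close>

lemma res_gset_sel [simp]:
  "pts (res_gset H X) = pts X" "act (res_gset H X) = restrict (act X) H"
  by (simp_all add: res_gset_def)

lemma gid_res_gset: "gid (res_gset H X) = gid X"
  by (simp add: gid_def)

lemma res_gset_in_gsets:
  assumes "subgroup H G" "group G" "X \<in> gsets G"
  shows "res_gset H X \<in> gsets (G\<lparr>carrier := H\<rparr>)"
proof -
  interpret A: group_hom G "BijGroup (pts X)" "act X"
    using assms(3) by (simp add: gsets_def group_action.group_hom)
  have "restrict (act X) H \<in> hom (G\<lparr>carrier := H\<rparr>) (BijGroup (pts X))"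
    using A.homh A.G.m_closed subgroup.mem_carrier[OF assms(1)] subgroup.m_closed[OF assms(1)]
    by (simp add: hom_def Pi_def)
  then have "group_action (G\<lparr>carrier := H\<rparr>) (pts X) (restrict (act X) H)"
    unfolding group_action_def group_hom_def group_hom_axioms_def
    using subgroup.subgroup_is_group[OF assms(1,2)] A.H.is_group by blast
  then show ?thesis
    using assms(3) by (simp add: gsets_def)
qed

lemma gmaps_res_gset:
  assumes "subgroup H G" "f \<in> gmaps G X Y"
  shows "f \<in> gmaps (G\<lparr>carrier := H\<rparr>) (res_gset H X) (res_gset H Y)"
  using assms subgroup.mem_carrier[OF assms(1)] by (auto simp: gmaps_def)

lemma is_coproduct_res_gset:
  assumes "subgroup H G" "is_coproduct G X Y Z i j"
  shows "is_coproduct (G\<lparr>carrier := H\<rparr>) (res_gset H X) (res_gset H Y) (res_gset H Z) i j"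
  using assms gmaps_res_gset[OF assms(1)] by (auto simp: is_coproduct_def)

lemma is_pullback_res_gset:
  assumes "subgroup H G" "is_pullback G X Y Z P f h p p'"
  shows "is_pullback (G\<lparr>carrier := H\<rparr>) (res_gset H X) (res_gset H Y) (res_gset H Z) (res_gset H P) f h p p'"
  using assms gmaps_res_gset[OF assms(1)] by (auto simp: is_pullback_def)

lemma is_exponential_res_gset:
  assumes "subgroup H G" "is_exponential G A X Y P D u f p p' q e"
  shows "is_exponential (G\<lparr>carrier := H\<rparr>) (res_gset H A) (res_gset H X) (res_gset H Y)
    (res_gset H P) (res_gset H D) u f p p' q e"
  using assms gmaps_res_gset[OF assms(1)] is_pullback_res_gset[OF assms(1)]
  by (simp add: is_exponential_def)

lemma tambara_functor_coind:
  assumes "group G" "finite (carrier G)" "subgroup H G" "tambara_functor (G\<lparr>carrier := H\<rparr>) R"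
  shows "tambara_functor G (coind H R)"
proof -
  interpret R: tambara_functor "G\<lparr>carrier := H\<rparr>" R by fact
  note X = res_gset_in_gsets[OF assms(3,1)]
  note f = gmaps_res_gset[OF assms(3)]
  note c = gid_res_gset[of H, symmetric]
  show ?thesis
  proof (rule tambara_functor.intro, goal_cases)
    case 1 show ?case by (rule assms(1))
  next
    case 2 show ?case by (rule assms(2))
  next
    case (3 Y) then show ?case by (simp add: coind_def R.val_cring X)
  next
    case (4 X Y f) then show ?case using R.res_hom[OF X X f] by (simp add: coind_def)
  next
    case (5 X Y f) then show ?case using R.tr_hom[OF X X f] by (simp add: coind_def)
  next
    case (6 X Y f) then show ?case using R.nm_hom[OF X X f] by (simp add: coind_def)
  next
    case (7 X Y f) then show ?case using R.nm_one[OF X X f] by (simp add: coind_def)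
  next
    case (8 X a) then show ?case using R.res_id[OF X] by (simp add: coind_def gid_res_gset)
  next
    case (9 X a) then show ?case using R.tr_id[OF X] by (simp add: coind_def gid_res_gset)
  next
    case (10 X a) then show ?case using R.nm_id[OF X] by (simp add: coind_def gid_res_gset)
  next
    case (11 X Y Z f h a) then show ?case
      using R.res_comp[OF X X X f f, of X Y Z] by (simp add: coind_def)
  next
    case (12 X Y Z f h a) then show ?case
      using R.tr_comp[OF X X X f f, of X Y Z] by (simp add: coind_def)
  next
    case (13 X Y Z f h a) then show ?case
      using R.nm_comp[OF X X X f f, of X Y Z] by (simp add: coind_def)
  next
    case (14 X) then show ?case using R.val_empty[OF X] by (simp add: coind_def)
  next
    case (15 X Y Z i j) then show ?case
      using R.val_coproduct[OF X X X is_coproduct_res_gset[OF assms(3)]] by (simp add: coind_def)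
  next
    case (16 X Y Z P f h p p' a) then show ?case
      using R.res_tr[OF X X X X is_pullback_res_gset[OF assms(3)]] by (simp add: coind_def)
  next
    case (17 X Y Z P f h p p' a) then show ?case
      using R.res_nm[OF X X X X is_pullback_res_gset[OF assms(3)]] by (simp add: coind_def)
  next
    case (18 A X Y P D u f p p' q e a) then show ?case
      using R.nm_tr[OF X X X X X is_exponential_res_gset[OF assms(3)]] by (simp add: coind_def)
  qed
qed

lemma tambara_morphism_coind:
  assumes "group G" "subgroup H G" "tambara_morphism (G\<lparr>carrier := H\<rparr>) R S \<phi>"
  shows "tambara_morphism G (coind H R) (coind H S) (coind_morphism H \<phi>)"
  using assms(3) res_gset_in_gsets[OF assms(2,1)] gmaps_res_gset[OF assms(2)]
  by (auto simp: tambara_morphism_def coind_def coind_morphism_def)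

lemma coset_gset_in_gsets:
  fixes G (structure)
  assumes "group G" "finite (carrier G)" "subgroup K G"
  shows "coset_gset G K \<in> gsets G"
proof -
  interpret group G by fact
  let ?E = "(lcosets\<^bsub>G\<^esub> K) \<times> {0::nat}"
  let ?a = "\<lambda>g. \<lambda>c\<in>?E. (g <#\<^bsub>G\<^esub> fst c, 0::nat)"
  have K: "K \<subseteq> carrier G" using assms(3) by (rule subgroup.subset)
  have sub: "C \<subseteq> carrier G" if "C \<in> lcosets\<^bsub>G\<^esub> K" for C
    using that l_coset_subset_G[OF K] by (auto simp: LCOSETS_def)
  have cl: "g <#\<^bsub>G\<^esub> C \<in> lcosets\<^bsub>G\<^esub> K" if "g \<in> carrier G" "C \<in> lcosets\<^bsub>G\<^esub> K" for g C
    using that lcos_m_assoc[OF K] by (auto simp: LCOSETS_def)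
  have E: "?a g \<in> ?E \<rightarrow> ?E" if "g \<in> carrier G" for g
    using cl[OF that] by auto
  have comp: "?a (g \<otimes> h) c = ?a g (?a h c)" if "g \<in> carrier G" "h \<in> carrier G" "c \<in> ?E" for g h c
    using that cl lcos_m_assoc[OF sub, of "fst c" g h] by auto
  have id: "?a \<one> c = c" if "c \<in> ?E" for c
    using that lcos_mult_one[OF sub] by auto
  have inv1: "?a (inv g) (?a g c) = c" if "g \<in> carrier G" "c \<in> ?E" for g c
    using comp[of "inv g" g c] id that by simp
  have inv2: "?a g (?a (inv g) c) = c" if "g \<in> carrier G" "c \<in> ?E" for g c
    using comp[of g "inv g" c] id that by simp
  have bij: "?a g \<in> Bij ?E" if g: "g \<in> carrier G" for g
  proof -
    have "bij_betw (?a g) ?E ?E"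
      by (rule bij_betwI[where g = "?a (inv g)"])
        (use E[OF g] E[OF inv_closed[OF g]] inv1[OF g] inv2[OF g] in blast)+
    then show ?thesis by (simp add: Bij_def)
  qed
  have "?a (g \<otimes> h) = compose ?E (?a g) (?a h)" if "g \<in> carrier G" "h \<in> carrier G" for g h
    using comp[OF that] by (intro extensionalityI[of _ ?E]) (auto simp: compose_def)
  then have "restrict ?a (carrier G) \<in> hom G (BijGroup ?E)"
    using bij by (simp add: hom_def BijGroup_def Pi_def)
  then have "group_action G ?E (restrict ?a (carrier G))"
    unfolding group_action_def group_hom_def group_hom_axioms_def
    using is_group group_BijGroup by blast
  moreover have "finite ?E"
    using assms(2) by (simp add: LCOSETS_def)
  ultimately show ?thesis
    by (simp add: gsets_def coset_gset_def)
qed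

lemma coset_proj_in_gmaps:
  fixes G (structure)
  assumes "group G" "subgroup K G" "subgroup L G" "K \<subseteq> L"
  shows "coset_proj G K L \<in> gmaps G (coset_gset G K) (coset_gset G L)"
proof -
  interpret group G by fact
  have K: "K \<subseteq> carrier G" and L: "L \<subseteq> carrier G"
    using assms by (auto dest: subgroup.subset)
  have KL: "K <#>\<^bsub>G\<^esub> L = L"
  proof
    show "K <#>\<^bsub>G\<^esub> L \<subseteq> L"
      using assms by (auto simp: set_mult_def intro: subgroup.m_closed)
    have "l \<in> K <#>\<^bsub>G\<^esub> L" if "l \<in> L" for l
      using that L subgroup.one_closed[OF assms(2)] by (force simp: set_mult_def)
    then show "L \<subseteq> K <#>\<^bsub>G\<^esub> L" by blast
  qed
  have eq: "(a <#\<^bsub>G\<^esub> K) <#>\<^bsub>G\<^esub> L = a <#\<^bsub>G\<^esub> L" if "a \<in> carrier G" for a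
    using set_mult_assoc[of "{a}" K L] that K L KL by (simp add: l_coset_eq_set_mult)
  show ?thesis
    using eq lcos_m_assoc[OF K] lcos_m_assoc[OF L]
    by (auto simp: gmaps_def coset_proj_def coset_gset_def LCOSETS_def)
qed

lemma subgroup_conj_subgroup:
  fixes G (structure)
  assumes "group G" "subgroup K G" "g \<in> carrier G"
  shows "subgroup (conj_subgroup G g K) G"
  using group.subgroup_conjugation_is_surj2[of G g K] assms
  by (simp add: conj_subgroup_def)

lemma conj_subgroup_coset:
  fixes G (structure)
  assumes "group G" "subgroup K G" "g \<in> carrier G" "a \<in> carrier G"
  shows "(a <#\<^bsub>G\<^esub> conj_subgroup G g K) #>\<^bsub>G\<^esub> g = (a \<otimes> g) <#\<^bsub>G\<^esub> K"
proof -
  interpret group G by fact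
  let ?L = "conj_subgroup G g K"
  have K: "K \<subseteq> carrier G" using assms by (auto dest: subgroup.subset)
  have L: "?L \<subseteq> carrier G" using subgroup_conj_subgroup[OF assms(1-3)] by (rule subgroup.subset)
  have gK: "g <#\<^bsub>G\<^esub> K \<subseteq> carrier G" using K assms(3) by (rule l_coset_subset_G)
  have "?L #>\<^bsub>G\<^esub> g = g <#\<^bsub>G\<^esub> K"
    using coset_mult_assoc[OF gK, of "inv g" g] assms(3) gK
    by (simp add: conj_subgroup_def)
  then show ?thesis
    using coset_assoc[OF assms(4,3) L] lcos_m_assoc[OF K assms(4,3)] by simp
qed

lemma coset_conj_in_gmaps:
  fixes G (structure)
  assumes "group G" "subgroup K G" "g \<in> carrier G"
  shows "coset_conj G g K \<in> gmaps G (coset_gset G (conj_subgroup G g K)) (coset_gset G K)"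
proof -
  interpret group G by fact
  let ?L = "conj_subgroup G g K"
  have K: "K \<subseteq> carrier G" using assms by (auto dest: subgroup.subset)
  have L: "?L \<subseteq> carrier G" using subgroup_conj_subgroup[OF assms] by (rule subgroup.subset)
  show ?thesis
    using conj_subgroup_coset[OF assms] assms(3) lcos_m_assoc[OF K] lcos_m_assoc[OF L]
    by (auto simp: gmaps_def coset_conj_def coset_gset_def LCOSETS_def m_assoc)
qed

lemma tunit_in_tideals:
  assumes "tambara_functor G R"
  shows "tunit G R \<in> tideals G R"
proof -
  interpret tambara_functor G R by fact
  have S: "coset_gset G K \<in> gsets G" if "K \<in> subgroups G" for K
    using that coset_gset_in_gsets[OF group finite_group] by (simp add: subgroups_def)
  have P: "coset_proj G K L \<in> gmaps G (coset_gset G K) (coset_gset G L)"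
    if "K \<in> subgroups G" "L \<in> subgroups G" "K \<subseteq> L" for K L
    using that coset_proj_in_gmaps[OF group] by (simp add: subgroups_def)
  have C: "conj_subgroup G g K \<in> subgroups G"
    "coset_conj G g K \<in> gmaps G (coset_gset G (conj_subgroup G g K)) (coset_gset G K)"
    if "K \<in> subgroups G" "g \<in> carrier G" for K g
    using that subgroup_conj_subgroup[OF group] coset_conj_in_gmaps[OF group] by (simp_all add: subgroups_def)
  have i: "ideal (carrier (tval R (coset_gset G K))) (tval R (coset_gset G K))"
    if "K \<in> subgroups G" for K
    using val_cring[OF S[OF that]] by (simp add: cring_def ring.oneideal)
  have t: "ttr R X Y f a \<in> carrier (tval R Y)" "tnm R X Y f a \<in> carrier (tval R Y)"
    if "X \<in> gsets G" "Y \<in> gsets G" "f \<in> gmaps G X Y" "a \<in> carrier (tval R X)" for X Y f a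
    using tr_hom[OF that(1-3)] nm_hom[OF that(1-3)] that(4) by (auto simp: hom_def)
  have r: "tres R X Y f a \<in> carrier (tval R X)"
    if "X \<in> gsets G" "Y \<in> gsets G" "f \<in> gmaps G X Y" "a \<in> carrier (tval R Y)" for X Y f a
    using res_hom[OF that(1-3)] that(4) by (auto simp: ring_hom_def)
  show ?thesis
    unfolding tideals_def tunit_def using i t r S P C by simp
qed

lemma Inter_tideals:
  assumes "group G" "\<I> \<subseteq> tideals G R" "\<I> \<noteq> {}"
  shows "(\<lambda>K\<in>subgroups G. \<Inter>{I K | I. I \<in> \<I>}) \<in> tideals G R" (is "?J \<in> _")
proof -
  have i: "ideal (I K) (tval R (coset_gset G K))" if "I \<in> \<I>" "K \<in> subgroups G" for I K
    using that assms(2) by (auto simp: tideals_def)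
  obtain I0 where I0: "I0 \<in> \<I>" using assms(3) by blast
  have "ideal (\<Inter>{I K | I. I \<in> \<I>}) (tval R (coset_gset G K))" if K: "K \<in> subgroups G" for K
    by (rule ring.i_Intersect) (use i[OF _ K] I0 in \<open>auto simp: ideal_def\<close>)
  moreover have "conj_subgroup G g K \<in> subgroups G" if "K \<in> subgroups G" "g \<in> carrier G" for K g
    using that subgroup_conj_subgroup[OF assms(1)] by (simp add: subgroups_def)
  moreover have "ttr R (coset_gset G K) (coset_gset G L) (coset_proj G K L) a \<in> I L"
    "tnm R (coset_gset G K) (coset_gset G L) (coset_proj G K L) a \<in> I L"
    if "I \<in> \<I>" "K \<in> subgroups G" "L \<in> subgroups G" "K \<subseteq> L" "a \<in> I K" for I K L a
    using that assms(2) by (auto simp: tideals_def)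
  moreover have "tres R (coset_gset G K) (coset_gset G L) (coset_proj G K L) a \<in> I K"
    if "I \<in> \<I>" "K \<in> subgroups G" "L \<in> subgroups G" "K \<subseteq> L" "a \<in> I L" for I K L a
    using that assms(2) by (auto simp: tideals_def)
  moreover have "tres R (coset_gset G (conj_subgroup G g K)) (coset_gset G K) (coset_conj G g K) a
      \<in> I (conj_subgroup G g K)"
    if "I \<in> \<I>" "K \<in> subgroups G" "g \<in> carrier G" "a \<in> I K" for I K g a
    using that assms(2) by (auto simp: tideals_def)
  moreover have "a \<in> ?J K \<longleftrightarrow> (\<forall>I\<in>\<I>. a \<in> I K)" if "K \<in> subgroups G" for K a
    using that by auto
  moreover have "?J K = \<Inter>{I K | I. I \<in> \<I>}" if "K \<in> subgroups G" for K
    using that by simp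
  ultimately show ?thesis
    unfolding tideals_def mem_Collect_eq
    by (intro conjI ballI impI restrict_extensional) (simp_all del: restrict_apply)
qed

lemma tideals_leI:
  assumes "I \<in> tideals G R" "J \<in> tideals G R" "\<And>K. K \<in> subgroups G \<Longrightarrow> I K \<subseteq> J K"
  shows "I \<le> J"
proof (rule le_funI)
  fix K show "I K \<subseteq> J K"
    using assms by (cases "K \<in> subgroups G") (auto simp: tideals_def extensional_def)
qed

lemma tideals_le_tunit:
  assumes "tambara_functor G R" "I \<in> tideals G R"
  shows "I \<le> tunit G R"
proof (rule tideals_leI[OF assms(2) tunit_in_tideals[OF assms(1)]])
  fix K assume K: "K \<in> subgroups G"
  then have "ideal (I K) (tval R (coset_gset G K))"
    using assms(2) by (simp add: tideals_def)
  then show "I K \<subseteq> tunit G R K"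
    using K by (simp add: tunit_def ideal.Icarr subsetI)
qed

lemma ideal_prod_le:
  assumes "ideal I R" "ideal J R"
  shows "ideal_prod R I J \<subseteq> I \<inter> J"
  using ring.ideal_prod_inter[OF _ assms] assms(1) by (simp add: ideal_def)

lemma tprod_tideals:
  assumes "tambara_functor G R" "I \<in> tideals G R" "J \<in> tideals G R"
  shows "tprod G R I J \<in> tideals G R" "tprod G R I J \<le> I" "tprod G R I J \<le> J"
proof -
  let ?\<M> = "{M \<in> tideals G R. \<forall>L\<in>subgroups G. ideal_prod (tval R (coset_gset G L)) (I L) (J L) \<subseteq> M L}"
  have "ideal (I L) (tval R (coset_gset G L))" "ideal (J L) (tval R (coset_gset G L))"
    if "L \<in> subgroups G" for L
    using that assms(2,3) by (simp_all add: tideals_def)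
  then have M: "I \<in> ?\<M>" "J \<in> ?\<M>"
    using assms(2,3) ideal_prod_le by blast+
  have eq: "tprod G R I J = (\<lambda>K\<in>subgroups G. \<Inter>{M K | M. M \<in> ?\<M>})"
    by (simp add: tprod_def)
  show *: "tprod G R I J \<in> tideals G R"
    unfolding eq using M by (intro Inter_tideals tambara_functor.group[OF assms(1)]) auto
  show "tprod G R I J \<le> I"
    by (rule tideals_leI[OF * assms(2)]) (use M in \<open>auto simp: eq\<close>)
  show "tprod G R I J \<le> J"
    by (rule tideals_leI[OF * assms(3)]) (use M in \<open>auto simp: eq\<close>)
qed

lemma tvanish_tprod:
  assumes "tambara_functor G R" "I \<in> tideals G R" "J \<in> tideals G R"
  shows "tvanish G R (tprod G R I J) = tvanish G R I \<union> tvanish G R J"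
proof -
  have "I \<le> \<pp> \<or> J \<le> \<pp>" if "\<pp> \<in> tprimes G R" "tprod G R I J \<le> \<pp>" for \<pp>
    using that assms(2,3) by (simp add: tprimes_def)
  moreover have "tprod G R I J \<le> \<pp>" if "I \<le> \<pp> \<or> J \<le> \<pp>" for \<pp>
    using that tprod_tideals(2,3)[OF assms] by (auto intro: order_trans)
  ultimately show ?thesis
    by (auto simp: tvanish_def)
qed

lemma tvanish_tunit:
  assumes "tambara_functor G R"
  shows "tvanish G R (tunit G R) = {}"
  using tideals_le_tunit[OF assms] by (force simp: tvanish_def tprimes_def)

lemma tvanish_Inter:
  assumes "tambara_functor G R" "\<I> \<subseteq> tideals G R"
  obtains J where "J \<in> tideals G R" "tvanish G R J = tprimes G R \<inter> (\<Inter>I\<in>\<I>. tvanish G R I)"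
proof -
  let ?\<M> = "{M \<in> tideals G R. \<forall>I\<in>\<I>. I \<le> M}"
  define J where "J = (\<lambda>K\<in>subgroups G. \<Inter>{M K | M. M \<in> ?\<M>})"
  have "tunit G R \<in> ?\<M>"
    using assms tideals_le_tunit tunit_in_tideals by blast
  then have J: "J \<in> tideals G R"
    unfolding J_def by (intro Inter_tideals tambara_functor.group[OF assms(1)]) auto
  have le: "J \<le> M" if "M \<in> ?\<M>" for M
    by (rule tideals_leI[OF J]) (use that in \<open>auto simp: J_def\<close>)
  have ge: "I \<le> J" if "I \<in> \<I>" for I
  proof (rule tideals_leI[OF _ J])
    show "I \<in> tideals G R" using that assms(2) by blast
    fix K assume "K \<in> subgroups G"
    then show "I K \<subseteq> J K" using that by (auto simp: J_def le_fun_def)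
  qed
  have "J \<le> \<pp> \<longleftrightarrow> (\<forall>I\<in>\<I>. I \<le> \<pp>)" if "\<pp> \<in> tprimes G R" for \<pp>
  proof
    show "\<forall>I\<in>\<I>. I \<le> \<pp>" if "J \<le> \<pp>"
      using order_trans[OF ge that] by blast
    show "J \<le> \<pp>" if "\<forall>I\<in>\<I>. I \<le> \<pp>"
      using that \<open>\<pp> \<in> tprimes G R\<close> by (intro le) (simp add: tprimes_def)
  qed
  then have "tvanish G R J = tprimes G R \<inter> (\<Inter>I\<in>\<I>. tvanish G R I)"
    by (auto simp: tvanish_def)
  with J show ?thesis by (rule that)
qed

lemma istopology_nakaoka:
  assumes "tambara_functor G R"
  shows "istopology (\<lambda>U. \<exists>I\<in>tideals G R. U = tprimes G R - tvanish G R I)"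
proof (unfold istopology_def, intro conjI allI impI)
  fix U U'
  assume "\<exists>I\<in>tideals G R. U = tprimes G R - tvanish G R I"
    and "\<exists>I\<in>tideals G R. U' = tprimes G R - tvanish G R I"
  then obtain I J where "I \<in> tideals G R" "U = tprimes G R - tvanish G R I"
    and "J \<in> tideals G R" "U' = tprimes G R - tvanish G R J" by blast
  then show "\<exists>I\<in>tideals G R. U \<inter> U' = tprimes G R - tvanish G R I"
    using tvanish_tprod[OF assms] tprod_tideals(1)[OF assms] by (intro bexI[of _ "tprod G R I J"]) auto
next
  fix \<U>
  assume *: "\<forall>U\<in>\<U>. \<exists>I\<in>tideals G R. U = tprimes G R - tvanish G R I"
  let ?\<I> = "{I \<in> tideals G R. tprimes G R - tvanish G R I \<in> \<U>}"
  obtain J where J: "J \<in> tideals G R" "tvanish G R J = tprimes G R \<inter> (\<Inter>I\<in>?\<I>. tvanish G R I)"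
    by (rule tvanish_Inter[OF assms, of ?\<I>]) auto
  have "\<Union>\<U> = tprimes G R - tvanish G R J"
  proof
    show "\<Union>\<U> \<subseteq> tprimes G R - tvanish G R J"
    proof
      fix \<pp> assume "\<pp> \<in> \<Union>\<U>"
      then obtain U where U: "U \<in> \<U>" "\<pp> \<in> U" by blast
      then obtain I where "I \<in> tideals G R" "U = tprimes G R - tvanish G R I" using * by blast
      then show "\<pp> \<in> tprimes G R - tvanish G R J" using U J(2) by auto
    qed
    show "tprimes G R - tvanish G R J \<subseteq> \<Union>\<U>" using J(2) by auto
  qed
  then show "\<exists>I\<in>tideals G R. \<Union>\<U> = tprimes G R - tvanish G R I"
    using J(1) by blast
qed

lemma openin_nakaoka_spec:
  assumes "tambara_functor G R"
  shows "openin (nakaoka_spec G R) U \<longleftrightarrow> (\<exists>I\<in>tideals G R. U = tprimes G R - tvanish G R I)"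
  unfolding nakaoka_spec_def using istopology_nakaoka[OF assms] by (simp add: topology_inverse')

lemma topspace_nakaoka_spec:
  assumes "tambara_functor G R"
  shows "topspace (nakaoka_spec G R) = tprimes G R"
  unfolding topspace_def openin_nakaoka_spec[OF assms]
  using tvanish_tunit[OF assms] tunit_in_tideals[OF assms] by blast

lemma closedin_nakaoka_spec:
  assumes "tambara_functor G R"
  shows "closedin (nakaoka_spec G R) C \<longleftrightarrow> (\<exists>I\<in>tideals G R. C = tvanish G R I)"
proof -
  have "tvanish G R I \<subseteq> tprimes G R" for I
    by (auto simp: tvanish_def)
  then show ?thesis
    unfolding closedin_def topspace_nakaoka_spec[OF assms] openin_nakaoka_spec[OF assms]
    by (metis double_diff order_refl Diff_subset)
qed

text \<open>The extension of a Tambara ideal restricts to the given ideals and takes coproducts to products.\<close>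

lemma gid_in_gmaps:
  assumes "X \<in> gsets G"
  shows "gid X \<in> gmaps G X X"
  using assms group_action.element_image[of G "pts X" "act X"]
  by (auto simp: gid_def gmaps_def gsets_def)

lemma compose_in_gmaps:
  assumes "X \<in> gsets G" "f \<in> gmaps G X Y" "h \<in> gmaps G Y Z"
  shows "compose (pts X) h f \<in> gmaps G X Z"
proof -
  have "act X g x \<in> pts X" if "g \<in> carrier G" "x \<in> pts X" for g x
    using group_action.element_image[of G "pts X" "act X" g x] assms(1) that by (simp add: gsets_def)
  moreover have "f x \<in> pts Y" if "x \<in> pts X" for x
    using assms(2) that by (auto simp: gmaps_def)
  moreover have "h y \<in> pts Z" if "y \<in> pts Y" for y
    using assms(3) that by (auto simp: gmaps_def)
  ultimately show ?thesis
    using assms(2,3) by (simp add: gmaps_def compose_def)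
qed

lemma inj_gmap_coset_gset:
  fixes G (structure)
  assumes "group G" "subgroup K G" "subgroup L G"
    and f: "f \<in> gmaps G (coset_gset G L) (coset_gset G K)" "inj_on f (pts (coset_gset G L))"
  obtains g where "g \<in> carrier G" "L = conj_subgroup G g K" "f = coset_conj G g K"
proof -
  interpret group G by fact
  have K: "K \<subseteq> carrier G" and L: "L \<subseteq> carrier G" using assms(2,3) by (auto dest: subgroup.subset)
  have pL: "(x <#\<^bsub>G\<^esub> L, 0) \<in> pts (coset_gset G L)" if "x \<in> carrier G" for x
    using that by (auto simp: coset_gset_def LCOSETS_def)
  have L1: "\<one> <#\<^bsub>G\<^esub> L = L" using L by (rule lcos_mult_one)
  have "f (L, 0) \<in> pts (coset_gset G K)"
    using f(1) pL[of \<one>] L1 by (auto simp: gmaps_def)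
  then obtain g where g: "g \<in> carrier G" "f (L, 0) = (g <#\<^bsub>G\<^esub> K, 0)"
    by (auto simp: coset_gset_def LCOSETS_def)
  have f_eq: "f (x <#\<^bsub>G\<^esub> L, 0) = ((x \<otimes> g) <#\<^bsub>G\<^esub> K, 0)" if x: "x \<in> carrier G" for x
  proof -
    have "f (act (coset_gset G L) x (L, 0)) = act (coset_gset G K) x (f (L, 0))"
      using f(1) pL[of \<one>] L1 x by (auto simp: gmaps_def)
    moreover have "act (coset_gset G L) x (L, 0) = (x <#\<^bsub>G\<^esub> L, 0)"
      using pL[of \<one>] L1 x by (simp add: coset_gset_def)
    moreover have "act (coset_gset G K) x (g <#\<^bsub>G\<^esub> K, 0) = (x <#\<^bsub>G\<^esub> (g <#\<^bsub>G\<^esub> K), 0)"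
      using x g(1) by (auto simp: coset_gset_def LCOSETS_def)
    ultimately show ?thesis
      using g lcos_m_assoc[OF K x g(1)] by simp
  qed
  have in_iff: "x \<in> M \<longleftrightarrow> x <#\<^bsub>G\<^esub> M = M" if "x \<in> carrier G" "subgroup M G" for x M
  proof
    show "x <#\<^bsub>G\<^esub> M = M" if "x \<in> M" using that \<open>subgroup M G\<close> \<open>x \<in> carrier G\<close> by (simp add: coset_join3)
    have "x \<otimes> \<one> \<in> x <#\<^bsub>G\<^esub> M"
      using subgroup.one_closed[OF \<open>subgroup M G\<close>] by (force simp: l_coset_def)
    then show "x \<in> M" if "x <#\<^bsub>G\<^esub> M = M" using that \<open>x \<in> carrier G\<close> by simp
  qed
  let ?C = "conj_subgroup G g K"
  have C: "subgroup ?C G" using subgroup_conj_subgroup[OF assms(1,2) g(1)] .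
  have C_sub: "?C \<subseteq> carrier G" using C by (rule subgroup.subset)
  have inC: "x \<in> ?C \<longleftrightarrow> (x \<otimes> g) <#\<^bsub>G\<^esub> K = g <#\<^bsub>G\<^esub> K" if x: "x \<in> carrier G" for x
  proof -
    have xC: "x <#\<^bsub>G\<^esub> ?C \<subseteq> carrier G" using C_sub x by (rule l_coset_subset_G)
    have e: "(x <#\<^bsub>G\<^esub> ?C) #>\<^bsub>G\<^esub> g = (x \<otimes> g) <#\<^bsub>G\<^esub> K"
      by (rule conj_subgroup_coset[OF assms(1,2) g(1) x])
    have e1: "?C #>\<^bsub>G\<^esub> g = g <#\<^bsub>G\<^esub> K"
      using conj_subgroup_coset[OF assms(1,2) g(1) one_closed] lcos_mult_one[OF C_sub] g(1) by simp
    have "M = (M #>\<^bsub>G\<^esub> g) #>\<^bsub>G\<^esub> inv g" if "M \<subseteq> carrier G" for M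
      using coset_mult_assoc[OF that g(1) inv_closed[OF g(1)]] that g(1) by simp
    then have "x <#\<^bsub>G\<^esub> ?C = ?C \<longleftrightarrow> (x <#\<^bsub>G\<^esub> ?C) #>\<^bsub>G\<^esub> g = ?C #>\<^bsub>G\<^esub> g"
      using xC C_sub by metis
    then show ?thesis using in_iff[OF x C] e e1 by simp
  qed
  have "x \<in> L \<longleftrightarrow> x \<in> ?C" if x: "x \<in> carrier G" for x
  proof -
    have "x <#\<^bsub>G\<^esub> L = L \<longleftrightarrow> f (x <#\<^bsub>G\<^esub> L, 0) = f (L, 0)"
      using inj_on_eq_iff[OF f(2) pL[OF x], of "(L, 0)"] pL[of \<one>] L1 by simp
    then show ?thesis
      using in_iff[OF x assms(3)] inC[OF x] f_eq[OF x] g(2) by simp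
  qed
  then have LC: "L = ?C" using L C_sub by blast
  have "f = coset_conj G g K"
  proof (rule extensionalityI[of _ "pts (coset_gset G L)"])
    show "f \<in> extensional (pts (coset_gset G L))" using f(1) by (simp add: gmaps_def PiE_def)
    show "coset_conj G g K \<in> extensional (pts (coset_gset G L))"
      using LC by (simp add: coset_conj_def)
    fix c assume c: "c \<in> pts (coset_gset G L)"
    then obtain x where x: "x \<in> carrier G" "c = (x <#\<^bsub>G\<^esub> L, 0)"
      by (auto simp: coset_gset_def LCOSETS_def)
    have "coset_conj G g K c = (fst c #>\<^bsub>G\<^esub> g, 0)"
      using c LC by (simp add: coset_conj_def)
    then show "f c = coset_conj G g K c"
      using conj_subgroup_coset[OF assms(1,2) g(1) x(1)] f_eq[OF x(1)] x(2) LC by simp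
  qed
  with g(1) LC show ?thesis by (rule that)
qed

lemma ideal_ext_coset_gset:
  assumes "tambara_functor G R" "I \<in> tideals G R" "K \<in> subgroups G"
  shows "ideal_ext G R I (coset_gset G K) = I K"
proof -
  interpret tambara_functor G R by fact
  have X: "coset_gset G K \<in> gsets G"
    using assms(3) coset_gset_in_gsets[OF group finite_group] by (simp add: subgroups_def)
  show ?thesis
  proof
    show "ideal_ext G R I (coset_gset G K) \<subseteq> I K"
    proof
      fix a assume a: "a \<in> ideal_ext G R I (coset_gset G K)"
      have "inj_on (gid (coset_gset G K)) (pts (coset_gset G K))"
        by (simp add: gid_def inj_on_def)
      then show "a \<in> I K"
        using a assms(3) gid_in_gmaps[OF X] res_id[OF X, of a] unfolding ideal_ext_def by force
    qed
    show "I K \<subseteq> ideal_ext G R I (coset_gset G K)"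
    proof
      fix a assume a: "a \<in> I K"
      have "ideal (I K) (tval R (coset_gset G K))"
        using assms(2,3) by (simp add: tideals_def)
      then have "a \<in> carrier (tval R (coset_gset G K))"
        using a by (rule ideal.Icarr)
      moreover have "tres R (coset_gset G L) (coset_gset G K) f a \<in> I L"
        if L: "L \<in> subgroups G" and f: "f \<in> gmaps G (coset_gset G L) (coset_gset G K)"
          "inj_on f (pts (coset_gset G L))" for L f
      proof -
        obtain g where "g \<in> carrier G" "L = conj_subgroup G g K" "f = coset_conj G g K"
          using inj_gmap_coset_gset[OF group _ _ f] L assms(3) by (auto simp: subgroups_def)
        then show ?thesis
          using assms(2,3) a by (simp add: tideals_def)
      qed
      ultimately show "a \<in> ideal_ext G R I (coset_gset G K)"
        by (simp add: ideal_ext_def)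
    qed
  qed
qed

lemma ideal_ext_coproduct:
  assumes "tambara_functor G R" and X: "X \<in> gsets G" "Y \<in> gsets G" "Z \<in> gsets G"
    and cop: "is_coproduct G X Y Z i j" and a: "a \<in> carrier (tval R Z)"
  shows "a \<in> ideal_ext G R I Z \<longleftrightarrow>
    tres R X Z i a \<in> ideal_ext G R I X \<and> tres R Y Z j a \<in> ideal_ext G R I Y"
proof -
  interpret tambara_functor G R by fact
  interpret G: group G by (rule group)
  have S: "coset_gset G K \<in> gsets G" if "K \<in> subgroups G" for K
    using that coset_gset_in_gsets[OF group finite_group] by (simp add: subgroups_def)
  have down: "tres R W Z i a \<in> ideal_ext G R I W"
    if "W \<in> gsets G" "i \<in> gmaps G W Z" "inj_on i (pts W)" "a \<in> ideal_ext G R I Z" for W i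
  proof -
    have "tres R W Z i a \<in> carrier (tval R W)"
      using res_hom[OF that(1) X(3) that(2)] a by (auto simp: ring_hom_def)
    moreover have "tres R (coset_gset G K) W f (tres R W Z i a) \<in> I K"
      if K: "K \<in> subgroups G" and f: "f \<in> gmaps G (coset_gset G K) W" "inj_on f (pts (coset_gset G K))"
      for K f
    proof -
      have "f ` pts (coset_gset G K) \<subseteq> pts W" using f(1) by (auto simp: gmaps_def)
      then have "inj_on (compose (pts (coset_gset G K)) i f) (pts (coset_gset G K))"
        using f(2) \<open>inj_on i (pts W)\<close> by (auto simp: inj_on_def compose_def image_subset_iff)
      then show ?thesis
        using \<open>a \<in> ideal_ext G R I Z\<close> K compose_in_gmaps[OF S[OF K] f(1) \<open>i \<in> gmaps G W Z\<close>]
          res_comp[OF S[OF K] \<open>W \<in> gsets G\<close> X(3) f(1) \<open>i \<in> gmaps G W Z\<close> a]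
        unfolding ideal_ext_def by force
    qed
    ultimately show ?thesis by (simp add: ideal_ext_def)
  qed
  have up: "tres R (coset_gset G K) Z f a \<in> I K"
    if W: "W \<in> gsets G" "i \<in> gmaps G W Z" "inj_on i (pts W)" "tres R W Z i a \<in> ideal_ext G R I W"
      and K: "K \<in> subgroups G" and f: "f \<in> gmaps G (coset_gset G K) Z" "inj_on f (pts (coset_gset G K))"
      and w: "w \<in> pts W" "f (K, 0) = i w" for W i K f w
  proof -
    let ?O = "coset_gset G K"
    have Ks: "K \<subseteq> carrier G" using K by (simp add: subgroups_def subgroup.subset)
    have K0: "(K, 0) \<in> pts ?O"
      using G.lcos_mult_one[OF Ks] G.one_closed by (force simp: coset_gset_def LCOSETS_def)
    have "f c \<in> i ` pts W" if c: "c \<in> pts ?O" for c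
    proof -
      obtain x where x: "x \<in> carrier G" "c = (x <#\<^bsub>G\<^esub> K, 0)"
        using c by (auto simp: coset_gset_def LCOSETS_def)
      have "c = act ?O x (K, 0)" using K0 x by (simp add: coset_gset_def)
      then have "f c = act Z x (i w)" using f(1) K0 x(1) w(2) by (simp add: gmaps_def)
      also have "\<dots> = i (act W x w)" using W(2) w(1) x(1) by (simp add: gmaps_def)
      finally show ?thesis
        using group_action.element_image[of G "pts W" "act W" x w] W(1) x(1) w(1)
        by (auto simp: gsets_def)
    qed
    note fi = this
    define h where "h = (\<lambda>c\<in>pts ?O. inv_into (pts W) i (f c))"
    have h: "h c \<in> pts W" "i (h c) = f c" if "c \<in> pts ?O" for c
      using fi[OF that] that by (simp_all add: h_def inv_into_into f_inv_into_f)
    have actO: "act ?O x c \<in> pts ?O" if "x \<in> carrier G" "c \<in> pts ?O" for x c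
      using group_action.element_image[of G "pts ?O" "act ?O" x c] S[OF K] that by (simp add: gsets_def)
    have actW: "act W x c \<in> pts W" if "x \<in> carrier G" "c \<in> pts W" for x c
      using group_action.element_image[of G "pts W" "act W" x c] W(1) that by (simp add: gsets_def)
    have i_act: "i (act W x c) = act Z x (i c)" if "x \<in> carrier G" "c \<in> pts W" for x c
      using W(2) that by (simp add: gmaps_def)
    have f_act: "f (act ?O x c) = act Z x (f c)" if "x \<in> carrier G" "c \<in> pts ?O" for x c
      using f(1) that by (simp add: gmaps_def)
    have "h (act ?O x c) = act W x (h c)" if xc: "x \<in> carrier G" "c \<in> pts ?O" for x c
      by (rule inj_onD[OF W(3) _ h(1)[OF actO[OF xc]] actW[OF xc(1) h(1)[OF xc(2)]]])
        (simp only: h(2)[OF actO[OF xc]] i_act[OF xc(1) h(1)[OF xc(2)]] h(2)[OF xc(2)] f_act[OF xc])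
    moreover have "h \<in> pts ?O \<rightarrow>\<^sub>E pts W"
      using h(1) by (intro PiE_I) (simp_all add: h_def)
    ultimately have hm: "h \<in> gmaps G ?O W"
      by (simp add: gmaps_def)
    have "inj_on h (pts ?O)"
    proof (rule inj_onI)
      fix c d assume cd: "c \<in> pts ?O" "d \<in> pts ?O" "h c = h d"
      then have "f c = f d" using h(2)[OF cd(1)] h(2)[OF cd(2)] by simp
      then show "c = d" using inj_onD[OF f(2)] cd(1,2) by blast
    qed
    then have "tres R ?O W h (tres R W Z i a) \<in> I K"
      using W(4) K hm unfolding ideal_ext_def by blast
    moreover have "compose (pts ?O) i h = f"
    proof (rule extensionalityI[of _ "pts ?O"])
      show "f \<in> extensional (pts ?O)" using f(1) by (simp add: gmaps_def PiE_def)
    qed (use h(2) in \<open>auto simp: compose_def\<close>)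
    ultimately show ?thesis
      using res_comp[OF S[OF K] W(1) X(3) hm W(2) a] by simp
  qed
  note c = cop[unfolded is_coproduct_def]
  show ?thesis
  proof
    assume "a \<in> ideal_ext G R I Z"
    then show "tres R X Z i a \<in> ideal_ext G R I X \<and> tres R Y Z j a \<in> ideal_ext G R I Y"
      using down X c by blast
  next
    assume r: "tres R X Z i a \<in> ideal_ext G R I X \<and> tres R Y Z j a \<in> ideal_ext G R I Y"
    have "tres R (coset_gset G K) Z f a \<in> I K"
      if K: "K \<in> subgroups G" and f: "f \<in> gmaps G (coset_gset G K) Z" "inj_on f (pts (coset_gset G K))"
      for K f
    proof -
      have Ks: "K \<subseteq> carrier G" using K by (simp add: subgroups_def subgroup.subset)
      have "(K, 0) \<in> pts (coset_gset G K)"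
        using G.lcos_mult_one[OF Ks] G.one_closed by (force simp: coset_gset_def LCOSETS_def)
      then have "f (K, 0) \<in> pts Z" using f(1) by (auto simp: gmaps_def)
      then have "f (K, 0) \<in> i ` pts X \<or> f (K, 0) \<in> j ` pts Y" using c by blast
      then show ?thesis
      proof
        assume "f (K, 0) \<in> i ` pts X"
        then obtain x where "x \<in> pts X" "f (K, 0) = i x" by blast
        then show ?thesis using up[OF X(1) _ _ _ K f, of i x] c r by simp
      next
        assume "f (K, 0) \<in> j ` pts Y"
        then obtain y where "y \<in> pts Y" "f (K, 0) = j y" by blast
        then show ?thesis using up[OF X(2) _ _ _ K f, of j y] c r by simp
      qed
    qed
    then show "a \<in> ideal_ext G R I Z" using a by (simp add: ideal_ext_def)
  qed
qed

end

theory Submission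
  imports Defs
begin

text \<open>
  A Tambara ideal \<open>I\<close> extends to all finite \<open>G\<close>-sets, and the extension is closed under restrictions,
  transfers and norms along surjections: decomposing into orbits reduces this to maps \<open>G/K \<rightarrow> G/L\<close>.
  Norms need surjectivity, because the norm of an element is a product over the orbits and
  the norm along \<open>\<emptyset> \<rightarrow> X\<close> is \<open>1\<close>.

  For \<open>L \<subseteq> H\<close> let \<open>\<eta> : H/L \<rightarrow> Res (G/L)\<close> be the inclusion.  Since \<open>R\<^sub>\<eta> T\<^sub>\<eta> = id\<close>, the coinduced ideal \<open>J\<close>
  determines \<open>I\<close> by \<open>a \<in> I(H/L) \<longleftrightarrow> T\<^sub>\<eta> a \<in> J(G/L)\<close>.  Conversely this formula defines a Tambara ideal for
  every \<open>J\<close>, because the squares relating \<open>\<eta>\<close> for \<open>K\<close> and \<open>L\<close> are pullbacks, and it coinduces to \<open>J\<close>,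
  because every map \<open>H/L \<rightarrow> Res (G/K)\<close> factors through \<open>\<eta>\<close>.

  For continuity of preimages under a morphism \<open>\<phi>\<close>, the Tambara ideal generated by \<open>\<phi>(I)\<close> consists of the
  elements \<open>T\<^sub>u(c \<phi>(i))\<close>; by Frobenius reciprocity the product of two such ideals is controlled by \<open>\<phi>(I J)\<close>.
\<close>

section \<open>Finite \<open>G\<close>-sets\<close>

text \<open>\<open>Res (G/K)\<close> is usually not transitive, so the value of
  \<open>CoInd I\<close> at \<open>G/K\<close> already involves the extension of \<open>I\<close>.
  Norms remain available because projections between orbits are onto, and restricting the group does
  not change that. In the other direction \<open>eta\<close> is a map over \<open>H\<close> only, so
  no closure property of a Tambara ideal \<open>J\<close> of the coinduced functor mentions
  \<open>T_eta\<close>. What connects them is Frobenius reciprocity,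
  \<open>T_eta(R_eta b) = T_eta(1) b\<close>: this uses only that \<open>J(G/L)\<close> is an ideal.
  Frobenius reciprocity is itself not an axiom of \<open>tambara_functor\<close>, which relates the
  operations only by base change and by distributivity of norms over transfers, so it is derived
  from distributivity. Primality is compared without computing any product ideal: a product lies
  below \<open>M\<close> as soon as products of single elements do. That preimages of primes are
  prime is not formal either, since norms are not additive; the distributive law is what keeps the
  elements \<open>T_u(c phi(i))\<close> stable under norms.\<close>

lemma gset_act_closed:
  "\<lbrakk>X \<in> gsets G; g \<in> carrier G; x \<in> pts X\<rbrakk> \<Longrightarrow> act X g x \<in> pts X"
  using group_action.element_image[of G "pts X" "act X"] by (simp add: gsets_def)

lemma gset_act_one: "\<lbrakk>X \<in> gsets G; x \<in> pts X\<rbrakk> \<Longrightarrow> act X \<one>\<^bsub>G\<^esub> x = x"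
  using group_action.id_eq_one[of G "pts X" "act X"] by (simp add: gsets_def) (metis restrict_apply')

lemma gset_act_mult:
  "\<lbrakk>X \<in> gsets G; g \<in> carrier G; h \<in> carrier G; x \<in> pts X\<rbrakk>
    \<Longrightarrow> act X (g \<otimes>\<^bsub>G\<^esub> h) x = act X g (act X h x)"
  using group_action.composition_rule[of G "pts X" "act X"] by (simp add: gsets_def)

lemma gset_group: "X \<in> gsets G \<Longrightarrow> group G"
  by (simp add: gsets_def group_action_def group_hom_def)

lemma gset_act_inv:
  assumes "X \<in> gsets G" "g \<in> carrier G" "x \<in> pts X"
  shows "act X (inv\<^bsub>G\<^esub> g) (act X g x) = x" "act X g (act X (inv\<^bsub>G\<^esub> g) x) = x"
proof -
  interpret group G using assms(1) by (rule gset_group)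
  show "act X (inv\<^bsub>G\<^esub> g) (act X g x) = x" "act X g (act X (inv\<^bsub>G\<^esub> g) x) = x"
    using gset_act_mult[of X G "inv\<^bsub>G\<^esub> g" g x] gset_act_mult[of X G g "inv\<^bsub>G\<^esub> g" x]
      gset_act_one[of X G x] assms by simp_all
qed

lemma gset_finite: "X \<in> gsets G \<Longrightarrow> finite (pts X)"
  by (simp add: gsets_def)

text \<open>Bijectivity of the action maps is not a hypothesis, since the inverse group element acts
  as the inverse map.\<close>

lemma gsetI:
  fixes G (structure)
  assumes "group G" "finite (pts X)" "act X \<in> extensional (carrier G)"
    and ext: "\<And>g. g \<in> carrier G \<Longrightarrow> act X g \<in> extensional (pts X)"
    and cl: "\<And>g x. \<lbrakk>g \<in> carrier G; x \<in> pts X\<rbrakk> \<Longrightarrow> act X g x \<in> pts X"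
    and one: "\<And>x. x \<in> pts X \<Longrightarrow> act X \<one> x = x"
    and mult: "\<And>g h x. \<lbrakk>g \<in> carrier G; h \<in> carrier G; x \<in> pts X\<rbrakk>
      \<Longrightarrow> act X (g \<otimes> h) x = act X g (act X h x)"
  shows "X \<in> gsets G"
proof -
  interpret group G by fact
  have inv: "act X (inv g) (act X g x) = x" "act X g (act X (inv g) x) = x"
    if "g \<in> carrier G" "x \<in> pts X" for g x
    using mult[of "inv g" g x] mult[of g "inv g" x] one that by simp_all
  have bij: "act X g \<in> Bij (pts X)" if g: "g \<in> carrier G" for g
  proof -
    have "bij_betw (act X g) (pts X) (pts X)"
      by (rule bij_betwI[where g = "act X (inv g)"]) (use g cl inv in auto)
    then show ?thesis using ext[OF g] by (simp add: Bij_def)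
  qed
  have "act X (g \<otimes> h) = compose (pts X) (act X g) (act X h)" if "g \<in> carrier G" "h \<in> carrier G" for g h
    using mult[OF that] ext[of "g \<otimes> h"] that
    by (intro extensionalityI[of _ "pts X"]) (auto simp: compose_def)
  then have "act X \<in> hom G (BijGroup (pts X))"
    using bij by (simp add: hom_def BijGroup_def Pi_def)
  then have "group_action G (pts X) (act X)"
    unfolding group_action_def group_hom_def group_hom_axioms_def
    using is_group group_BijGroup by blast
  then show ?thesis using assms(2,3) by (simp add: gsets_def)
qed

lemma gmap_mem: "\<lbrakk>f \<in> gmaps G X Y; x \<in> pts X\<rbrakk> \<Longrightarrow> f x \<in> pts Y"
  by (auto simp: gmaps_def)

lemma gmap_act:
  "\<lbrakk>f \<in> gmaps G X Y; g \<in> carrier G; x \<in> pts X\<rbrakk> \<Longrightarrow> f (act X g x) = act Y g (f x)"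
  by (simp add: gmaps_def)

lemma gmap_eqI:
  assumes "f \<in> gmaps G X Y" "h \<in> gmaps G X Z" "\<And>x. x \<in> pts X \<Longrightarrow> f x = h x"
  shows "f = h"
  using assms by (intro extensionalityI[of _ "pts X"]) (auto simp: gmaps_def PiE_def)

lemma restrict_in_gmaps:
  assumes "X \<in> gsets G" "\<And>x. x \<in> pts X \<Longrightarrow> f x \<in> pts Y"
    and "\<And>g x. \<lbrakk>g \<in> carrier G; x \<in> pts X\<rbrakk> \<Longrightarrow> f (act X g x) = act Y g (f x)"
  shows "restrict f (pts X) \<in> gmaps G X Y"
  using assms gset_act_closed[OF assms(1)] by (auto simp: gmaps_def)

lemma inv_gmap:
  assumes "X \<in> gsets G" "Y \<in> gsets G" "f \<in> gmaps G X Y" "bij_betw f (pts X) (pts Y)"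
  obtains h where "h \<in> gmaps G Y X" "\<And>x. x \<in> pts X \<Longrightarrow> h (f x) = x" "\<And>y. y \<in> pts Y \<Longrightarrow> f (h y) = y"
proof
  let ?h = "restrict (inv_into (pts X) f) (pts Y)"
  have inj: "inj_on f (pts X)" and im: "f ` pts X = pts Y" using assms(4) by (auto simp: bij_betw_def)
  show hf: "?h (f x) = x" if "x \<in> pts X" for x
    using that inj gmap_mem[OF assms(3)] by simp
  show "f (?h y) = y" if "y \<in> pts Y" for y
    using that im by (simp add: f_inv_into_f)
  show "?h \<in> gmaps G Y X"
  proof (rule restrict_in_gmaps[OF assms(2)])
    show "inv_into (pts X) f y \<in> pts X" if "y \<in> pts Y" for y
      using that im by (metis inv_into_into)
    fix g y assume g: "g \<in> carrier G" and "y \<in> pts Y"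
    then obtain x where x: "x \<in> pts X" "y = f x" using im by blast
    show "inv_into (pts X) f (act Y g y) = act X g (inv_into (pts X) f y)"
      using x g inj gmap_act[OF assms(3) g x(1)] gset_act_closed[OF assms(1) g x(1)]
      by (metis inv_into_f_f)
  qed
qed

text \<open>Constructions of \<open>G\<close>-sets are carried out on whatever type is convenient
  (pairs, sums, functions) and then moved by this lemma into the fixed type of points. The
  \<open>nat\<close> component has room for any finite set.\<close>

lemma gset_copy:
  fixes G :: "'g monoid" and \<rho> :: "'g \<Rightarrow> 'b \<Rightarrow> 'b"
  assumes "group G" "finite E"
    and cl: "\<And>g x. \<lbrakk>g \<in> carrier G; x \<in> E\<rbrakk> \<Longrightarrow> \<rho> g x \<in> E"
    and one: "\<And>x. x \<in> E \<Longrightarrow> \<rho> \<one>\<^bsub>G\<^esub> x = x"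
    and mult: "\<And>g h x. \<lbrakk>g \<in> carrier G; h \<in> carrier G; x \<in> E\<rbrakk> \<Longrightarrow> \<rho> (g \<otimes>\<^bsub>G\<^esub> h) x = \<rho> g (\<rho> h x)"
  shows "\<exists>(X :: 'g gset) c. X \<in> gsets G \<and> bij_betw c (pts X) E \<and>
    (\<forall>g\<in>carrier G. \<forall>w\<in>pts X. c (act X g w) = \<rho> g (c w))"
proof -
  interpret group G by fact
  obtain n :: "'b \<Rightarrow> nat" where n: "inj_on n E"
    using finite_imp_inj_to_nat_seg[OF assms(2)] by blast
  define b where "b = (\<lambda>x. ({} :: 'g set, n x))"
  have b: "inj_on b E" using n by (simp add: b_def inj_on_def)
  define c where "c = inv_into E b"
  have cb: "c (b x) = x" if "x \<in> E" for x using b that by (simp add: c_def)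
  define X where "X = \<lparr>pts = b ` E, act = (\<lambda>g\<in>carrier G. \<lambda>w\<in>b ` E. b (\<rho> g (c w)))\<rparr>"
  have pts: "pts X = b ` E" by (simp add: X_def)
  have act: "act X g (b x) = b (\<rho> g x)" if "g \<in> carrier G" "x \<in> E" for g x
    using that cb by (auto simp: X_def)
  have "X \<in> gsets G"
  proof (rule gsetI)
    show "act X \<in> extensional (carrier G)" by (simp add: X_def)
    show "act X g \<in> extensional (pts X)" if "g \<in> carrier G" for g using that by (simp add: X_def)
  qed (use assms(1,2) cl one mult act in \<open>auto simp: pts\<close>)
  moreover have "bij_betw c (pts X) E"
    unfolding pts c_def by (intro bij_betw_inv_into bij_betw_imageI b refl)
  moreover have "c (act X g w) = \<rho> g (c w)" if "g \<in> carrier G" "w \<in> pts X" for g w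
    using that cb act cl by (auto simp: pts)
  ultimately show ?thesis by blast
qed

section \<open>Pullbacks, coproducts and exponential diagrams\<close>

lemma pullback_exists:
  fixes X Y :: "'g gset"
  assumes X: "X \<in> gsets G" "Y \<in> gsets G" and f: "f \<in> gmaps G X Z" "h \<in> gmaps G Y Z"
  obtains P p p' where "P \<in> gsets G" "is_pullback G X Y Z P f h p p'"
proof -
  let ?E = "{w \<in> pts X \<times> pts Y. f (fst w) = h (snd w)}"
  let ?\<rho> = "\<lambda>g w. (act X g (fst w), act Y g (snd w))"
  have fin: "finite ?E"
    by (rule finite_subset[of _ "pts X \<times> pts Y"]) (auto simp: gset_finite[OF X(1)] gset_finite[OF X(2)])
  have "\<exists>(P :: 'g gset) c. P \<in> gsets G \<and> bij_betw c (pts P) ?E \<and>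
    (\<forall>g\<in>carrier G. \<forall>w\<in>pts P. c (act P g w) = ?\<rho> g (c w))"
    by (rule gset_copy[OF gset_group[OF X(1)] fin])
      (simp_all add: mem_Times_iff gset_act_closed[OF X(1)] gset_act_closed[OF X(2)]
        gmap_act[OF f(1)] gmap_act[OF f(2)] gset_act_one[OF X(1)] gset_act_one[OF X(2)]
        gset_act_mult[OF X(1)] gset_act_mult[OF X(2)])
  then obtain P :: "'g gset" and c where P: "P \<in> gsets G" "bij_betw c (pts P) ?E"
    "\<And>g w. \<lbrakk>g \<in> carrier G; w \<in> pts P\<rbrakk> \<Longrightarrow> c (act P g w) = ?\<rho> g (c w)" by blast
  have cE: "c w \<in> ?E" if "w \<in> pts P" for w using P(2) that by (rule bij_betw_apply)
  let ?p = "restrict (\<lambda>w. fst (c w)) (pts P)" and ?p' = "restrict (\<lambda>w. snd (c w)) (pts P)"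
  have p: "?p \<in> gmaps G P X" "?p' \<in> gmaps G P Y"
    using cE P(3) by (simp_all add: restrict_in_gmaps[OF P(1)] mem_Times_iff)
  have E: "?E = {(x, y). x \<in> pts X \<and> y \<in> pts Y \<and> f x = h y}" by fastforce
  have "bij_betw (\<lambda>w. (?p w, ?p' w)) (pts P) ?E"
    using P(2) by (rule bij_betw_cong[THEN iffD1, rotated]) simp
  then have "is_pullback G X Y Z P f h ?p ?p'"
    using p f unfolding is_pullback_def E by blast
  with that P(1) show ?thesis by blast
qed

lemma coproduct_exists:
  fixes X Y :: "'g gset"
  assumes X: "X \<in> gsets G" "Y \<in> gsets G"
  obtains Z i j where "Z \<in> gsets G" "is_coproduct G X Y Z i j"
proof -
  let ?E = "pts X <+> pts Y"
  let ?\<rho> = "\<lambda>g. map_sum (act X g) (act Y g)"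
  have fin: "finite ?E" using gset_finite[OF X(1)] gset_finite[OF X(2)] by simp
  have "\<exists>(Z :: 'g gset) c. Z \<in> gsets G \<and> bij_betw c (pts Z) ?E \<and>
    (\<forall>g\<in>carrier G. \<forall>w\<in>pts Z. c (act Z g w) = ?\<rho> g (c w))"
  proof (rule gset_copy[OF gset_group[OF X(1)] fin])
    show "?\<rho> g x \<in> ?E" if "g \<in> carrier G" "x \<in> ?E" for g x
      using that(2) gset_act_closed[OF X(1) that(1)] gset_act_closed[OF X(2) that(1)]
      by (elim PlusE) (simp_all add: InlI InrI)
    show "?\<rho> \<one>\<^bsub>G\<^esub> x = x" if "x \<in> ?E" for x
      using that gset_act_one[OF X(1)] gset_act_one[OF X(2)] by (elim PlusE) simp_all
    show "?\<rho> (g \<otimes>\<^bsub>G\<^esub> h) x = ?\<rho> g (?\<rho> h x)" if "g \<in> carrier G" "h \<in> carrier G" "x \<in> ?E" for g h x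
      using that(3) gset_act_mult[OF X(1) that(1,2)] gset_act_mult[OF X(2) that(1,2)]
      by (elim PlusE) simp_all
  qed
  then obtain Z :: "'g gset" and c where Z: "Z \<in> gsets G" and c: "bij_betw c (pts Z) ?E"
    and cact: "\<And>g w. \<lbrakk>g \<in> carrier G; w \<in> pts Z\<rbrakk> \<Longrightarrow> c (act Z g w) = ?\<rho> g (c w)" by blast
  define b where "b = inv_into (pts Z) c"
  have b: "bij_betw b ?E (pts Z)" unfolding b_def using c by (rule bij_betw_inv_into)
  have bZ: "b x \<in> pts Z" if "x \<in> ?E" for x using b that by (rule bij_betw_apply)
  have cb: "c (b x) = x" if "x \<in> ?E" for x
    unfolding b_def using c that by (rule bij_betw_inv_into_right)
  have bc: "b (c w) = w" if "w \<in> pts Z" for w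
    unfolding b_def using c that by (rule bij_betw_inv_into_left)
  have bact: "b (?\<rho> g x) = act Z g (b x)" if "g \<in> carrier G" "x \<in> ?E" for g x
    using cact[OF that(1) bZ[OF that(2)]] cb[OF that(2)] bc[OF gset_act_closed[OF Z that(1) bZ[OF that(2)]]]
    by simp
  let ?i = "restrict (\<lambda>x. b (Inl x)) (pts X)" and ?j = "restrict (\<lambda>x. b (Inr x)) (pts Y)"
  have "?i \<in> gmaps G X Z" "?j \<in> gmaps G Y Z"
    using bZ bact[OF _ InlI] bact[OF _ InrI] by (simp_all add: restrict_in_gmaps X InlI InrI)
  moreover have inj: "inj_on b ?E" using b by (rule bij_betw_imp_inj_on)
  have "inj_on ?i (pts X)" "inj_on ?j (pts Y)"
    using inj by (simp_all add: inj_on_def InlI InrI) blast+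
  moreover have "?i ` pts X = b ` Inl ` pts X" "?j ` pts Y = b ` Inr ` pts Y"
    by (simp_all add: image_image)
  moreover have "b ` Inl ` pts X \<inter> b ` Inr ` pts Y = b ` (Inl ` pts X \<inter> Inr ` pts Y)"
    by (rule inj_on_image_Int[OF inj, symmetric]) auto
  then have "b ` Inl ` pts X \<inter> b ` Inr ` pts Y = {}" by auto
  moreover have "b ` Inl ` pts X \<union> b ` Inr ` pts Y = pts Z"
    using bij_betw_imp_surj_on[OF b] by (simp add: Plus_def image_Un)
  ultimately have "is_coproduct G X Y Z ?i ?j"
    by (simp add: is_coproduct_def)
  with that Z show ?thesis by blast
qed


lemma pullbackD:
  assumes "is_pullback G X Y Z P f h p p'"
  shows "f \<in> gmaps G X Z" "h \<in> gmaps G Y Z" "p \<in> gmaps G P X" "p' \<in> gmaps G P Y"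
    "\<And>w. w \<in> pts P \<Longrightarrow> f (p w) = h (p' w)"
    "\<And>x y. \<lbrakk>x \<in> pts X; y \<in> pts Y; f x = h y\<rbrakk> \<Longrightarrow> \<exists>w\<in>pts P. p w = x \<and> p' w = y"
proof -
  note b = assms[unfolded is_pullback_def]
  show "f \<in> gmaps G X Z" "h \<in> gmaps G Y Z" "p \<in> gmaps G P X" "p' \<in> gmaps G P Y"
    using b by simp_all
  have im: "(\<lambda>w. (p w, p' w)) ` pts P = {(x, y). x \<in> pts X \<and> y \<in> pts Y \<and> f x = h y}"
    using b by (simp add: bij_betw_def)
  show "f (p w) = h (p' w)" if "w \<in> pts P" for w
    using imageI[OF that, of "\<lambda>w. (p w, p' w)"] unfolding im by simp
  show "\<exists>w\<in>pts P. p w = x \<and> p' w = y" if "x \<in> pts X" "y \<in> pts Y" "f x = h y" for x y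
  proof -
    have "(x, y) \<in> (\<lambda>w. (p w, p' w)) ` pts P" unfolding im using that by simp
    then show ?thesis by (rule imageE) (simp, blast)
  qed
qed

text \<open>The dependent product is built as the set of pairs of a point \<open>y\<close> and a
  section of \<open>u\<close> over the fibre at \<open>y\<close>. Sections are extensional on their
  fibre, which makes the set finite and the point \<open>d\<close> belonging to a section
  unique.\<close>

lemma exponential_exists:
  fixes A X Y :: "'g gset"
  assumes X: "A \<in> gsets G" "X \<in> gsets G" "Y \<in> gsets G" and u: "u \<in> gmaps G A X" and f: "f \<in> gmaps G X Y"
  obtains P D p p' q e where "P \<in> gsets G" "D \<in> gsets G" "is_exponential G A X Y P D u f p p' q e"
proof -
  interpret group G using X(1) by (rule gset_group)
  define fib where "fib y = {x \<in> pts X. f x = y}" for y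
  define S where "S y = (\<Pi>\<^sub>E x\<in>fib y. {a \<in> pts A. u a = x})" for y
  let ?E = "{w. fst w \<in> pts Y \<and> snd w \<in> S (fst w)}"
  \<comment> \<open>The group acts on sections by conjugation, \<open>s\<close> going to
    \<open>x |-> g s(g^-1 x)\<close>; a section over the fibre at \<open>y\<close> becomes one over
    the fibre at \<open>g y\<close>.\<close>
  define \<sigma> where "\<sigma> g w = (\<lambda>x\<in>fib (act Y g (fst w)). act A g (snd w (act X (inv\<^bsub>G\<^esub> g) x)))"
    for g and w :: "'g point \<times> ('g point \<Rightarrow> 'g point)"
  let ?\<rho> = "\<lambda>g w. (act Y g (fst w), \<sigma> g w)"
  have Sd: "s x \<in> pts A" "u (s x) = x" if "s \<in> S y" "x \<in> fib y" for s x y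
    using PiE_mem[of s "fib y" "\<lambda>x. {a \<in> pts A. u a = x}" x] that by (simp_all add: S_def)
  have Sx: "s \<in> extensional (fib y)" if "s \<in> S y" for s y
    using that by (simp add: S_def PiE_def)
  have fibX: "x \<in> pts X" "f x = y" if "x \<in> fib y" for x y using that by (simp_all add: fib_def)
  have fib_inv: "act X (inv\<^bsub>G\<^esub> g) x \<in> fib y"
    if "g \<in> carrier G" "y \<in> pts Y" "x \<in> fib (act Y g y)" for g x y
    using fibX[OF that(3)] that(1,2) gset_act_closed[OF X(2)] gmap_act[OF f] gset_act_inv(1)[OF X(3)]
    by (simp add: fib_def)
  have "finite ?E"
  proof -
    have "finite (Sigma (pts Y) S)"
      using gset_finite[OF X(1)] gset_finite[OF X(2)] gset_finite[OF X(3)]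
      unfolding S_def fib_def by (intro finite_SigmaI finite_PiE) simp_all
    moreover have "?E \<subseteq> Sigma (pts Y) S" by (auto simp: mem_Times_iff)
    ultimately show ?thesis by (rule rev_finite_subset)
  qed
  then have "\<exists>(D :: 'g gset) c. D \<in> gsets G \<and> bij_betw c (pts D) ?E \<and>
    (\<forall>g\<in>carrier G. \<forall>w\<in>pts D. c (act D g w) = ?\<rho> g (c w))"
  proof (rule gset_copy[OF is_group])
    show "?\<rho> g w \<in> ?E" if g: "g \<in> carrier G" and w: "w \<in> ?E" for g w
    proof -
      have w': "fst w \<in> pts Y" "snd w \<in> S (fst w)" using w by simp_all
      have "\<sigma> g w \<in> S (act Y g (fst w))"
        unfolding S_def \<sigma>_def
      proof (rule restrict_PiE_iff[THEN iffD2], rule ballI)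
        fix x assume x: "x \<in> fib (act Y g (fst w))"
        note x' = fib_inv[OF g w'(1) x]
        show "act A g (snd w (act X (inv\<^bsub>G\<^esub> g) x)) \<in> {a \<in> pts A. u a = x}"
          using Sd[OF w'(2) x'] g gset_act_closed[OF X(1) g] gmap_act[OF u g] gset_act_inv(2)[OF X(2) g]
            fibX[OF x] by simp
      qed
      then show ?thesis using gset_act_closed[OF X(3) g w'(1)] by simp
    qed
    show "?\<rho> \<one>\<^bsub>G\<^esub> w = w" if w: "w \<in> ?E" for w
    proof -
      have w': "fst w \<in> pts Y" "snd w \<in> S (fst w)" using w by simp_all
      have "\<sigma> \<one>\<^bsub>G\<^esub> w = snd w"
      proof (rule extensionalityI[of _ "fib (fst w)"])
        show "\<sigma> \<one>\<^bsub>G\<^esub> w \<in> extensional (fib (fst w))"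
          using gset_act_one[OF X(3) w'(1)] by (simp add: \<sigma>_def)
        show "\<sigma> \<one>\<^bsub>G\<^esub> w x = snd w x" if x: "x \<in> fib (fst w)" for x
          using gset_act_one[OF X(3) w'(1)] gset_act_one[OF X(2) fibX(1)[OF x]] x
            gset_act_one[OF X(1) Sd(1)[OF w'(2) x]] by (simp add: \<sigma>_def)
      qed (rule Sx[OF w'(2)])
      then show ?thesis using gset_act_one[OF X(3) w'(1)] by (simp add: prod_eq_iff)
    qed
    show "?\<rho> (g \<otimes>\<^bsub>G\<^esub> h) w = ?\<rho> g (?\<rho> h w)"
      if g: "g \<in> carrier G" and h: "h \<in> carrier G" and w: "w \<in> ?E" for g h w
    proof -
      have w': "fst w \<in> pts Y" "snd w \<in> S (fst w)" using w by simp_all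
      note m = gset_act_mult[OF X(3) g h w'(1)]
      have "\<sigma> (g \<otimes>\<^bsub>G\<^esub> h) w = \<sigma> g (?\<rho> h w)"
      proof (rule extensionalityI[of _ "fib (act Y g (act Y h (fst w)))"])
        show "\<sigma> (g \<otimes>\<^bsub>G\<^esub> h) w \<in> extensional (fib (act Y g (act Y h (fst w))))"
          using m by (simp add: \<sigma>_def)
        show "\<sigma> g (?\<rho> h w) \<in> extensional (fib (act Y g (act Y h (fst w))))"
          by (simp add: \<sigma>_def)
        fix x assume x: "x \<in> fib (act Y g (act Y h (fst w)))"
        have x1: "act X (inv\<^bsub>G\<^esub> g) x \<in> fib (act Y h (fst w))"
          by (rule fib_inv[OF g gset_act_closed[OF X(3) h w'(1)] x])
        have x2: "act X (inv\<^bsub>G\<^esub> h) (act X (inv\<^bsub>G\<^esub> g) x) \<in> fib (fst w)"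
          by (rule fib_inv[OF h w'(1) x1])
        have "act X (inv\<^bsub>G\<^esub> (g \<otimes>\<^bsub>G\<^esub> h)) x = act X (inv\<^bsub>G\<^esub> h) (act X (inv\<^bsub>G\<^esub> g) x)"
          using gset_act_mult[OF X(2) _ _ fibX(1)[OF x]] g h by (simp add: inv_mult_group)
        then show "\<sigma> (g \<otimes>\<^bsub>G\<^esub> h) w x = \<sigma> g (?\<rho> h w) x"
          using x x1 m gset_act_mult[OF X(1) g h Sd(1)[OF w'(2) x2]] by (simp add: \<sigma>_def)
      qed
      then show ?thesis using m by simp
    qed
  qed
  then obtain D :: "'g gset" and c where D: "D \<in> gsets G" and c: "bij_betw c (pts D) ?E"
    and cact: "\<And>g w. \<lbrakk>g \<in> carrier G; w \<in> pts D\<rbrakk> \<Longrightarrow> c (act D g w) = ?\<rho> g (c w)" by blast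
  have cE: "fst (c d) \<in> pts Y" "snd (c d) \<in> S (fst (c d))" if "d \<in> pts D" for d
    using bij_betw_apply[OF c that] by simp_all
  define q where "q = restrict (\<lambda>d. fst (c d)) (pts D)"
  have q: "q \<in> gmaps G D Y"
    unfolding q_def using cE cact by (intro restrict_in_gmaps[OF D]) simp_all
  obtain P p p' where P: "P \<in> gsets G" and pb: "is_pullback G X D Y P f q p p'"
    by (rule pullback_exists[OF X(2) D f q])
  note pbD = pullbackD[OF pb]
  have p'D: "p' w \<in> pts D" and pX: "p w \<in> pts X" if "w \<in> pts P" for w
    using gmap_mem[OF pbD(4) that] gmap_mem[OF pbD(3) that] by auto
  have pfib: "p w \<in> fib (fst (c (p' w)))" if "w \<in> pts P" for w
    using pbD(5)[OF that] pX[OF that] p'D[OF that] by (simp add: fib_def q_def)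
  define e where "e = restrict (\<lambda>w. snd (c (p' w)) (p w)) (pts P)"
  have e: "e \<in> gmaps G P A"
    unfolding e_def
  proof (rule restrict_in_gmaps[OF P])
    show "snd (c (p' w)) (p w) \<in> pts A" if "w \<in> pts P" for w
      by (rule Sd(1)[OF cE(2)[OF p'D[OF that]] pfib[OF that]])
    fix g w assume g: "g \<in> carrier G" and w: "w \<in> pts P"
    have "act X g (p w) \<in> fib (act Y g (fst (c (p' w))))"
      using pfib[OF w] gset_act_closed[OF X(2) g] gmap_act[OF f g] by (simp add: fib_def)
    then show "snd (c (p' (act P g w))) (p (act P g w)) = act A g (snd (c (p' w)) (p w))"
      using gmap_act[OF pbD(4) g w] gmap_act[OF pbD(3) g w] cact[OF g p'D[OF w]]
        gset_act_inv(1)[OF X(2) g pX[OF w]] by (simp add: \<sigma>_def)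
  qed
  have ue: "u (e w) = p w" if "w \<in> pts P" for w
    using Sd(2)[OF cE(2)[OF p'D[OF that]] pfib[OF that]] that by (simp add: e_def)
  have "\<exists>!d. d \<in> pts D \<and> q d = y \<and> (\<forall>w\<in>pts P. p' w = d \<longrightarrow> e w = s (p w))"
    if y: "y \<in> pts Y" and s: "\<forall>x\<in>pts X. f x = y \<longrightarrow> s x \<in> pts A \<and> u (s x) = x" for y s
  proof -
    have "restrict s (fib y) \<in> S y"
      using s by (simp add: S_def fib_def restrict_PiE_iff)
    then have "(y, restrict s (fib y)) \<in> ?E" using y by simp
    then obtain d where d: "d \<in> pts D" "c d = (y, restrict s (fib y))"
      using c unfolding bij_betw_def by (metis (no_types, lifting) imageE)
    show ?thesis
    proof (rule ex1I[of _ d], intro conjI ballI impI)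
      show "d \<in> pts D" by (rule d(1))
      show "q d = y" using d by (simp add: q_def)
      show "e w = s (p w)" if "w \<in> pts P" "p' w = d" for w
        using that d pfib[OF that(1)] by (simp add: e_def)
      fix d' assume d': "d' \<in> pts D \<and> q d' = y \<and> (\<forall>w\<in>pts P. p' w = d' \<longrightarrow> e w = s (p w))"
      then have fd': "fst (c d') = y" by (auto simp: q_def)
      have "snd (c d') = restrict s (fib y)"
      proof (rule extensionalityI[of _ "fib y"])
        show "snd (c d') \<in> extensional (fib y)" using Sx[OF cE(2)[of d']] d' fd' by simp
        fix x assume x: "x \<in> fib y"
        \<comment> \<open>Every point \<open>x\<close> of the fibre forms a point of the pullback
          together with \<open>d'\<close>, so the values of \<open>e\<close> recover the whole
          section stored in \<open>d'\<close>.\<close>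
        have "f x = q d'" using d' fibX(2)[OF x] by simp
        then obtain w where w: "w \<in> pts P" "p w = x" "p' w = d'"
          using pbD(6)[OF fibX(1)[OF x]] d' by metis
        then have "e w = s x" using d' by metis
        then show "snd (c d') x = restrict s (fib y) x" using w x by (simp add: e_def)
      qed simp
      then have "c d' = c d" using fd' d(2) by (simp add: prod_eq_iff)
      then show "d' = d"
        using bij_betw_imp_inj_on[OF c] d' d(1) by (metis inj_onD)
    qed
  qed
  then have "is_exponential G A X Y P D u f p p' q e"
    unfolding is_exponential_def using u e pb ue by blast
  with that P D show ?thesis by blast
qed

section \<open>Coset spaces, orbits and the maps out of them\<close>

context
  fixes G :: "'g monoid" (structure)
  assumes grp: "group G"
begin

interpretation group G by (rule grp)

lemma coset_base:
  assumes "subgroup K G"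
  shows "(K, 0) \<in> pts (coset_gset G K)"
proof -
  have "K = \<one> <# K" using lcos_mult_one[OF subgroup.subset[OF assms]] by simp
  then show ?thesis using one_closed by (auto simp: coset_gset_def LCOSETS_def)
qed

lemma coset_act_base:
  assumes "subgroup K G" "g \<in> carrier G"
  shows "act (coset_gset G K) g (K, 0) = (g <# K, 0)"
  using coset_base[OF assms(1)] assms(2) by (simp add: coset_gset_def)

lemma coset_ptE:
  assumes "subgroup K G" "c \<in> pts (coset_gset G K)"
  obtains g where "g \<in> carrier G" "c = act (coset_gset G K) g (K, 0)"
proof -
  obtain g where "g \<in> carrier G" "c = (g <# K, 0)"
    using assms(2) by (auto simp: coset_gset_def LCOSETS_def)
  then show ?thesis using that coset_act_base[OF assms(1)] by simp
qed

text \<open>A coset space is the orbit of its base point, and equivariance propagates the value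
  there.\<close>

lemma coset_gmap_eqI:
  assumes K: "subgroup K G" and f: "f \<in> gmaps G (coset_gset G K) X" "h \<in> gmaps G (coset_gset G K) X"
    and eq: "f (K, 0) = h (K, 0)"
  shows "f = h"
proof (rule gmap_eqI[OF f])
  fix c assume "c \<in> pts (coset_gset G K)"
  then obtain g where "g \<in> carrier G" "c = act (coset_gset G K) g (K, 0)" by (rule coset_ptE[OF K])
  then show "f c = h c" using eq gmap_act[OF f(1) _ coset_base[OF K]] gmap_act[OF f(2) _ coset_base[OF K]] by simp
qed

lemma coset_eq_iff:
  assumes "subgroup K G" "g \<in> carrier G" "h \<in> carrier G"
  shows "g <# K = h <# K \<longleftrightarrow> inv g \<otimes> h \<in> K"
proof
  assume "g <# K = h <# K"
  moreover have "h \<in> h <# K"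
    using subgroup.one_closed[OF assms(1)] assms(3) by (force simp: l_coset_def)
  ultimately obtain k where k: "k \<in> K" "h = g \<otimes> k" by (auto simp: l_coset_def)
  then have "inv g \<otimes> h = k"
    using subgroup.mem_carrier[OF assms(1)] assms(2) by (simp add: inv_solve_left')
  then show "inv g \<otimes> h \<in> K" using k by simp
next
  assume *: "inv g \<otimes> h \<in> K"
  have "h <# K = (g \<otimes> (inv g \<otimes> h)) <# K"
    using assms(2,3) by (simp add: m_assoc[symmetric])
  also have "\<dots> = g <# ((inv g \<otimes> h) <# K)"
    using subgroup.subset[OF assms(1)] assms(2,3) by (simp add: lcos_m_assoc)
  also have "\<dots> = g <# K"
    using * assms by (simp add: coset_join3)
  finally show "g <# K = h <# K" ..
qed

text \<open>Orbit and stabilizer: \<open>gK\<close> is sent to \<open>g x\<close>. This is well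
  defined because \<open>K\<close> fixes \<open>x\<close>, and injective once \<open>K\<close>
  contains everything that fixes \<open>x\<close>.\<close>

lemma orbit_map:
  assumes fin: "finite (carrier G)" and X: "X \<in> gsets G" and K: "subgroup K G"
    and x: "x \<in> pts X" "\<And>k. k \<in> K \<Longrightarrow> act X k x = x"
  obtains f where "f \<in> gmaps G (coset_gset G K) X" "f (K, 0) = x"
    "K = stabilizer G (act X) x \<Longrightarrow> inj_on f (pts (coset_gset G K))"
proof -
  \<comment> \<open>A coset is only a set, so a representative is chosen; \<open>key\<close> shows
    that the value does not depend on it.\<close>
  let ?r = "\<lambda>c. SOME g. g \<in> carrier G \<and> c = (g <# K, 0::nat)"
  define f where "f = restrict (\<lambda>c. act X (?r c) x) (pts (coset_gset G K))"
  have O: "coset_gset G K \<in> gsets G" using coset_gset_in_gsets[OF is_group fin K] .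
  have pt: "(g <# K, 0) \<in> pts (coset_gset G K)" if "g \<in> carrier G" for g
    using gset_act_closed[OF O that coset_base[OF K]] coset_act_base[OF K that] by simp
  have key: "act X g x = act X h x \<longleftrightarrow> act X (inv g \<otimes> h) x = x" if "g \<in> carrier G" "h \<in> carrier G" for g h
  proof -
    have "act X (inv g \<otimes> h) x = act X (inv g) (act X h x)"
      using gset_act_mult[OF X inv_closed that(2) x(1)] that(1) by simp
    then show ?thesis
      using gset_act_inv[OF X that(1) gset_act_closed[OF X that(2) x(1)]]
        gset_act_inv(1)[OF X that(1) x(1)] by auto
  qed
  have f: "f (g <# K, 0) = act X g x" if g: "g \<in> carrier G" for g
  proof -
    define r where "r = ?r (g <# K, 0)"
    have "r \<in> carrier G \<and> (g <# K, 0::nat) = (r <# K, 0)"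
      unfolding r_def by (rule someI[where P = "\<lambda>r. r \<in> carrier G \<and> (g <# K, 0::nat) = (r <# K, 0)"]) (use g in simp)
    then have r: "r \<in> carrier G" "g <# K = r <# K" by simp_all
    have "inv r \<otimes> g \<in> K"
      using coset_eq_iff[OF K r(1) g] r(2) by simp
    then have "act X r x = act X g x" using key[OF r(1) g] x(2) by simp
    then show ?thesis using pt[OF g] by (simp add: f_def r_def)
  qed
  have fact: "f (act (coset_gset G K) g (K, 0)) = act X g x" if "g \<in> carrier G" for g
    using f[OF that] coset_act_base[OF K that] by simp
  have "f \<in> gmaps G (coset_gset G K) X"
  proof -
    have "f c \<in> pts X \<and> (\<forall>h\<in>carrier G. f (act (coset_gset G K) h c) = act X h (f c))"
      if c: "c \<in> pts (coset_gset G K)" for c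
    proof -
      obtain g where g: "g \<in> carrier G" "c = act (coset_gset G K) g (K, 0)"
        by (rule coset_ptE[OF K c])
      show ?thesis
        using g fact gset_act_closed[OF X _ x(1)] gset_act_mult[OF O _ g(1) coset_base[OF K], symmetric]
          gset_act_mult[OF X _ g(1) x(1)] by simp
    qed
    then show ?thesis by (auto simp: gmaps_def f_def)
  qed
  moreover have "f (K, 0) = x"
    using f[OF one_closed] lcos_mult_one[OF subgroup.subset[OF K]] gset_act_one[OF X x(1)] by simp
  moreover have "inj_on f (pts (coset_gset G K))" if st: "K = stabilizer G (act X) x"
  proof (rule inj_onI)
    fix c d assume c: "c \<in> pts (coset_gset G K)" and d: "d \<in> pts (coset_gset G K)" and eq: "f c = f d"
    obtain g where g: "g \<in> carrier G" "c = act (coset_gset G K) g (K, 0)" by (rule coset_ptE[OF K c])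
    obtain h where h: "h \<in> carrier G" "d = act (coset_gset G K) h (K, 0)" by (rule coset_ptE[OF K d])
    have "act X (inv g \<otimes> h) x = x" using eq key g h fact by simp
    then have "inv g \<otimes> h \<in> K" using g(1) h(1) st by (simp add: stabilizer_def)
    then show "c = d" using coset_eq_iff[OF K g(1) h(1)] g h coset_act_base[OF K] by simp
  qed
  ultimately show ?thesis using that by blast
qed

lemma coset_proj_base:
  assumes "subgroup K G" "subgroup L G" "K \<subseteq> L"
  shows "coset_proj G K L (K, 0) = (L, 0)"
proof -
  have "K <#> L = L"
  proof
    show "K <#> L \<subseteq> L" using assms subgroup.m_closed[OF assms(2)] by (auto simp: set_mult_def)
    show "L \<subseteq> K <#> L"
      using subgroup.one_closed[OF assms(1)] subgroup.mem_carrier[OF assms(2)] by (force simp: set_mult_def)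
  qed
  then show ?thesis using coset_base[OF assms(1)] by (simp add: coset_proj_def)
qed

text \<open>Take for \<open>L\<close> the stabilizer of the image of the base point. The
  factorization reduces statements about all maps out of an orbit to projections and to embeddings
  of orbits, the two kinds that occur in the definitions of \<open>tideals\<close> and
  \<open>ideal_ext\<close>.\<close>

lemma gmap_coset_factor:
  assumes fin: "finite (carrier G)" and X: "X \<in> gsets G" and K: "subgroup K G"
    and f: "f \<in> gmaps G (coset_gset G K) X"
  obtains L i where "subgroup L G" "K \<subseteq> L" "i \<in> gmaps G (coset_gset G L) X"
    "inj_on i (pts (coset_gset G L))" "f = compose (pts (coset_gset G K)) i (coset_proj G K L)"
proof -
  let ?x = "f (K, 0)"
  let ?L = "stabilizer G (act X) ?x"
  have x: "?x \<in> pts X" by (rule gmap_mem[OF f coset_base[OF K]])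
  have L: "subgroup ?L G"
    using group_action.stabilizer_subgroup[of G "pts X" "act X"] X x by (simp add: gsets_def)
  have "k \<in> ?L" if k: "k \<in> K" for k
  proof -
    have kG: "k \<in> carrier G" using subgroup.mem_carrier[OF K k] .
    have "k <# K = K" using coset_join3[OF kG K k] .
    then have "act (coset_gset G K) k (K, 0) = (K, 0)" using coset_act_base[OF K kG] by simp
    then show ?thesis using gmap_act[OF f kG coset_base[OF K]] kG by (simp add: stabilizer_def)
  qed
  then have KL: "K \<subseteq> ?L" by blast
  obtain i where i: "i \<in> gmaps G (coset_gset G ?L) X" "i (?L, 0) = ?x" "inj_on i (pts (coset_gset G ?L))"
    using orbit_map[OF fin X L x] by (auto simp: stabilizer_def)
  have pr: "coset_proj G K ?L \<in> gmaps G (coset_gset G K) (coset_gset G ?L)"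
    by (rule coset_proj_in_gmaps[OF is_group K L KL])
  have "f = compose (pts (coset_gset G K)) i (coset_proj G K ?L)"
    by (rule coset_gmap_eqI[OF K f compose_in_gmaps[OF coset_gset_in_gsets[OF is_group fin K] pr i(1)]])
      (simp add: compose_def coset_base[OF K] coset_proj_base[OF K L KL] i(2))
  with that L KL i(1,3) show ?thesis by blast
qed

text \<open>The image is a nonempty invariant subset of a single orbit.\<close>

lemma gmap_coset_surj:
  assumes X: "X \<in> gsets G" and K: "subgroup K G" and f: "f \<in> gmaps G X (coset_gset G K)" and ne: "pts X \<noteq> {}"
    and fin: "finite (carrier G)"
  shows "f ` pts X = pts (coset_gset G K)"
proof
  show "f ` pts X \<subseteq> pts (coset_gset G K)" using gmap_mem[OF f] by blast
  obtain x where x: "x \<in> pts X" using ne by blast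
  have O: "coset_gset G K \<in> gsets G" using coset_gset_in_gsets[OF is_group fin K] .
  obtain g where g: "g \<in> carrier G" "f x = act (coset_gset G K) g (K, 0)"
    by (rule coset_ptE[OF K gmap_mem[OF f x]])
  show "pts (coset_gset G K) \<subseteq> f ` pts X"
  proof
    fix c assume "c \<in> pts (coset_gset G K)"
    then obtain h where h: "h \<in> carrier G" "c = act (coset_gset G K) h (K, 0)"
      by (rule coset_ptE[OF K])
    have "(K, 0) = act (coset_gset G K) (inv g) (f x)"
      using gset_act_inv(1)[OF O g(1) coset_base[OF K]] g(2) by simp
    then have "c = f (act X h (act X (inv g) x))"
      using gmap_act[OF f] g(1) h x gset_act_closed[OF X] by simp
    then show "c \<in> f ` pts X" using gset_act_closed[OF X] g(1) h(1) x by blast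
  qed
qed

end

section \<open>Invariant subsets, complements and maps out of coproducts\<close>

definition sub_gset :: "'g monoid \<Rightarrow> 'g gset \<Rightarrow> 'g point set \<Rightarrow> 'g gset" where
  "sub_gset G X S = \<lparr>pts = S, act = (\<lambda>g\<in>carrier G. restrict (act X g) S)\<rparr>"

lemma sub_gset_sel [simp]:
  "pts (sub_gset G X S) = S"
  "\<lbrakk>g \<in> carrier G; x \<in> S\<rbrakk> \<Longrightarrow> act (sub_gset G X S) g x = act X g x"
  by (simp_all add: sub_gset_def)

lemma sub_gset_in_gsets:
  fixes G (structure)
  assumes X: "X \<in> gsets G" and S: "S \<subseteq> pts X" "\<And>g x. \<lbrakk>g \<in> carrier G; x \<in> S\<rbrakk> \<Longrightarrow> act X g x \<in> S"
  shows "sub_gset G X S \<in> gsets G" "restrict id S \<in> gmaps G (sub_gset G X S) X"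
proof -
  interpret group G using X by (rule gset_group)
  show *: "sub_gset G X S \<in> gsets G"
  proof (rule gsetI[OF is_group], goal_cases)
    case 1 show ?case using finite_subset[OF S(1) gset_finite[OF X]] by simp
  next
    case 2 show ?case by (simp add: sub_gset_def)
  next
    case (3 g) then show ?case by (simp add: sub_gset_def)
  next
    case (4 g x) then show ?case using S(2) by simp
  next
    case (5 x) then show ?case using gset_act_one[OF X subsetD[OF S(1)]] by simp
  next
    case (6 g h x)
    then have "x \<in> S" "act X h x \<in> S" using S(2) by simp_all
    then show ?case using 6(1,2) gset_act_mult[OF X 6(1,2) subsetD[OF S(1)]] by simp
  qed
  show "restrict id S \<in> gmaps G (sub_gset G X S) X"
    using restrict_in_gmaps[OF *, of id X] subsetD[OF S(1)] S(2) by simp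
qed

lemma gmap_image_act:
  assumes "X \<in> gsets G" "f \<in> gmaps G X Y" "g \<in> carrier G" "y \<in> f ` pts X"
  shows "act Y g y \<in> f ` pts X"
  using assms(4) gmap_act[OF assms(2,3)] gset_act_closed[OF assms(1,3)] by (metis (no_types, lifting) image_iff)

text \<open>The complement of the image is invariant because group elements act invertibly. This
  allows one orbit at a time to be split off.\<close>

lemma complement_exists:
  assumes X: "X \<in> gsets G" "Z \<in> gsets G" and i: "i \<in> gmaps G X Z" "inj_on i (pts X)"
  obtains Y j where "Y \<in> gsets G" "is_coproduct G X Y Z i j"
proof -
  interpret group G using X(1) by (rule gset_group)
  let ?S = "pts Z - i ` pts X"
  have cl: "act Z g z \<in> ?S" if g: "g \<in> carrier G" and z: "z \<in> ?S" for g z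
  proof -
    have "z \<in> i ` pts X" if "act Z g z \<in> i ` pts X"
      using gmap_image_act[OF X(1) i(1) inv_closed[OF g] that] gset_act_inv(1)[OF X(2) g] z by simp
    then show ?thesis using z gset_act_closed[OF X(2) g] by blast
  qed
  note s = sub_gset_in_gsets[OF X(2) Diff_subset cl]
  have "is_coproduct G X (sub_gset G Z ?S) Z i (restrict id ?S)"
    unfolding is_coproduct_def using i s(2) gmap_mem[OF i(1)] by auto
  with that s(1) show ?thesis by blast
qed

lemma coproductD:
  assumes "is_coproduct G X Y Z i j"
  shows "i \<in> gmaps G X Z" "j \<in> gmaps G Y Z" "inj_on i (pts X)" "inj_on j (pts Y)"
    "i ` pts X \<inter> j ` pts Y = {}" "j ` pts Y \<inter> i ` pts X = {}"
  using assms by (auto simp: is_coproduct_def)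

lemma coproduct_cases:
  assumes "is_coproduct G X Y Z i j" "z \<in> pts Z"
  obtains x where "x \<in> pts X" "z = i x" | y where "y \<in> pts Y" "z = j y"
proof -
  have "z \<in> i ` pts X \<union> j ` pts Y" using assms by (simp add: is_coproduct_def)
  then show ?thesis using that by blast
qed

lemma coproduct_neq:
  assumes "is_coproduct G X Y Z i j" "x \<in> pts X" "y \<in> pts Y"
  shows "i x \<noteq> j y"
  using coproductD(5)[OF assms(1)] assms(2,3) by blast

lemma coproduct_copair:
  assumes X: "X \<in> gsets G" "Y \<in> gsets G" "Z \<in> gsets G" and c: "is_coproduct G X Y Z i j"
    and u: "u \<in> gmaps G X W" "v \<in> gmaps G Y W"
  obtains h where "h \<in> gmaps G Z W" "\<And>x. x \<in> pts X \<Longrightarrow> h (i x) = u x" "\<And>y. y \<in> pts Y \<Longrightarrow> h (j y) = v y"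
    "compose (pts X) h i = u" "compose (pts Y) h j = v"
proof -
  note ij = coproductD[OF c]
  define h where "h = restrict (\<lambda>z. if z \<in> i ` pts X then u (inv_into (pts X) i z) else v (inv_into (pts Y) j z)) (pts Z)"
  have hi: "h (i x) = u x" if "x \<in> pts X" for x
    using that ij(3) gmap_mem[OF ij(1) that] by (simp add: h_def)
  have hj: "h (j y) = v y" if "y \<in> pts Y" for y
  proof -
    have "j y \<notin> i ` pts X" using that ij(5) by blast
    then show ?thesis using that ij(4) gmap_mem[OF ij(2) that] by (simp add: h_def)
  qed
  have "restrict h (pts Z) \<in> gmaps G Z W"
  proof (rule restrict_in_gmaps[OF X(3)])
    show "h z \<in> pts W" if "z \<in> pts Z" for z
      by (rule coproduct_cases[OF c that]) (simp_all add: hi hj gmap_mem[OF u(1)] gmap_mem[OF u(2)])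
    show "h (act Z g z) = act W g (h z)" if g: "g \<in> carrier G" and z: "z \<in> pts Z" for g z
      by (rule coproduct_cases[OF c z])
        (simp_all add: hi hj gmap_act[OF u(1) g] gmap_act[OF u(2) g] gmap_act[OF ij(1) g, symmetric]
          gmap_act[OF ij(2) g, symmetric] gset_act_closed[OF X(1) g] gset_act_closed[OF X(2) g])
  qed
  moreover have "restrict h (pts Z) = h" by (simp add: h_def)
  ultimately have h: "h \<in> gmaps G Z W" by simp
  have "compose (pts X) h i = u"
    by (rule gmap_eqI[OF compose_in_gmaps[OF X(1) ij(1) h] u(1)]) (simp add: compose_def hi)
  moreover have "compose (pts Y) h j = v"
    by (rule gmap_eqI[OF compose_in_gmaps[OF X(2) ij(2) h] u(2)]) (simp add: compose_def hj)
  ultimately show ?thesis using that h hi hj by blast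
qed

text \<open>Injectivity means that the fibre product of \<open>i\<close> with itself is the
  diagonal. Base change along this square gives \<open>R_i T_i = id\<close> and
  \<open>R_i N_i = id\<close>.\<close>

lemma inj_pullback:
  assumes "X \<in> gsets G" "i \<in> gmaps G X Z" "inj_on i (pts X)"
  shows "is_pullback G X X Z X i i (gid X) (gid X)"
proof -
  have "bij_betw (\<lambda>x. (x, x)) (pts X) {(x, y). x \<in> pts X \<and> y \<in> pts X \<and> i x = i y}"
    using assms(3) by (intro bij_betwI[where g = fst]) (auto simp: inj_on_eq_iff)
  then have "bij_betw (\<lambda>w. (gid X w, gid X w)) (pts X) {(x, y). x \<in> pts X \<and> y \<in> pts X \<and> i x = i y}"
    by (rule bij_betw_cong[THEN iffD1, rotated]) (simp add: gid_def)
  then show ?thesis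
    using assms gid_in_gmaps[OF assms(1)] by (simp add: is_pullback_def)
qed

text \<open>For disjoint images base change passes through an empty \<open>G\<close>-set, whose ring
  is zero.\<close>

lemma disjoint_pullback:
  assumes X: "X \<in> gsets G" "Y \<in> gsets G" and i: "i \<in> gmaps G X Z" "j \<in> gmaps G Y Z"
    and "i ` pts X \<inter> j ` pts Y = {}"
  obtains E p p' where "E \<in> gsets G" "pts E = {}" "is_pullback G X Y Z E i j p p'"
proof -
  obtain E p p' where E: "E \<in> gsets G" "is_pullback G X Y Z E i j p p'"
    by (rule pullback_exists[OF X i])
  have "w \<notin> pts E" for w
    using pullbackD(5)[OF E(2), of w] gmap_mem[OF pullbackD(3)[OF E(2)], of w]
      gmap_mem[OF pullbackD(4)[OF E(2)], of w] assms(5) by blast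
  then show ?thesis using that E by blast
qed

section \<open>Transfers and norms along coproducts\<close>

context tambara_functor
begin

lemma res_closed:
  "\<lbrakk>X \<in> gsets G; Y \<in> gsets G; f \<in> gmaps G X Y; a \<in> carrier (tval R Y)\<rbrakk> \<Longrightarrow> tres R X Y f a \<in> carrier (tval R X)"
  by (rule ring_hom_closed[OF res_hom])

lemma tr_closed:
  "\<lbrakk>X \<in> gsets G; Y \<in> gsets G; f \<in> gmaps G X Y; a \<in> carrier (tval R X)\<rbrakk> \<Longrightarrow> ttr R X Y f a \<in> carrier (tval R Y)"
  by (frule (2) tr_hom) (auto simp: hom_def)

lemma nm_closed:
  "\<lbrakk>X \<in> gsets G; Y \<in> gsets G; f \<in> gmaps G X Y; a \<in> carrier (tval R X)\<rbrakk> \<Longrightarrow> tnm R X Y f a \<in> carrier (tval R Y)"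
  by (frule (2) nm_hom) (auto simp: hom_def)

lemma val_ring: "X \<in> gsets G \<Longrightarrow> ring (tval R X)"
  using val_cring by (simp add: cring_def)

lemma val_abelian_group: "X \<in> gsets G \<Longrightarrow> abelian_group (tval R X)"
  using val_ring by (simp add: ring_def)

lemma val_monoid: "X \<in> gsets G \<Longrightarrow> monoid (tval R X)"
  using val_ring by (simp add: ring_def)

lemma res_add:
  "\<lbrakk>X \<in> gsets G; Y \<in> gsets G; f \<in> gmaps G X Y; a \<in> carrier (tval R Y); b \<in> carrier (tval R Y)\<rbrakk>
    \<Longrightarrow> tres R X Y f (a \<oplus>\<^bsub>tval R Y\<^esub> b) = tres R X Y f a \<oplus>\<^bsub>tval R X\<^esub> tres R X Y f b"
  using ring_hom_add[OF res_hom] by blast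

lemma res_mult:
  "\<lbrakk>X \<in> gsets G; Y \<in> gsets G; f \<in> gmaps G X Y; a \<in> carrier (tval R Y); b \<in> carrier (tval R Y)\<rbrakk>
    \<Longrightarrow> tres R X Y f (a \<otimes>\<^bsub>tval R Y\<^esub> b) = tres R X Y f a \<otimes>\<^bsub>tval R X\<^esub> tres R X Y f b"
  using ring_hom_mult[OF res_hom] by blast

lemma tr_add:
  "\<lbrakk>X \<in> gsets G; Y \<in> gsets G; f \<in> gmaps G X Y; a \<in> carrier (tval R X); b \<in> carrier (tval R X)\<rbrakk>
    \<Longrightarrow> ttr R X Y f (a \<oplus>\<^bsub>tval R X\<^esub> b) = ttr R X Y f a \<oplus>\<^bsub>tval R Y\<^esub> ttr R X Y f b"
  by (frule (2) tr_hom) (simp add: hom_def)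

lemma nm_mult:
  "\<lbrakk>X \<in> gsets G; Y \<in> gsets G; f \<in> gmaps G X Y; a \<in> carrier (tval R X); b \<in> carrier (tval R X)\<rbrakk>
    \<Longrightarrow> tnm R X Y f (a \<otimes>\<^bsub>tval R X\<^esub> b) = tnm R X Y f a \<otimes>\<^bsub>tval R Y\<^esub> tnm R X Y f b"
  by (frule (2) nm_hom) (simp add: hom_def)

lemma tr_zero:
  assumes X: "X \<in> gsets G" "Y \<in> gsets G" "f \<in> gmaps G X Y"
  shows "ttr R X Y f \<zero>\<^bsub>tval R X\<^esub> = \<zero>\<^bsub>tval R Y\<^esub>"
proof -
  interpret group_hom "add_monoid (tval R X)" "add_monoid (tval R Y)" "ttr R X Y f"
    using tr_hom[OF X] abelian_group.a_group[OF val_abelian_group[OF X(1)]]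
      abelian_group.a_group[OF val_abelian_group[OF X(2)]]
    by (simp add: group_hom_def group_hom_axioms_def comm_group_def)
  show ?thesis using hom_one by simp
qed

lemma res_tr_inj:
  assumes "X \<in> gsets G" "Z \<in> gsets G" "i \<in> gmaps G X Z" "inj_on i (pts X)" "a \<in> carrier (tval R X)"
  shows "tres R X Z i (ttr R X Z i a) = a"
  using res_tr[OF assms(1,1,2,1) inj_pullback[OF assms(1,3,4)] assms(5)] assms(1,5)
  by (simp add: res_id tr_id)

lemma res_nm_inj:
  assumes "X \<in> gsets G" "Z \<in> gsets G" "i \<in> gmaps G X Z" "inj_on i (pts X)" "a \<in> carrier (tval R X)"
  shows "tres R X Z i (tnm R X Z i a) = a"
  using res_nm[OF assms(1,1,2,1) inj_pullback[OF assms(1,3,4)] assms(5)] assms(1,5)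
  by (simp add: res_id nm_id)

text \<open>In the zero ring over the empty set the restricted element equals both 0 and 1. Read as
  0 it is transferred to 0, read as 1 it has norm 1.\<close>

lemma
  assumes X: "X \<in> gsets G" "Y \<in> gsets G" "Z \<in> gsets G" and i: "i \<in> gmaps G X Z" "j \<in> gmaps G Y Z"
    and d: "i ` pts X \<inter> j ` pts Y = {}" and a: "a \<in> carrier (tval R X)"
  shows res_tr_disjoint: "tres R Y Z j (ttr R X Z i a) = \<zero>\<^bsub>tval R Y\<^esub>"
    and res_nm_disjoint: "tres R Y Z j (tnm R X Z i a) = \<one>\<^bsub>tval R Y\<^esub>"
proof -
  obtain E p p' where E: "E \<in> gsets G" "pts E = {}" and pb: "is_pullback G X Y Z E i j p p'"
    by (rule disjoint_pullback[OF X(1,2) i d])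
  note p = pullbackD(3,4)[OF pb]
  have "tres R E X p a = \<zero>\<^bsub>tval R E\<^esub>"
    using res_closed[OF E(1) X(1) p(1) a] val_empty[OF E] by simp
  then show "tres R Y Z j (ttr R X Z i a) = \<zero>\<^bsub>tval R Y\<^esub>"
    using res_tr[OF X(1-3) E(1) pb a] tr_zero[OF E(1) X(2) p(2)] by simp
  have "tres R E X p a = \<one>\<^bsub>tval R E\<^esub>"
    using res_closed[OF E(1) X(1) p(1) a] monoid.one_closed[OF val_monoid[OF E(1)]] val_empty[OF E] by simp
  then show "tres R Y Z j (tnm R X Z i a) = \<one>\<^bsub>tval R Y\<^esub>"
    using res_nm[OF X(1-3) E(1) pb a] nm_one[OF E(1) X(2) p(2)] by simp
qed

section \<open>Elements, transfers and norms over a coproduct\<close>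

context
  fixes X Y Z i j
  assumes X: "X \<in> gsets G" "Y \<in> gsets G" "Z \<in> gsets G" and c: "is_coproduct G X Y Z i j"
begin

private lemmas ij = coproductD[OF c]

lemma coproduct_eqI:
  assumes "a \<in> carrier (tval R Z)" "b \<in> carrier (tval R Z)"
    and "tres R X Z i a = tres R X Z i b" "tres R Y Z j a = tres R Y Z j b"
  shows "a = b"
proof -
  have "inj_on (\<lambda>a. (tres R X Z i a, tres R Y Z j a)) (carrier (tval R Z))"
    using val_coproduct[OF X c] by (simp add: ring_iso_def bij_betw_def)
  then show ?thesis using assms by (simp add: inj_on_def)
qed

lemma coproduct_pair:
  assumes "a \<in> carrier (tval R X)" "b \<in> carrier (tval R Y)"
  obtains d where "d \<in> carrier (tval R Z)" "tres R X Z i d = a" "tres R Y Z j d = b"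
proof -
  have "(\<lambda>a. (tres R X Z i a, tres R Y Z j a)) ` carrier (tval R Z) = carrier (tval R X) \<times> carrier (tval R Y)"
    using val_coproduct[OF X c] by (simp add: ring_iso_def bij_betw_def RDirProd_carrier)
  then have "(a, b) \<in> (\<lambda>a. (tres R X Z i a, tres R Y Z j a)) ` carrier (tval R Z)"
    using assms by simp
  then show ?thesis using that by auto
qed

text \<open>Compare both sides on the two summands: there one term restricts to the required
  component and the other one to 0. For norms the same comparison gives a product, the foreign
  factor restricting to 1.\<close>

lemma coproduct_sum:
  assumes a: "a \<in> carrier (tval R Z)"
  shows "a = ttr R X Z i (tres R X Z i a) \<oplus>\<^bsub>tval R Z\<^esub> ttr R Y Z j (tres R Y Z j a)"
proof -
  interpret RX: abelian_group "tval R X" by (rule val_abelian_group[OF X(1)])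
  interpret RY: abelian_group "tval R Y" by (rule val_abelian_group[OF X(2)])
  interpret RZ: abelian_group "tval R Z" by (rule val_abelian_group[OF X(3)])
  note r = res_closed[OF X(1,3) ij(1) a] res_closed[OF X(2,3) ij(2) a]
  note t = tr_closed[OF X(1,3) ij(1) r(1)] tr_closed[OF X(2,3) ij(2) r(2)]
  show ?thesis
  proof (rule coproduct_eqI[OF a RZ.a_closed[OF t]])
    show "tres R X Z i a = tres R X Z i (ttr R X Z i (tres R X Z i a) \<oplus>\<^bsub>tval R Z\<^esub> ttr R Y Z j (tres R Y Z j a))"
      using res_add[OF X(1,3) ij(1) t] res_tr_inj[OF X(1,3) ij(1,3) r(1)]
        res_tr_disjoint[OF X(2,1,3) ij(2,1,6) r(2)] r by simp
    show "tres R Y Z j a = tres R Y Z j (ttr R X Z i (tres R X Z i a) \<oplus>\<^bsub>tval R Z\<^esub> ttr R Y Z j (tres R Y Z j a))"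
      using res_add[OF X(2,3) ij(2) t] res_tr_inj[OF X(2,3) ij(2,4) r(2)]
        res_tr_disjoint[OF X(1,2,3) ij(1,2,5) r(1)] r by simp
  qed
qed

lemma coproduct_prod:
  assumes a: "a \<in> carrier (tval R Z)"
  shows "a = tnm R X Z i (tres R X Z i a) \<otimes>\<^bsub>tval R Z\<^esub> tnm R Y Z j (tres R Y Z j a)"
proof -
  interpret RX: monoid "tval R X" by (rule val_monoid[OF X(1)])
  interpret RY: monoid "tval R Y" by (rule val_monoid[OF X(2)])
  interpret RZ: monoid "tval R Z" by (rule val_monoid[OF X(3)])
  note r = res_closed[OF X(1,3) ij(1) a] res_closed[OF X(2,3) ij(2) a]
  note t = nm_closed[OF X(1,3) ij(1) r(1)] nm_closed[OF X(2,3) ij(2) r(2)]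
  show ?thesis
  proof (rule coproduct_eqI[OF a RZ.m_closed[OF t]])
    show "tres R X Z i a = tres R X Z i (tnm R X Z i (tres R X Z i a) \<otimes>\<^bsub>tval R Z\<^esub> tnm R Y Z j (tres R Y Z j a))"
      using res_mult[OF X(1,3) ij(1) t] res_nm_inj[OF X(1,3) ij(1,3) r(1)]
        res_nm_disjoint[OF X(2,1,3) ij(2,1,6) r(2)] r by simp
    show "tres R Y Z j a = tres R Y Z j (tnm R X Z i (tres R X Z i a) \<otimes>\<^bsub>tval R Z\<^esub> tnm R Y Z j (tres R Y Z j a))"
      using res_mult[OF X(2,3) ij(2) t] res_nm_inj[OF X(2,3) ij(2,4) r(2)]
        res_nm_disjoint[OF X(1,2,3) ij(1,2,5) r(1)] r by simp
  qed
qed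

lemma coproduct_tr:
  assumes W: "W \<in> gsets G" and h: "h \<in> gmaps G Z W" and a: "a \<in> carrier (tval R Z)"
  shows "ttr R Z W h a = ttr R X W (compose (pts X) h i) (tres R X Z i a)
    \<oplus>\<^bsub>tval R W\<^esub> ttr R Y W (compose (pts Y) h j) (tres R Y Z j a)"
proof -
  note r = res_closed[OF X(1,3) ij(1) a] res_closed[OF X(2,3) ij(2) a]
  note t = tr_closed[OF X(1,3) ij(1) r(1)] tr_closed[OF X(2,3) ij(2) r(2)]
  show ?thesis
    using arg_cong[OF coproduct_sum[OF a], of "ttr R Z W h"] tr_add[OF X(3) W h t]
      tr_comp[OF X(1,3) W ij(1) h r(1)] tr_comp[OF X(2,3) W ij(2) h r(2)] by simp
qed

lemma coproduct_nm:
  assumes W: "W \<in> gsets G" and h: "h \<in> gmaps G Z W" and a: "a \<in> carrier (tval R Z)"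
  shows "tnm R Z W h a = tnm R X W (compose (pts X) h i) (tres R X Z i a)
    \<otimes>\<^bsub>tval R W\<^esub> tnm R Y W (compose (pts Y) h j) (tres R Y Z j a)"
proof -
  note r = res_closed[OF X(1,3) ij(1) a] res_closed[OF X(2,3) ij(2) a]
  note t = nm_closed[OF X(1,3) ij(1) r(1)] nm_closed[OF X(2,3) ij(2) r(2)]
  show ?thesis
    using arg_cong[OF coproduct_prod[OF a], of "tnm R Z W h"] nm_mult[OF X(3) W h t]
      nm_comp[OF X(1,3) W ij(1) h r(1)] nm_comp[OF X(2,3) W ij(2) h r(2)] by simp
qed

end

text \<open>For isomorphisms, transfer and norm add nothing to restriction. \<open>tideals\<close>
  demands closure along conjugations for restrictions only, and this lemma supplies the other two
  operations.\<close>

lemma tr_nm_inverse: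
  assumes X: "X \<in> gsets G" "Y \<in> gsets G" and f: "f \<in> gmaps G X Y" "inj_on f (pts X)"
    and h: "h \<in> gmaps G Y X" "\<And>y. y \<in> pts Y \<Longrightarrow> f (h y) = y" and a: "a \<in> carrier (tval R X)"
  shows "ttr R X Y f a = tres R Y X h a" "tnm R X Y f a = tres R Y X h a"
proof -
  have fh: "compose (pts Y) f h = gid Y"
    using h(2) by (simp add: compose_def gid_def fun_eq_iff restrict_def)
  note t = tr_closed[OF X f(1) a] nm_closed[OF X f(1) a]
  show "ttr R X Y f a = tres R Y X h a"
    using res_comp[OF X(2,1,2) h(1) f(1) t(1)] fh res_tr_inj[OF X f a] res_id[OF X(2) t(1)] by simp
  show "tnm R X Y f a = tres R Y X h a"
    using res_comp[OF X(2,1,2) h(1) f(1) t(2)] fh res_nm_inj[OF X f a] res_id[OF X(2) t(2)] by simp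
qed

text \<open>Every element is the sum of the transfers of its restrictions to the orbits. Phrasing
  this as an induction principle for an additively closed set \<open>M\<close> avoids a sum indexed
  by orbits.\<close>

lemma orbit_decomposition:
  assumes X: "X \<in> gsets G" and a: "a \<in> carrier (tval R X)"
    and M: "\<zero>\<^bsub>tval R X\<^esub> \<in> M" "\<And>b c. \<lbrakk>b \<in> M; c \<in> M\<rbrakk> \<Longrightarrow> b \<oplus>\<^bsub>tval R X\<^esub> c \<in> M"
    and orb: "\<And>K f. \<lbrakk>subgroup K G; f \<in> gmaps G (coset_gset G K) X; inj_on f (pts (coset_gset G K))\<rbrakk>
      \<Longrightarrow> ttr R (coset_gset G K) X f (tres R (coset_gset G K) X f a) \<in> M"
  shows "a \<in> M"
proof -
  \<comment> \<open>The induction runs over injections \<open>i\<close> into \<open>X\<close> with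
    \<open>a\<close> fixed: splitting an orbit off \<open>Y\<close> leaves an injection from a
    smaller \<open>G\<close>-set, and the two transfers add up by
    \<open>coproduct_tr\<close>.\<close>
  have *: "ttr R Y X i (tres R Y X i a) \<in> M"
    if "Y \<in> gsets G" "i \<in> gmaps G Y X" "inj_on i (pts Y)" for Y i
    using that
  proof (induction "card (pts Y)" arbitrary: Y i rule: less_induct)
    case less
    note Y = less.prems(1) and i = less.prems(2,3)
    note b = res_closed[OF Y X i(1) a]
    show ?case
    proof (cases "pts Y = {}")
      case True
      then show ?thesis using b val_empty[OF Y True] tr_zero[OF Y X i(1)] M(1) by simp
    next
      case False
      then obtain y where y: "y \<in> pts Y" by blast
      let ?K = "stabilizer G (act Y) y"
      have K: "subgroup ?K G"
        using group_action.stabilizer_subgroup[of G "pts Y" "act Y"] Y y by (simp add: gsets_def)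
      note O = coset_gset_in_gsets[OF group finite_group K]
      obtain f where f: "f \<in> gmaps G (coset_gset G ?K) Y" "inj_on f (pts (coset_gset G ?K))"
      proof (rule orbit_map[OF group finite_group Y K y])
        show "act Y k y = y" if "k \<in> ?K" for k using that by (simp add: stabilizer_def)
      qed blast
      obtain Y' j where Y': "Y' \<in> gsets G" and c: "is_coproduct G (coset_gset G ?K) Y' Y f j"
        by (rule complement_exists[OF O Y f])
      note j = coproductD(2,4)[OF c]
      have inj: "inj_on (compose (pts W) i l) (pts W)"
        if "l \<in> gmaps G W Y" "inj_on l (pts W)" for l W
        using that(2) i(2) gmap_mem[OF that(1)] by (auto simp: inj_on_def compose_def)
      have "j ` pts Y' \<subset> pts Y"
        using gmap_mem[OF j(1)] gmap_mem[OF f(1) coset_base[OF group K]] coproductD(5)[OF c]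
          coset_base[OF group K] by blast
      then have "card (pts Y') < card (pts Y)"
        using psubset_card_mono[OF gset_finite[OF Y]] card_image[OF j(2)] by metis
      from less.hyps[OF this Y' compose_in_gmaps[OF Y' j(1) i(1)] inj[OF j]]
        orb[OF K compose_in_gmaps[OF O f(1) i(1)] inj[OF f]]
      show ?thesis
        using coproduct_tr[OF O Y' Y c X i(1) b] res_comp[OF O Y X f(1) i(1) a]
          res_comp[OF Y' Y X j(1) i(1) a] M(2) by simp
    qed
  qed
  have "inj_on (gid X) (pts X)" by (simp add: gid_def inj_on_def)
  from *[OF X gid_in_gmaps[OF X] this] show ?thesis
    using res_id[OF X a] tr_id[OF X a] by simp
qed

end

text \<open>Additive inverses arise as multiples by \<open>-1\<close>, and commutativity gives
  closure on the other side.\<close>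

lemma cring_idealI:
  assumes "cring A" "I \<subseteq> carrier A" "\<zero>\<^bsub>A\<^esub> \<in> I"
    and add: "\<And>a b. \<lbrakk>a \<in> I; b \<in> I\<rbrakk> \<Longrightarrow> a \<oplus>\<^bsub>A\<^esub> b \<in> I"
    and mult: "\<And>a x. \<lbrakk>a \<in> I; x \<in> carrier A\<rbrakk> \<Longrightarrow> x \<otimes>\<^bsub>A\<^esub> a \<in> I"
  shows "ideal I A"
proof -
  interpret cring A by fact
  have "\<ominus>\<^bsub>A\<^esub> a \<in> I" if "a \<in> I" for a
    using mult[OF that, of "\<ominus>\<^bsub>A\<^esub> \<one>\<^bsub>A\<^esub>"] that assms(2) by (simp add: l_minus subset_iff)
  then have "subgroup I (add_monoid A)"
    using assms(2,3) add by (intro subgroup.intro) (simp_all add: a_inv_def[symmetric])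
  moreover have "a \<otimes>\<^bsub>A\<^esub> x \<in> I" if "a \<in> I" "x \<in> carrier A" for a x
    using mult[OF that] that assms(2) by (simp add: m_comm subset_iff)
  ultimately show ?thesis using mult by (intro idealI) (simp_all add: ring_axioms)
qed

lemma pullbackI:
  assumes "f \<in> gmaps G X Z" "h \<in> gmaps G Y Z" "p \<in> gmaps G P X" "p' \<in> gmaps G P Y"
    and comm: "\<And>w. w \<in> pts P \<Longrightarrow> f (p w) = h (p' w)"
    and ex: "\<And>x y. \<lbrakk>x \<in> pts X; y \<in> pts Y; f x = h y\<rbrakk> \<Longrightarrow> \<exists>w\<in>pts P. p w = x \<and> p' w = y"
    and uniq: "\<And>w w'. \<lbrakk>w \<in> pts P; w' \<in> pts P; p w = p w'; p' w = p' w'\<rbrakk> \<Longrightarrow> w = w'"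
  shows "is_pullback G X Y Z P f h p p'"
proof -
  have "inj_on (\<lambda>w. (p w, p' w)) (pts P)" using uniq by (intro inj_onI) simp
  moreover have "(\<lambda>w. (p w, p' w)) ` pts P = {(x, y). x \<in> pts X \<and> y \<in> pts Y \<and> f x = h y}"
  proof (intro equalityI subsetI)
    fix z assume "z \<in> (\<lambda>w. (p w, p' w)) ` pts P"
    then show "z \<in> {(x, y). x \<in> pts X \<and> y \<in> pts Y \<and> f x = h y}"
      by (rule imageE) (simp add: gmap_mem[OF assms(3)] gmap_mem[OF assms(4)] comm)
  next
    fix z assume "z \<in> {(x, y). x \<in> pts X \<and> y \<in> pts Y \<and> f x = h y}"
    then obtain w where "w \<in> pts P" "p w = fst z" "p' w = snd z"
      using ex[of "fst z" "snd z"] by (simp add: case_prod_beta) blast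
    then show "z \<in> (\<lambda>w. (p w, p' w)) ` pts P" by (intro image_eqI[of _ _ w]) simp_all
  qed
  ultimately show ?thesis using assms(1-4) by (simp add: is_pullback_def bij_betw_def)
qed

section \<open>Frobenius reciprocity\<close>

context tambara_functor
begin

text \<open>
  Frobenius reciprocity comes from distributing the norm along the fold map \<open>Y \<squnion> Y \<rightarrow> Y\<close>, which is
  multiplication, over the transfer along \<open>u \<squnion> id : X \<squnion> Y \<rightarrow> Y \<squnion> Y\<close>.
\<close>

lemma tr_frobenius:
  assumes X: "X \<in> gsets G" "Y \<in> gsets G" and u: "u \<in> gmaps G X Y"
    and a: "a \<in> carrier (tval R X)" and b: "b \<in> carrier (tval R Y)"
  shows "ttr R X Y u (a \<otimes>\<^bsub>tval R X\<^esub> tres R X Y u b) = ttr R X Y u a \<otimes>\<^bsub>tval R Y\<^esub> b"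
proof -
  obtain A i j where A: "A \<in> gsets G" and cA: "is_coproduct G X Y A i j"
    by (rule coproduct_exists[OF X])
  obtain B k l where B: "B \<in> gsets G" and cB: "is_coproduct G Y Y B k l"
    by (rule coproduct_exists[OF X(2,2)])
  obtain P m n where P: "P \<in> gsets G" and cP: "is_coproduct G X X P m n"
    by (rule coproduct_exists[OF X(1,1)])
  note ij = coproductD[OF cA] and kl = coproductD[OF cB] and mn = coproductD[OF cP]
  have idX: "gid X x = x" if "x \<in> pts X" for x using that by (simp add: gid_def)
  have idY: "gid Y y = y" if "y \<in> pts Y" for y using that by (simp add: gid_def)
  have uY: "u x \<in> pts Y" if "x \<in> pts X" for x by (rule gmap_mem[OF u that])
  note ku = compose_in_gmaps[OF X(1) u kl(1)] and lu = compose_in_gmaps[OF X(1) u kl(2)]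
    and ju = compose_in_gmaps[OF X(1) u ij(2)]
  \<comment> \<open>Here \<open>A\<close> is \<open>X + Y\<close>, \<open>B\<close> is
    \<open>Y + Y\<close> and \<open>P\<close> is \<open>X + X\<close>. The map \<open>v\<close> is
    \<open>u + id\<close>, \<open>f\<close> is the fold map, \<open>p\<close> is
    \<open>u + u\<close>, \<open>p'\<close> is the fold map of \<open>X\<close>, and
    \<open>e\<close> is the identity on the first copy of \<open>X\<close> and \<open>u\<close> into
    \<open>Y\<close> on the second.\<close>
  obtain v where v: "v \<in> gmaps G A B" "\<And>x. x \<in> pts X \<Longrightarrow> v (i x) = compose (pts X) k u x"
    "\<And>y. y \<in> pts Y \<Longrightarrow> v (j y) = l y" "compose (pts X) v i = compose (pts X) k u" "compose (pts Y) v j = l"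
    by (rule coproduct_copair[OF X A cA ku kl(2)]) (rule that)
  obtain f where f: "f \<in> gmaps G B Y" "\<And>y. y \<in> pts Y \<Longrightarrow> f (k y) = gid Y y"
    "\<And>y. y \<in> pts Y \<Longrightarrow> f (l y) = gid Y y" "compose (pts Y) f k = gid Y" "compose (pts Y) f l = gid Y"
    by (rule coproduct_copair[OF X(2,2) B cB gid_in_gmaps[OF X(2)] gid_in_gmaps[OF X(2)]]) (rule that)
  obtain p where p: "p \<in> gmaps G P B" "\<And>x. x \<in> pts X \<Longrightarrow> p (m x) = compose (pts X) k u x"
    "\<And>x. x \<in> pts X \<Longrightarrow> p (n x) = compose (pts X) l u x"
    by (rule coproduct_copair[OF X(1,1) P cP ku lu]) (rule that)
  obtain p' where p': "p' \<in> gmaps G P X" "\<And>x. x \<in> pts X \<Longrightarrow> p' (m x) = gid X x"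
    "\<And>x. x \<in> pts X \<Longrightarrow> p' (n x) = gid X x" "compose (pts X) p' m = gid X" "compose (pts X) p' n = gid X"
    by (rule coproduct_copair[OF X(1,1) P cP gid_in_gmaps[OF X(1)] gid_in_gmaps[OF X(1)]]) (rule that)
  obtain e where e: "e \<in> gmaps G P A" "\<And>x. x \<in> pts X \<Longrightarrow> e (m x) = i x"
    "\<And>x. x \<in> pts X \<Longrightarrow> e (n x) = compose (pts X) j u x" "compose (pts X) e m = i"
    "compose (pts X) e n = compose (pts X) j u"
    by (rule coproduct_copair[OF X(1,1) P cP ij(1) ju]) (rule that)
  note ev = v(2,3) f(2,3) p(2,3) p'(2,3) e(2,3) idX idY compose_eq uY
  have mP: "m x \<in> pts P" "n x \<in> pts P" if "x \<in> pts X" for x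
    using gmap_mem[OF mn(1) that] gmap_mem[OF mn(2) that] by auto
  have pb: "is_pullback G B X Y P f u p p'"
  proof (rule pullbackI[OF f(1) u p(1) p'(1)])
    show "f (p w) = u (p' w)" if "w \<in> pts P" for w
      by (rule coproduct_cases[OF cP that]) (simp_all add: ev)
    show "\<exists>w\<in>pts P. p w = z \<and> p' w = x" if z: "z \<in> pts B" and x: "x \<in> pts X" and eq: "f z = u x" for z x
    proof (rule coproduct_cases[OF cB z])
      fix y assume "y \<in> pts Y" "z = k y"
      then show ?thesis using eq x mP by (intro bexI[of _ "m x"]) (simp_all add: ev)
    next
      fix y assume "y \<in> pts Y" "z = l y"
      then show ?thesis using eq x mP by (intro bexI[of _ "n x"]) (simp_all add: ev)
    qed
    show "w = w'" if w: "w \<in> pts P" "w' \<in> pts P" and eq: "p w = p w'" "p' w = p' w'" for w w'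
    proof -
      have ne: "k (u x) \<noteq> l (u x')" "l (u x) \<noteq> k (u x')" if "x \<in> pts X" "x' \<in> pts X" for x x'
        using coproduct_neq[OF cB uY[OF that(1)] uY[OF that(2)]]
          coproduct_neq[OF cB uY[OF that(2)] uY[OF that(1)]] by metis+
      show ?thesis
        by (rule coproduct_cases[OF cP w(1)]; rule coproduct_cases[OF cP w(2)])
          (use eq ne in \<open>simp_all add: ev\<close>)
    qed
  qed
  \<comment> \<open>The fibre of the fold map at \<open>y\<close> consists of two points. A section
    of \<open>v\<close> chooses some \<open>x\<close> over \<open>y\<close> at the first one and is
    forced at the second, so the dependent product is \<open>X\<close> over \<open>Y\<close> by way
    of \<open>u\<close>.\<close>
  have "is_exponential G A B Y P X v f p p' u e"
    unfolding is_exponential_def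
  proof (intro conjI ballI allI impI v(1) e(1) pb)
    show "v (e w) = p w" if "w \<in> pts P" for w
      by (rule coproduct_cases[OF cP that]) (simp_all add: ev)
    fix y s assume y: "y \<in> pts Y" and "\<forall>x\<in>pts B. f x = y \<longrightarrow> s x \<in> pts A \<and> v (s x) = x"
    then have s: "s (k y) \<in> pts A" "v (s (k y)) = k y" "s (l y) \<in> pts A" "v (s (l y)) = l y"
      using gmap_mem[OF kl(1) y] gmap_mem[OF kl(2) y] by (simp_all add: ev)
    obtain x where x: "x \<in> pts X" "s (k y) = i x"
    proof (rule coproduct_cases[OF cA s(1)])
      fix y' assume "y' \<in> pts Y" "s (k y) = j y'"
      then show ?thesis using s(2) coproduct_neq[OF cB y, of y'] by (auto simp: ev)
    qed
    have uxy: "u x = y" using s(2) x inj_onD[OF kl(3)] y by (simp add: ev)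
    have sl: "s (l y) = j y"
    proof (rule coproduct_cases[OF cA s(3)])
      fix x' assume "x' \<in> pts X" "s (l y) = i x'"
      then show ?thesis using s(4) coproduct_neq[OF cB uY y] by (simp add: ev)
    next
      fix y' assume "y' \<in> pts Y" "s (l y) = j y'"
      then show ?thesis using s(4) inj_onD[OF kl(4), of y' y] y by (auto simp: ev)
    qed
    show "\<exists>!d. d \<in> pts X \<and> u d = y \<and> (\<forall>w\<in>pts P. p' w = d \<longrightarrow> e w = s (p w))"
    proof (rule ex1I[of _ x], intro conjI ballI impI x(1) uxy)
      show "e w = s (p w)" if "w \<in> pts P" "p' w = x" for w
        by (rule coproduct_cases[OF cP that(1)]) (use that(2) x uxy sl in \<open>simp_all add: ev\<close>)
      show "d = x" if d: "d \<in> pts X \<and> u d = y \<and> (\<forall>w\<in>pts P. p' w = d \<longrightarrow> e w = s (p w))" for d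
      proof -
        have "e (m d) = s (p (m d))" using d mP(1)[of d] by (simp add: ev)
        then have "i d = i x" using d x by (simp add: ev)
        then show ?thesis using d x(1) inj_onD[OF ij(3)] by blast
      qed
    qed
  qed
  note nt = nm_tr[OF A B X(2) P X(1) this]
  \<comment> \<open>Apply distributivity to the element \<open>c\<close> with components
    \<open>a\<close> and \<open>b\<close>: transferring first and then multiplying gives
    \<open>T_u(a) b\<close>, while restricting, multiplying and then transferring gives
    \<open>T_u(a R_u(b))\<close>.\<close>
  obtain c where c: "c \<in> carrier (tval R A)" "tres R X A i c = a" "tres R Y A j c = b"
    by (rule coproduct_pair[OF X A cA a b])
  note tua = tr_closed[OF X u a] and tvc = tr_closed[OF A B v(1) c(1)] and rec = res_closed[OF P A e(1) c(1)]
  interpret RY: cring "tval R Y" by (rule val_cring[OF X(2)])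
  have "ttr R A B v c = ttr R Y B k (ttr R X Y u a) \<oplus>\<^bsub>tval R B\<^esub> ttr R Y B l b"
    using coproduct_tr[OF X A cA B v(1) c(1)] c(2,3) v(4,5) tr_comp[OF X B u kl(1) a] by simp
  then have "tres R Y B k (ttr R A B v c) = ttr R X Y u a" "tres R Y B l (ttr R A B v c) = b"
    using tua b res_add[OF X(2) B kl(1) tr_closed[OF X(2) B kl(1) tua] tr_closed[OF X(2) B kl(2) b]]
      res_add[OF X(2) B kl(2) tr_closed[OF X(2) B kl(1) tua] tr_closed[OF X(2) B kl(2) b]]
      res_tr_inj[OF X(2) B kl(1,3)] res_tr_inj[OF X(2) B kl(2,4)]
      res_tr_disjoint[OF X(2,2) B kl(1,2,5)] res_tr_disjoint[OF X(2,2) B kl(2,1,6)] by simp_all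
  then have "tnm R B Y f (ttr R A B v c) = ttr R X Y u a \<otimes>\<^bsub>tval R Y\<^esub> b"
    using coproduct_nm[OF X(2,2) B cB X(2) f(1) tvc] f(4,5) nm_id[OF X(2)] tua b by simp
  moreover have "tres R X P m (tres R P A e c) = a"
    using res_comp[OF X(1) P A mn(1) e(1) c(1)] e(4) c(2) by simp
  moreover have "tres R X P n (tres R P A e c) = tres R X Y u b"
    using res_comp[OF X(1) P A mn(2) e(1) c(1)] e(5) c(3) res_comp[OF X A u ij(2) c(1)] by simp
  moreover have "tnm R P X p' (tres R P A e c) = tres R X P m (tres R P A e c) \<otimes>\<^bsub>tval R X\<^esub> tres R X P n (tres R P A e c)"
    using coproduct_nm[OF X(1,1) P cP X(1) p'(1) rec] p'(4,5) nm_id[OF X(1)]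
      res_closed[OF X(1) P mn(1) rec] res_closed[OF X(1) P mn(2) rec] by simp
  ultimately show ?thesis using nt[OF c(1)] by simp
qed

section \<open>Tambara ideals along arbitrary maps of orbits\<close>

lemma tideal_ideal: "\<lbrakk>I \<in> tideals G R; subgroup K G\<rbrakk> \<Longrightarrow> ideal (I K) (tval R (coset_gset G K))"
  by (simp add: tideals_def subgroups_def)

lemma tideal_carrier: "\<lbrakk>I \<in> tideals G R; subgroup K G; a \<in> I K\<rbrakk> \<Longrightarrow> a \<in> carrier (tval R (coset_gset G K))"
  by (rule ideal.Icarr[OF tideal_ideal])

lemma coset_gset_closed: "subgroup K G \<Longrightarrow> coset_gset G K \<in> gsets G"
  by (rule coset_gset_in_gsets[OF group finite_group])

text \<open>The definition of \<open>tideals\<close> mentions projections and conjugations only. Any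
  map of orbits is a projection followed by an injection, and an injective map of orbits is a
  conjugation.\<close>

lemma tideal_gmap:
  assumes I: "I \<in> tideals G R" and K: "subgroup K G" and L: "subgroup L G"
    and f: "f \<in> gmaps G (coset_gset G K) (coset_gset G L)"
  shows "a \<in> I L \<Longrightarrow> tres R (coset_gset G K) (coset_gset G L) f a \<in> I K"
    and "a \<in> I K \<Longrightarrow> ttr R (coset_gset G K) (coset_gset G L) f a \<in> I L"
    and "a \<in> I K \<Longrightarrow> tnm R (coset_gset G K) (coset_gset G L) f a \<in> I L"
proof -
  note GK = coset_gset_closed[OF K] and GL = coset_gset_closed[OF L]
  obtain M i where M: "subgroup M G" "K \<subseteq> M" and i: "i \<in> gmaps G (coset_gset G M) (coset_gset G L)"
    "inj_on i (pts (coset_gset G M))" and fi: "f = compose (pts (coset_gset G K)) i (coset_proj G K M)"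
    by (rule gmap_coset_factor[OF group finite_group GL K f])
  note GM = coset_gset_closed[OF M(1)]
  note pr = coset_proj_in_gmaps[OF group K M]
  have conj: "tres R (coset_gset G A) (coset_gset G B) h b \<in> I A"
    if h: "subgroup A G" "subgroup B G" "h \<in> gmaps G (coset_gset G A) (coset_gset G B)"
      "inj_on h (pts (coset_gset G A))" "b \<in> I B" for A B h b
  proof -
    obtain g where "g \<in> carrier G" "A = conj_subgroup G g B" "h = coset_conj G g B"
      by (rule inj_gmap_coset_gset[OF group h(2,1,3,4)])
    then show ?thesis using I h(2,5) by (simp add: tideals_def subgroups_def)
  qed
  have proj: "ttr R (coset_gset G K) (coset_gset G M) (coset_proj G K M) b \<in> I M"
    "tnm R (coset_gset G K) (coset_gset G M) (coset_proj G K M) b \<in> I M" if "b \<in> I K" for b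
    using I K M that by (simp_all add: tideals_def subgroups_def)
  have projr: "tres R (coset_gset G K) (coset_gset G M) (coset_proj G K M) b \<in> I K" if "b \<in> I M" for b
    using I K M that by (simp add: tideals_def subgroups_def)
  have ne: "pts (coset_gset G M) \<noteq> {}" using coset_base[OF group M(1)] by blast
  \<comment> \<open>An injection between orbits is onto, so it has an equivariant inverse
    \<open>h\<close>. Restriction along \<open>h\<close>, again a conjugation, replaces the transfer
    and the norm along \<open>i\<close>.\<close>
  have "bij_betw i (pts (coset_gset G M)) (pts (coset_gset G L))"
    using i(2) gmap_coset_surj[OF group GM L i(1) ne finite_group] by (simp add: bij_betw_def)
  then obtain h where h: "h \<in> gmaps G (coset_gset G L) (coset_gset G M)"
    "\<And>y. y \<in> pts (coset_gset G L) \<Longrightarrow> i (h y) = y"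
    by (rule inv_gmap[OF GM GL i(1)]) (rule that)
  have hinj: "inj_on h (pts (coset_gset G L))" by (rule inj_on_inverseI[of _ i]) (rule h(2))
  show "tres R (coset_gset G K) (coset_gset G L) f a \<in> I K" if "a \<in> I L"
    using projr[OF conj[OF M(1) L i that]] res_comp[OF GK GM GL pr i(1) tideal_carrier[OF I L that]] fi by simp
  show "ttr R (coset_gset G K) (coset_gset G L) f a \<in> I L" if "a \<in> I K"
    using conj[OF L M(1) h(1) hinj proj(1)[OF that]] fi
      tr_comp[OF GK GM GL pr i(1) tideal_carrier[OF I K that]]
      tr_nm_inverse(1)[OF GM GL i h tideal_carrier[OF I M(1) proj(1)[OF that]]] by simp
  show "tnm R (coset_gset G K) (coset_gset G L) f a \<in> I L" if "a \<in> I K"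
    using conj[OF L M(1) h(1) hinj proj(2)[OF that]] fi
      nm_comp[OF GK GM GL pr i(1) tideal_carrier[OF I K that]]
      tr_nm_inverse(2)[OF GM GL i h tideal_carrier[OF I M(1) proj(2)[OF that]]] by simp
qed

section \<open>The extension of a Tambara ideal to all finite \<open>G\<close>-sets\<close>

context
  fixes I assumes I: "I \<in> tideals G R"
begin

lemma ideal_ext_carrier: "a \<in> ideal_ext G R I X \<Longrightarrow> a \<in> carrier (tval R X)"
  by (simp add: ideal_ext_def)

text \<open>The definition tests embedded orbits only. Any other map from \<open>G/K\<close> first
  projects onto the orbit that it meets, and \<open>I\<close> is closed under restriction along that
  projection.\<close>

lemma ideal_ext_res_coset:
  assumes X: "X \<in> gsets G" and a: "a \<in> ideal_ext G R I X" and K: "subgroup K G"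
    and f: "f \<in> gmaps G (coset_gset G K) X"
  shows "tres R (coset_gset G K) X f a \<in> I K"
proof -
  obtain L i where L: "subgroup L G" "K \<subseteq> L" and i: "i \<in> gmaps G (coset_gset G L) X"
    "inj_on i (pts (coset_gset G L))" and fi: "f = compose (pts (coset_gset G K)) i (coset_proj G K L)"
    by (rule gmap_coset_factor[OF group finite_group X K f])
  note pr = coset_proj_in_gmaps[OF group K L]
  have "tres R (coset_gset G L) X i a \<in> I L"
    using a L(1) i by (simp add: ideal_ext_def subgroups_def)
  then show ?thesis
    using tideal_gmap(1)[OF I K L(1) pr] fi
      res_comp[OF coset_gset_closed[OF K] coset_gset_closed[OF L(1)] X pr i(1) ideal_ext_carrier[OF a]]
    by simp
qed

lemma ideal_ext_res:
  assumes X: "X \<in> gsets G" "Y \<in> gsets G" and h: "h \<in> gmaps G X Y" and a: "a \<in> ideal_ext G R I Y"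
  shows "tres R X Y h a \<in> ideal_ext G R I X"
proof -
  have "tres R (coset_gset G K) X f (tres R X Y h a) \<in> I K"
    if K: "subgroup K G" and f: "f \<in> gmaps G (coset_gset G K) X" for K f
    using ideal_ext_res_coset[OF X(2) a K compose_in_gmaps[OF coset_gset_closed[OF K] f h]]
      res_comp[OF coset_gset_closed[OF K] X f h ideal_ext_carrier[OF a]] by simp
  then show ?thesis
    using res_closed[OF X h ideal_ext_carrier[OF a]] by (simp add: ideal_ext_def subgroups_def)
qed

lemma ideal_ext_ideal:
  assumes X: "X \<in> gsets G"
  shows "ideal (ideal_ext G R I X) (tval R X)"
proof (rule cring_idealI[OF val_cring[OF X]])
  interpret RX: cring "tval R X" by (rule val_cring[OF X])
  show "ideal_ext G R I X \<subseteq> carrier (tval R X)" using ideal_ext_carrier by blast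
  have zero: "tres R Y X f \<zero>\<^bsub>tval R X\<^esub> = \<zero>\<^bsub>tval R Y\<^esub>" if "Y \<in> gsets G" "f \<in> gmaps G Y X" for Y f
    using ring_hom_zero[OF res_hom[OF that(1) X that(2)] val_ring[OF X] val_ring[OF that(1)]] .
  have K: "additive_subgroup (I K) (tval R (coset_gset G K))" if "subgroup K G" for K
    using tideal_ideal[OF I that] by (rule ideal.axioms(1))
  show "\<zero>\<^bsub>tval R X\<^esub> \<in> ideal_ext G R I X"
    using zero[OF coset_gset_closed] additive_subgroup.zero_closed[OF K]
    by (simp add: ideal_ext_def subgroups_def)
  fix a assume a: "a \<in> ideal_ext G R I X"
  show "a \<oplus>\<^bsub>tval R X\<^esub> b \<in> ideal_ext G R I X" if b: "b \<in> ideal_ext G R I X" for b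
  proof -
    have "tres R (coset_gset G K) X f (a \<oplus>\<^bsub>tval R X\<^esub> b) \<in> I K"
      if "subgroup K G" "f \<in> gmaps G (coset_gset G K) X" for K f
      using res_add[OF coset_gset_closed[OF that(1)] X that(2) ideal_ext_carrier[OF a] ideal_ext_carrier[OF b]]
        additive_subgroup.a_closed[OF K[OF that(1)] ideal_ext_res_coset[OF X a that] ideal_ext_res_coset[OF X b that]]
      by simp
    then show ?thesis
      using ideal_ext_carrier[OF a] ideal_ext_carrier[OF b] by (simp add: ideal_ext_def subgroups_def)
  qed
  show "x \<otimes>\<^bsub>tval R X\<^esub> a \<in> ideal_ext G R I X" if x: "x \<in> carrier (tval R X)" for x
  proof -
    have "tres R (coset_gset G K) X f (x \<otimes>\<^bsub>tval R X\<^esub> a) \<in> I K"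
      if "subgroup K G" "f \<in> gmaps G (coset_gset G K) X" for K f
      using res_mult[OF coset_gset_closed[OF that(1)] X that(2) x ideal_ext_carrier[OF a]]
        ideal.I_l_closed[OF tideal_ideal[OF I that(1)] ideal_ext_res_coset[OF X a that]
          res_closed[OF coset_gset_closed[OF that(1)] X that(2) x]]
      by simp
    then show ?thesis
      using ideal_ext_carrier[OF a] x by (simp add: ideal_ext_def subgroups_def)
  qed
qed

text \<open>Membership is tested on maps from \<open>G/K\<close>, and base change turns each test
  into a transfer from the pullback \<open>P\<close> to \<open>G/K\<close>. Additivity of the
  transfer then permits treating the orbits of \<open>P\<close> separately.\<close>

lemma ideal_ext_tr:
  assumes X: "X \<in> gsets G" "Y \<in> gsets G" and h: "h \<in> gmaps G X Y" and a: "a \<in> ideal_ext G R I X"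
  shows "ttr R X Y h a \<in> ideal_ext G R I Y"
proof -
  note ac = ideal_ext_carrier[OF a]
  have "tres R (coset_gset G K) Y f (ttr R X Y h a) \<in> I K"
    if K: "subgroup K G" and f: "f \<in> gmaps G (coset_gset G K) Y" for K f
  proof -
    note GK = coset_gset_closed[OF K]
    obtain P p p' where P: "P \<in> gsets G" and pb: "is_pullback G X (coset_gset G K) Y P h f p p'"
      by (rule pullback_exists[OF X(1) GK h f])
    note p = pullbackD(3,4)[OF pb]
    let ?b = "tres R P X p a"
    have b: "?b \<in> ideal_ext G R I P" by (rule ideal_ext_res[OF P X(1) p(1) a])
    note bc = ideal_ext_carrier[OF b]
    interpret RP: cring "tval R P" by (rule val_cring[OF P])
    interpret IK: ideal "I K" "tval R (coset_gset G K)" by (rule tideal_ideal[OF I K])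
    \<comment> \<open>Membership in the ring is made part of the set, since additivity of the
      transfer is available for ring elements only.\<close>
    have "?b \<in> {c \<in> carrier (tval R P). ttr R P (coset_gset G K) p' c \<in> I K}"
    proof (rule orbit_decomposition[OF P bc])
      show "\<zero>\<^bsub>tval R P\<^esub> \<in> {c \<in> carrier (tval R P). ttr R P (coset_gset G K) p' c \<in> I K}"
        using tr_zero[OF P GK p(2)] by simp
      show "c \<oplus>\<^bsub>tval R P\<^esub> d \<in> {c \<in> carrier (tval R P). ttr R P (coset_gset G K) p' c \<in> I K}"
        if "c \<in> {c \<in> carrier (tval R P). ttr R P (coset_gset G K) p' c \<in> I K}"
          "d \<in> {c \<in> carrier (tval R P). ttr R P (coset_gset G K) p' c \<in> I K}" for c d
        using that tr_add[OF P GK p(2)] by simp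
      fix L l assume L: "subgroup L G" and l: "l \<in> gmaps G (coset_gset G L) P"
      note GL = coset_gset_closed[OF L]
      have "tres R (coset_gset G L) P l ?b \<in> I L" by (rule ideal_ext_res_coset[OF P b L l])
      then have "ttr R (coset_gset G L) (coset_gset G K) (compose (pts (coset_gset G L)) p' l)
          (tres R (coset_gset G L) P l ?b) \<in> I K"
        by (rule tideal_gmap(2)[OF I L K compose_in_gmaps[OF GL l p(2)]])
      then show "ttr R (coset_gset G L) P l (tres R (coset_gset G L) P l ?b)
          \<in> {c \<in> carrier (tval R P). ttr R P (coset_gset G K) p' c \<in> I K}"
        using tr_comp[OF GL P GK l p(2) res_closed[OF GL P l bc]]
          tr_closed[OF GL P l res_closed[OF GL P l bc]] by simp
    qed
    then show ?thesis using res_tr[OF X(1) GK X(2) P pb ac] by simp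
  qed
  then show ?thesis
    using tr_closed[OF X h ac] by (simp add: ideal_ext_def subgroups_def)
qed

text \<open>After base change to \<open>G/K\<close> the norm is a product over the orbits of the
  pullback. A single factor in the ideal \<open>I(G/K)\<close> is enough, so one orbit is split off
  and the rest may contribute anything. Surjectivity of \<open>h\<close> ensures that the pullback
  has an orbit at all.\<close>

lemma ideal_ext_nm:
  assumes X: "X \<in> gsets G" "Y \<in> gsets G" and h: "h \<in> gmaps G X Y" "pts Y \<subseteq> h ` pts X"
    and a: "a \<in> ideal_ext G R I X"
  shows "tnm R X Y h a \<in> ideal_ext G R I Y"
proof -
  note ac = ideal_ext_carrier[OF a]
  have "tres R (coset_gset G K) Y f (tnm R X Y h a) \<in> I K"
    if K: "subgroup K G" and f: "f \<in> gmaps G (coset_gset G K) Y" for K f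
  proof -
    note GK = coset_gset_closed[OF K]
    obtain P p p' where P: "P \<in> gsets G" and pb: "is_pullback G X (coset_gset G K) Y P h f p p'"
      by (rule pullback_exists[OF X(1) GK h(1) f])
    note p = pullbackD(3,4)[OF pb]
    let ?b = "tres R P X p a"
    have b: "?b \<in> ideal_ext G R I P" by (rule ideal_ext_res[OF P X(1) p(1) a])
    note bc = ideal_ext_carrier[OF b]
    interpret IK: ideal "I K" "tval R (coset_gset G K)" by (rule tideal_ideal[OF I K])
    have "f (K, 0) \<in> h ` pts X" using gmap_mem[OF f coset_base[OF group K]] h(2) by blast
    then obtain w where w: "w \<in> pts P"
      using pullbackD(6)[OF pb _ coset_base[OF group K]] by (metis imageE)
    let ?L = "stabilizer G (act P) w"
    have L: "subgroup ?L G"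
      using group_action.stabilizer_subgroup[of G "pts P" "act P"] P w by (simp add: gsets_def)
    note GL = coset_gset_closed[OF L]
    obtain l where l: "l \<in> gmaps G (coset_gset G ?L) P" "inj_on l (pts (coset_gset G ?L))"
    proof (rule orbit_map[OF group finite_group P L w])
      show "act P k w = w" if "k \<in> ?L" for k using that by (simp add: stabilizer_def)
    qed blast
    obtain Q j where Q: "Q \<in> gsets G" and c: "is_coproduct G (coset_gset G ?L) Q P l j"
      by (rule complement_exists[OF GL P l])
    note j = coproductD(2)[OF c]
    have "tnm R (coset_gset G ?L) (coset_gset G K) (compose (pts (coset_gset G ?L)) p' l)
        (tres R (coset_gset G ?L) P l ?b) \<in> I K"
      by (rule tideal_gmap(3)[OF I L K compose_in_gmaps[OF GL l(1) p(2)] ideal_ext_res_coset[OF P b L l(1)]])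
    then have "tnm R P (coset_gset G K) p' ?b \<in> I K"
      using coproduct_nm[OF GL Q P c GK p(2) bc]
        IK.I_r_closed nm_closed[OF Q GK compose_in_gmaps[OF Q j p(2)] res_closed[OF Q P j bc]] by simp
    then show ?thesis using res_nm[OF X(1) GK X(2) P pb ac] by simp
  qed
  then show ?thesis
    using nm_closed[OF X h(1) ac] by (simp add: ideal_ext_def subgroups_def)
qed

end

end

section \<open>Coinduction of Tambara ideals\<close>

lemma coind_sel [simp]:
  "tval (coind H R) X = tval R (res_gset H X)"
  "tres (coind H R) X Y = tres R (res_gset H X) (res_gset H Y)"
  "ttr (coind H R) X Y = ttr R (res_gset H X) (res_gset H Y)"
  "tnm (coind H R) X Y = tnm R (res_gset H X) (res_gset H Y)"
  by (simp_all add: coind_def)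

lemma coset_restrict_carrier [simp]:
  "a <#\<^bsub>G\<lparr>carrier := H\<rparr>\<^esub> L = a <#\<^bsub>G\<^esub> L" "L #>\<^bsub>G\<lparr>carrier := H\<rparr>\<^esub> a = L #>\<^bsub>G\<^esub> a" "M <#>\<^bsub>G\<lparr>carrier := H\<rparr>\<^esub> L = M <#>\<^bsub>G\<^esub> L"
  by (simp_all add: l_coset_def r_coset_def set_mult_def)

text \<open>The product is the least Tambara ideal above the levelwise products, and
  \<open>M\<close> is already closed under all operations. So only the generators \<open>a b\<close>
  of the levelwise products have to be checked, and no description of the product itself
  enters.\<close>

lemma (in tambara_functor) tprod_le_iff:
  assumes "I \<in> tideals G R" "J \<in> tideals G R" "M \<in> tideals G R"
  shows "tprod G R I J \<le> M \<longleftrightarrow>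
    (\<forall>K. subgroup K G \<longrightarrow> (\<forall>a\<in>I K. \<forall>b\<in>J K. a \<otimes>\<^bsub>tval R (coset_gset G K)\<^esub> b \<in> M K))"
proof (intro iffI allI impI ballI)
  fix K a b assume le: "tprod G R I J \<le> M" and K: "subgroup K G" and a: "a \<in> I K" and b: "b \<in> J K"
  have "a \<otimes>\<^bsub>tval R (coset_gset G K)\<^esub> b \<in> ideal_prod (tval R (coset_gset G K)) (I K) (J K)"
    using a b by (rule ideal_prod.prod)
  then have "a \<otimes>\<^bsub>tval R (coset_gset G K)\<^esub> b \<in> tprod G R I J K"
    using K by (auto simp: tprod_def subgroups_def)
  then show "a \<otimes>\<^bsub>tval R (coset_gset G K)\<^esub> b \<in> M K"
    using le_funD[OF le, of K] by blast
next
  assume *: "\<forall>K. subgroup K G \<longrightarrow> (\<forall>a\<in>I K. \<forall>b\<in>J K. a \<otimes>\<^bsub>tval R (coset_gset G K)\<^esub> b \<in> M K)"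
  have "ideal_prod (tval R (coset_gset G K)) (I K) (J K) \<subseteq> M K" if K: "subgroup K G" for K
  proof
    fix x assume "x \<in> ideal_prod (tval R (coset_gset G K)) (I K) (J K)"
    then show "x \<in> M K"
    proof induction
      case (prod i j) then show ?case using * K by blast
    next
      case (sum s t) then show ?case
        by (intro additive_subgroup.a_closed[OF ideal.axioms(1)[OF tideal_ideal[OF assms(3) K]]])
    qed
  qed
  then show "tprod G R I J \<le> M"
    using assms(3) tprod_tideals(1)[OF tambara_functor_axioms assms(1,2)]
    by (intro tideals_leI) (auto simp: tprod_def subgroups_def)
qed

section \<open>Coset spaces of \<open>H\<close> inside the restricted coset spaces of
  \<open>G\<close>\<close>

context
  fixes G :: "'g monoid" (structure) and H :: "'g set" and R :: "('g, 'r) tambara"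
  assumes grp: "group G" and fin: "finite (carrier G)" and H: "subgroup H G"
    and RH: "tambara_functor (G\<lparr>carrier := H\<rparr>) R"
begin

interpretation group G by (rule grp)
interpretation RH: tambara_functor "G\<lparr>carrier := H\<rparr>" R by (rule RH)
interpretation CG: tambara_functor G "coind H R" by (rule tambara_functor_coind[OF grp fin H RH])

lemma subgroup_HD:
  assumes "subgroup L (G\<lparr>carrier := H\<rparr>)"
  shows "subgroup L G" "L \<subseteq> H"
  using incl_subgroup[OF H assms] subgroup.subset[OF assms] by simp_all

lemma res_coset_gset: "subgroup K G \<Longrightarrow> res_gset H (coset_gset G K) \<in> gsets (G\<lparr>carrier := H\<rparr>)"
  by (rule res_gset_in_gsets[OF H grp CG.coset_gset_closed])

text \<open>With points encoded as cosets, \<open>hL\<close> for \<open>h\<close> in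
  \<open>H\<close> is literally the same point of \<open>H/L\<close> and of \<open>G/L\<close>. The
  second claim holds because such cosets are subsets of \<open>H\<close>; it is what makes the
  squares for \<open>eta\<close> cartesian.\<close>

lemma coset_gset_H_pts:
  assumes L: "subgroup L (G\<lparr>carrier := H\<rparr>)"
  shows "pts (coset_gset (G\<lparr>carrier := H\<rparr>) L) \<subseteq> pts (coset_gset G L)"
    and "\<lbrakk>g \<in> carrier G; c \<in> pts (coset_gset (G\<lparr>carrier := H\<rparr>) L); act (coset_gset G L) g c \<in> pts (coset_gset (G\<lparr>carrier := H\<rparr>) L)\<rbrakk> \<Longrightarrow> g \<in> H"
    and "\<lbrakk>h \<in> H; c \<in> pts (coset_gset (G\<lparr>carrier := H\<rparr>) L)\<rbrakk> \<Longrightarrow> act (coset_gset (G\<lparr>carrier := H\<rparr>) L) h c = act (coset_gset G L) h c"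
proof -
  have HG: "h \<in> carrier G" if "h \<in> H" for h using subgroup.mem_carrier[OF H that] .
  have LG: "L \<subseteq> carrier G" using subgroup_HD(1)[OF L] by (rule subgroup.subset)
  show sub: "pts (coset_gset (G\<lparr>carrier := H\<rparr>) L) \<subseteq> pts (coset_gset G L)"
    using HG by (auto simp: coset_gset_def LCOSETS_def)
  show "g \<in> H" if g: "g \<in> carrier G" and c: "c \<in> pts (coset_gset (G\<lparr>carrier := H\<rparr>) L)"
    and gc: "act (coset_gset G L) g c \<in> pts (coset_gset (G\<lparr>carrier := H\<rparr>) L)" for g c
  proof -
    obtain h where h: "h \<in> H" "c = (h <# L, 0)"
      using c by (auto simp: coset_gset_def LCOSETS_def)
    have "act (coset_gset G L) g c = ((g \<otimes> h) <# L, 0)"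
      using subsetD[OF sub c] g h HG LG by (simp add: coset_gset_def lcos_m_assoc)
    then obtain k where k: "k \<in> H" "(g \<otimes> h) <# L = k <# L"
      using gc by (auto simp: coset_gset_def LCOSETS_def)
    have "inv k \<otimes> (g \<otimes> h) \<in> L"
      using coset_eq_iff[OF grp subgroup_HD(1)[OF L] HG[OF k(1)], of "g \<otimes> h"] k(2) g HG[OF h(1)] by simp
    then have "inv k \<otimes> (g \<otimes> h) \<in> H" using subgroup_HD(2)[OF L] by blast
    then have "k \<otimes> (inv k \<otimes> (g \<otimes> h)) \<otimes> inv h \<in> H"
      using k(1) h(1) subgroup.m_closed[OF H] subgroup.m_inv_closed[OF H] by blast
    moreover have "k \<otimes> (inv k \<otimes> (g \<otimes> h)) \<otimes> inv h = g"
      using g HG[OF h(1)] HG[OF k(1)] by (simp add: m_assoc[symmetric]) (simp add: m_assoc)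
    ultimately show "g \<in> H" by simp
  qed
  show "act (coset_gset (G\<lparr>carrier := H\<rparr>) L) h c = act (coset_gset G L) h c"
    if "h \<in> H" "c \<in> pts (coset_gset (G\<lparr>carrier := H\<rparr>) L)" for h c
    using that(1) that(2) subsetD[OF sub that(2)] HG[OF that(1)] by (simp add: coset_gset_def)
qed

text \<open>The unit \<open>H/L \<rightarrow> Res (G/L)\<close> of induction is the inclusion of those cosets that lie in \<open>H\<close>.\<close>

lemma eta_gmap:
  assumes L: "subgroup L (G\<lparr>carrier := H\<rparr>)"
  shows "gid (coset_gset (G\<lparr>carrier := H\<rparr>) L) \<in> gmaps (G\<lparr>carrier := H\<rparr>) (coset_gset (G\<lparr>carrier := H\<rparr>) L) (res_gset H (coset_gset G L))"
    and "inj_on (gid (coset_gset (G\<lparr>carrier := H\<rparr>) L)) (pts (coset_gset (G\<lparr>carrier := H\<rparr>) L))"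
proof -
  note GL = RH.coset_gset_closed[OF L]
  have "restrict (\<lambda>c. c) (pts (coset_gset (G\<lparr>carrier := H\<rparr>) L)) \<in> gmaps (G\<lparr>carrier := H\<rparr>) (coset_gset (G\<lparr>carrier := H\<rparr>) L) (res_gset H (coset_gset G L))"
    by (rule restrict_in_gmaps[OF GL]) (use coset_gset_H_pts[OF L] in auto)
  then show "gid (coset_gset (G\<lparr>carrier := H\<rparr>) L) \<in> gmaps (G\<lparr>carrier := H\<rparr>) (coset_gset (G\<lparr>carrier := H\<rparr>) L) (res_gset H (coset_gset G L))"
    by (simp add: gid_def)
  show "inj_on (gid (coset_gset (G\<lparr>carrier := H\<rparr>) L)) (pts (coset_gset (G\<lparr>carrier := H\<rparr>) L))"
    by (simp add: gid_def inj_on_def)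
qed

section \<open>Squares comparing maps of orbits over \<open>G\<close> and over
  \<open>H\<close>\<close>

context
  fixes K L F f
  assumes K: "subgroup K (G\<lparr>carrier := H\<rparr>)" and L: "subgroup L (G\<lparr>carrier := H\<rparr>)"
    and F: "F \<in> gmaps G (coset_gset G K) (coset_gset G L)"
    and f: "f \<in> gmaps (G\<lparr>carrier := H\<rparr>) (coset_gset (G\<lparr>carrier := H\<rparr>) K) (coset_gset (G\<lparr>carrier := H\<rparr>) L)"
    and Ff: "F (K, 0) = f (K, 0)"
begin

lemma eta_square_eq: "c \<in> pts (coset_gset (G\<lparr>carrier := H\<rparr>) K) \<Longrightarrow> F c = f c"
proof -
  assume c: "c \<in> pts (coset_gset (G\<lparr>carrier := H\<rparr>) K)"
  note base = coset_base[OF RH.group K]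
  obtain h where h: "h \<in> H" "c = act (coset_gset (G\<lparr>carrier := H\<rparr>) K) h (K, 0)"
    using coset_ptE[OF RH.group K c] by auto
  have hG: "h \<in> carrier G" using subgroup.mem_carrier[OF H h(1)] .
  have "F c = act (coset_gset G L) h (F (K, 0))"
    using gmap_act[OF F hG coset_base[OF grp subgroup_HD(1)[OF K]]] h coset_gset_H_pts(3)[OF K h(1) base] by simp
  also have "\<dots> = f c"
    using gmap_act[OF f _ base, of h] h Ff coset_gset_H_pts(3)[OF L h(1) gmap_mem[OF f base]] by simp
  finally show "F c = f c" .
qed

lemma eta_square_mem:
  assumes c: "c \<in> pts (coset_gset G K)" and Fc: "F c \<in> pts (coset_gset (G\<lparr>carrier := H\<rparr>) L)"
  shows "c \<in> pts (coset_gset (G\<lparr>carrier := H\<rparr>) K)"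
proof -
  note base = coset_base[OF RH.group K]
  obtain g where g: "g \<in> carrier G" "c = act (coset_gset G K) g (K, 0)"
    by (rule coset_ptE[OF grp subgroup_HD(1)[OF K] c])
  have "act (coset_gset G L) g (f (K, 0)) \<in> pts (coset_gset (G\<lparr>carrier := H\<rparr>) L)"
    using Fc gmap_act[OF F g(1) coset_base[OF grp subgroup_HD(1)[OF K]]] g(2) Ff by simp
  then have "g \<in> H" by (rule coset_gset_H_pts(2)[OF L g(1) gmap_mem[OF f base]])
  then show ?thesis
    using g(2) coset_gset_H_pts(3)[OF K _ base] gset_act_closed[OF RH.coset_gset_closed[OF K] _ base] by force
qed

text \<open>A point of \<open>G/K\<close> whose image lies in \<open>H/L\<close> already lies in
  \<open>H/K\<close>, so \<open>H/K\<close> is the full fibre product. Both orientations are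
  recorded: the first gives \<open>R_F T_eta = T_eta R_f\<close>, the second
  \<open>R_eta N_F = N_f R_eta\<close>.\<close>

lemma eta_square:
  "is_pullback (G\<lparr>carrier := H\<rparr>) (coset_gset (G\<lparr>carrier := H\<rparr>) L) (res_gset H (coset_gset G K)) (res_gset H (coset_gset G L))
    (coset_gset (G\<lparr>carrier := H\<rparr>) K) (gid (coset_gset (G\<lparr>carrier := H\<rparr>) L)) F f (gid (coset_gset (G\<lparr>carrier := H\<rparr>) K))"
  "is_pullback (G\<lparr>carrier := H\<rparr>) (res_gset H (coset_gset G K)) (coset_gset (G\<lparr>carrier := H\<rparr>) L) (res_gset H (coset_gset G L))
    (coset_gset (G\<lparr>carrier := H\<rparr>) K) F (gid (coset_gset (G\<lparr>carrier := H\<rparr>) L)) (gid (coset_gset (G\<lparr>carrier := H\<rparr>) K)) f"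
proof -
  note FH = gmaps_res_gset[OF H F] and e = eta_gmap(1)[OF K] eta_gmap(1)[OF L]
  have gK: "gid (coset_gset (G\<lparr>carrier := H\<rparr>) K) c = c" if "c \<in> pts (coset_gset (G\<lparr>carrier := H\<rparr>) K)" for c
    using that by (simp add: gid_def)
  have gL: "gid (coset_gset (G\<lparr>carrier := H\<rparr>) L) c = c" if "c \<in> pts (coset_gset (G\<lparr>carrier := H\<rparr>) L)" for c
    using that by (simp add: gid_def)
  show "is_pullback (G\<lparr>carrier := H\<rparr>) (coset_gset (G\<lparr>carrier := H\<rparr>) L) (res_gset H (coset_gset G K)) (res_gset H (coset_gset G L))
    (coset_gset (G\<lparr>carrier := H\<rparr>) K) (gid (coset_gset (G\<lparr>carrier := H\<rparr>) L)) F f (gid (coset_gset (G\<lparr>carrier := H\<rparr>) K))"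
  proof (rule pullbackI[OF e(2) FH f e(1)])
    fix x y assume "x \<in> pts (coset_gset (G\<lparr>carrier := H\<rparr>) L)" "y \<in> pts (res_gset H (coset_gset G K))"
      "gid (coset_gset (G\<lparr>carrier := H\<rparr>) L) x = F y"
    then show "\<exists>w\<in>pts (coset_gset (G\<lparr>carrier := H\<rparr>) K). f w = x \<and> gid (coset_gset (G\<lparr>carrier := H\<rparr>) K) w = y"
      using eta_square_mem[of y] eta_square_eq[of y] by (intro bexI[of _ y]) (simp_all add: gK gL)
  qed (simp_all add: gK gL eta_square_eq gmap_mem[OF f])
  show "is_pullback (G\<lparr>carrier := H\<rparr>) (res_gset H (coset_gset G K)) (coset_gset (G\<lparr>carrier := H\<rparr>) L) (res_gset H (coset_gset G L))
    (coset_gset (G\<lparr>carrier := H\<rparr>) K) F (gid (coset_gset (G\<lparr>carrier := H\<rparr>) L)) (gid (coset_gset (G\<lparr>carrier := H\<rparr>) K)) f"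
  proof (rule pullbackI[OF FH e(2) e(1) f])
    fix x y assume "x \<in> pts (res_gset H (coset_gset G K))" "y \<in> pts (coset_gset (G\<lparr>carrier := H\<rparr>) L)"
      "F x = gid (coset_gset (G\<lparr>carrier := H\<rparr>) L) y"
    then show "\<exists>w\<in>pts (coset_gset (G\<lparr>carrier := H\<rparr>) K). gid (coset_gset (G\<lparr>carrier := H\<rparr>) K) w = x \<and> f w = y"
      using eta_square_mem[of x] eta_square_eq[of x] by (intro bexI[of _ x]) (simp_all add: gK gL)
  qed (simp_all add: gK gL eta_square_eq gmap_mem[OF f])
qed

lemma eta_square_compose:
  "compose (pts (coset_gset (G\<lparr>carrier := H\<rparr>) K)) F (gid (coset_gset (G\<lparr>carrier := H\<rparr>) K)) =
    compose (pts (coset_gset (G\<lparr>carrier := H\<rparr>) K)) (gid (coset_gset (G\<lparr>carrier := H\<rparr>) L)) f"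
  using eta_square_eq gmap_mem[OF f] by (auto simp: compose_def gid_def)

end

section \<open>Coinduced ideals and the bijection of Tambara ideals\<close>

lemma coind_ideal_apply:
  "subgroup K G \<Longrightarrow> coind_ideal G H R I K = ideal_ext (G\<lparr>carrier := H\<rparr>) R I (res_gset H (coset_gset G K))"
  by (simp add: coind_ideal_def subgroups_def)

text \<open>Each closure property is the one of the extension along the restricted map. Norms are
  covered because a projection \<open>G/K -> G/L\<close> is onto.\<close>

lemma coind_ideal_in_tideals:
  assumes I: "I \<in> tideals (G\<lparr>carrier := H\<rparr>) R"
  shows "coind_ideal G H R I \<in> tideals G (coind H R)"
proof -
  have P: "coset_proj G K L \<in> gmaps (G\<lparr>carrier := H\<rparr>) (res_gset H (coset_gset G K)) (res_gset H (coset_gset G L))"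
    if "subgroup K G" "subgroup L G" "K \<subseteq> L" for K L
    by (rule gmaps_res_gset[OF H coset_proj_in_gmaps[OF grp that]])
  have N: "tnm R (res_gset H (coset_gset G K)) (res_gset H (coset_gset G L)) (coset_proj G K L) a
      \<in> ideal_ext (G\<lparr>carrier := H\<rparr>) R I (res_gset H (coset_gset G L))"
    if KL: "subgroup K G" "subgroup L G" "K \<subseteq> L" and a: "a \<in> ideal_ext (G\<lparr>carrier := H\<rparr>) R I (res_gset H (coset_gset G K))" for K L a
  proof (rule RH.ideal_ext_nm[OF I res_coset_gset[OF KL(1)] res_coset_gset[OF KL(2)] P[OF KL] _ a])
    have "pts (coset_gset G K) \<noteq> {}" using coset_base[OF grp KL(1)] by blast
    then show "pts (res_gset H (coset_gset G L)) \<subseteq> coset_proj G K L ` pts (res_gset H (coset_gset G K))"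
      using gmap_coset_surj[OF grp CG.coset_gset_closed[OF KL(1)] KL(2) coset_proj_in_gmaps[OF grp KL] _ fin] by simp
  qed
  have C: "subgroup (conj_subgroup G g K) G"
    "coset_conj G g K \<in> gmaps (G\<lparr>carrier := H\<rparr>) (res_gset H (coset_gset G (conj_subgroup G g K))) (res_gset H (coset_gset G K))"
    if "subgroup K G" "g \<in> carrier G" for K g
    using subgroup_conj_subgroup[OF grp that] gmaps_res_gset[OF H coset_conj_in_gmaps[OF grp that]] by simp_all
  show ?thesis
    unfolding tideals_def
  proof (intro CollectI conjI ballI impI)
    show "coind_ideal G H R I \<in> extensional (subgroups G)" by (simp add: coind_ideal_def)
  qed (simp_all add: subgroups_def coind_ideal_apply RH.ideal_ext_ideal[OF I] RH.ideal_ext_tr[OF I]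
      N RH.ideal_ext_res[OF I] P C res_coset_gset)
qed

lemma tr_eta_in_coind_ideal:
  assumes I: "I \<in> tideals (G\<lparr>carrier := H\<rparr>) R" and L: "subgroup L (G\<lparr>carrier := H\<rparr>)" and a: "a \<in> carrier (tval R (coset_gset (G\<lparr>carrier := H\<rparr>) L))"
  shows "ttr R (coset_gset (G\<lparr>carrier := H\<rparr>) L) (res_gset H (coset_gset G L)) (gid (coset_gset (G\<lparr>carrier := H\<rparr>) L)) a \<in> coind_ideal G H R I L
    \<longleftrightarrow> a \<in> I L"
proof -
  note GL = RH.coset_gset_closed[OF L] and rGL = res_coset_gset[OF subgroup_HD(1)[OF L]] and e = eta_gmap[OF L]
  have "I L = ideal_ext (G\<lparr>carrier := H\<rparr>) R I (coset_gset (G\<lparr>carrier := H\<rparr>) L)"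
    using ideal_ext_coset_gset[OF RH I] L by (simp add: subgroups_def)
  then show ?thesis
    using RH.ideal_ext_tr[OF I GL rGL e(1), of a] RH.ideal_ext_res_coset[OF I rGL _ L e(1)]
      RH.res_tr_inj[OF GL rGL e a] coind_ideal_apply[OF subgroup_HD(1)[OF L]] by metis
qed

lemma coind_ideal_le_iff:
  assumes I: "I \<in> tideals (G\<lparr>carrier := H\<rparr>) R" and J: "J \<in> tideals (G\<lparr>carrier := H\<rparr>) R"
  shows "coind_ideal G H R I \<le> coind_ideal G H R J \<longleftrightarrow> I \<le> J"
proof
  assume le: "coind_ideal G H R I \<le> coind_ideal G H R J"
  show "I \<le> J"
  proof (rule tideals_leI[OF I J], rule subsetI)
    fix L a assume "L \<in> subgroups (G\<lparr>carrier := H\<rparr>)" and a: "a \<in> I L"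
    then have L: "subgroup L (G\<lparr>carrier := H\<rparr>)" by (simp add: subgroups_def)
    note ac = RH.tideal_carrier[OF I L a]
    show "a \<in> J L"
      using le_funD[OF le, of L] tr_eta_in_coind_ideal[OF I L ac] tr_eta_in_coind_ideal[OF J L ac] a by blast
  qed
next
  assume le: "I \<le> J"
  have "I K \<subseteq> J K" for K using le by (simp add: le_fun_def)
  then show "coind_ideal G H R I \<le> coind_ideal G H R J"
    by (intro tideals_leI[OF coind_ideal_in_tideals[OF I] coind_ideal_in_tideals[OF J]])
      (auto simp: coind_ideal_def ideal_ext_def)
qed

context
  fixes J assumes J: "J \<in> tideals G (coind H R)"
begin

text \<open>By Frobenius reciprocity this element is \<open>T_eta(1) b\<close>, a multiple of
  \<open>b\<close>; the factor is the idempotent that cuts the orbit \<open>H/L\<close> out of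
  \<open>Res (G/L)\<close>.\<close>

lemma tr_res_eta:
  assumes L: "subgroup L (G\<lparr>carrier := H\<rparr>)" and b: "b \<in> J L"
  shows "ttr R (coset_gset (G\<lparr>carrier := H\<rparr>) L) (res_gset H (coset_gset G L)) (gid (coset_gset (G\<lparr>carrier := H\<rparr>) L))
    (tres R (coset_gset (G\<lparr>carrier := H\<rparr>) L) (res_gset H (coset_gset G L)) (gid (coset_gset (G\<lparr>carrier := H\<rparr>) L)) b) \<in> J L"
proof -
  note GL = RH.coset_gset_closed[OF L] and rGL = res_coset_gset[OF subgroup_HD(1)[OF L]] and e = eta_gmap[OF L]
  note bc = CG.tideal_carrier[OF J subgroup_HD(1)[OF L] b, simplified]
  interpret RL: cring "tval R (coset_gset (G\<lparr>carrier := H\<rparr>) L)" by (rule RH.val_cring[OF GL])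
  note r = RH.res_closed[OF GL rGL e(1) bc]
  have "ttr R (coset_gset (G\<lparr>carrier := H\<rparr>) L) (res_gset H (coset_gset G L)) (gid (coset_gset (G\<lparr>carrier := H\<rparr>) L)) \<one>\<^bsub>tval R (coset_gset (G\<lparr>carrier := H\<rparr>) L)\<^esub>
      \<otimes>\<^bsub>tval R (res_gset H (coset_gset G L))\<^esub> b \<in> J L"
    using ideal.I_l_closed[OF CG.tideal_ideal[OF J subgroup_HD(1)[OF L]] b]
      RH.tr_closed[OF GL rGL e(1) RL.one_closed] by simp
  then show ?thesis
    using RH.tr_frobenius[OF GL rGL e(1) RL.one_closed bc] r by simp
qed

end

text \<open>Agreement at the base point is the only compatibility that the squares for
  \<open>eta\<close> require of a map over \<open>G\<close> and one over \<open>H\<close>. This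
  lemma and the later one on \<open>coset_conj\<close> provide it for the generating maps.\<close>

lemma coset_proj_restrict_carrier:
  assumes "subgroup K (G\<lparr>carrier := H\<rparr>)" "subgroup L (G\<lparr>carrier := H\<rparr>)" "K \<subseteq> L"
  shows "coset_proj G K L (K, 0) = coset_proj (G\<lparr>carrier := H\<rparr>) K L (K, 0)"
  using coset_proj_base[OF grp subgroup_HD(1)[OF assms(1)] subgroup_HD(1)[OF assms(2)] assms(3)]
    coset_proj_base[OF RH.group assms] by simp

lemma conj_subgroup_restrict_carrier:
  assumes "g \<in> H"
  shows "conj_subgroup (G\<lparr>carrier := H\<rparr>) g K = conj_subgroup G g K"
  using assms m_inv_consistent[OF H] by (simp add: conj_subgroup_def)

lemma coset_conj_restrict_carrier:
  assumes K: "subgroup K (G\<lparr>carrier := H\<rparr>)" and g: "g \<in> H"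
  shows "coset_conj G g K (conj_subgroup G g K, 0) = coset_conj (G\<lparr>carrier := H\<rparr>) g K (conj_subgroup G g K, 0)"
proof -
  have gG: "g \<in> carrier G" using subgroup.mem_carrier[OF H g] .
  note C = conj_subgroup_restrict_carrier[OF g, of K]
  have "(conj_subgroup G g K, 0) \<in> pts (coset_gset G (conj_subgroup G g K))"
    by (rule coset_base[OF grp subgroup_conj_subgroup[OF grp subgroup_HD(1)[OF K] gG]])
  moreover have "(conj_subgroup G g K, 0) \<in> pts (coset_gset (G\<lparr>carrier := H\<rparr>) (conj_subgroup G g K))"
    using coset_base[OF RH.group subgroup_conj_subgroup[OF RH.group K, of g]] g C by simp
  ultimately show ?thesis by (simp add: coset_conj_def C)
qed

lemma coind_ideal_surj:
  assumes J: "J \<in> tideals G (coind H R)"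
  shows "\<exists>I\<in>tideals (G\<lparr>carrier := H\<rparr>) R. coind_ideal G H R I = J"
proof -
  let ?H = "G\<lparr>carrier := H\<rparr>"
  let ?T = "\<lambda>L. ttr R (coset_gset ?H L) (res_gset H (coset_gset G L)) (gid (coset_gset ?H L))"
  let ?E = "\<lambda>L. tres R (coset_gset ?H L) (res_gset H (coset_gset G L)) (gid (coset_gset ?H L))"
  define I where "I = (\<lambda>L\<in>subgroups ?H. {a \<in> carrier (tval R (coset_gset ?H L)). ?T L a \<in> J L})"
  have I_iff: "a \<in> I L \<longleftrightarrow> a \<in> carrier (tval R (coset_gset ?H L)) \<and> ?T L a \<in> J L" if "subgroup L ?H" for L a
    using that by (simp add: I_def subgroups_def)
  note GL = RH.coset_gset_closed and rGL = res_coset_gset[OF subgroup_HD(1)] and e = eta_gmap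
  have Jc: "b \<in> carrier (tval R (res_gset H (coset_gset G L)))" if "subgroup L ?H" "b \<in> J L" for L b
    using CG.tideal_carrier[OF J subgroup_HD(1)[OF that(1)] that(2)] by simp
  have EI: "?E L b \<in> I L" if "subgroup L ?H" "b \<in> J L" for L b
    using I_iff[OF that(1)] tr_res_eta[OF J that] RH.res_closed[OF GL rGL e(1) Jc] that by blast
  \<comment> \<open>Each map \<open>f\<close> over \<open>H\<close> is accompanied by a map
    \<open>F\<close> over \<open>G\<close> with the same value at the base point. Restrictions
    follow from \<open>R_F T_eta = T_eta R_f\<close>, transfers from functoriality in the form
    \<open>T_F T_eta = T_eta T_f\<close>.\<close>
  have sq: "a \<in> I L \<Longrightarrow> tres R (coset_gset ?H K) (coset_gset ?H L) f a \<in> I K"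
    "a \<in> I K \<Longrightarrow> ttr R (coset_gset ?H K) (coset_gset ?H L) f a \<in> I L"
    "a \<in> I K \<Longrightarrow> tnm R (coset_gset ?H K) (coset_gset ?H L) f a \<in> I L"
    if K: "subgroup K ?H" and L: "subgroup L ?H"
      and F: "F \<in> gmaps G (coset_gset G K) (coset_gset G L)"
      and f: "f \<in> gmaps ?H (coset_gset ?H K) (coset_gset ?H L)"
      and Ff: "F (K, 0) = f (K, 0)" for K L F f a
  proof -
    note S = eta_square[OF K L F f Ff] and KG = subgroup_HD(1)[OF K] and LG = subgroup_HD(1)[OF L]
    note FH = gmaps_res_gset[OF H F]
    note JF = CG.tideal_gmap[OF J KG LG F, simplified]
    show "tres R (coset_gset ?H K) (coset_gset ?H L) f a \<in> I K" if "a \<in> I L"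
      using that RH.res_tr[OF GL[OF L] rGL[OF K] rGL[OF L] GL[OF K] S(1), of a] JF(1)[of "?T L a"]
        RH.res_closed[OF GL[OF K] GL[OF L] f, of a] by (simp add: I_iff[OF L] I_iff[OF K])
    show "ttr R (coset_gset ?H K) (coset_gset ?H L) f a \<in> I L" if "a \<in> I K"
      using that RH.tr_comp[OF GL[OF K] rGL[OF K] rGL[OF L] e(1)[OF K] FH, of a]
        RH.tr_comp[OF GL[OF K] GL[OF L] rGL[OF L] f e(1)[OF L], of a] JF(2)[of "?T K a"]
        eta_square_compose[OF K L F f Ff] RH.tr_closed[OF GL[OF K] GL[OF L] f, of a]
      by (simp add: I_iff[OF L] I_iff[OF K])
    \<comment> \<open>Base change relates norms to restriction along \<open>eta\<close>, not to the
      transfer. So \<open>f\<close>-norms are reached as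
      \<open>N_f a = N_f R_eta T_eta a = R_eta N_F T_eta a\<close>, and \<open>EI\<close> places
      restrictions of elements of \<open>J\<close> in \<open>I\<close>.\<close>
    show "tnm R (coset_gset ?H K) (coset_gset ?H L) f a \<in> I L" if a: "a \<in> I K"
    proof -
      have ac: "a \<in> carrier (tval R (coset_gset ?H K))" and TJ: "?T K a \<in> J K"
        using a by (simp_all add: I_iff[OF K])
      show ?thesis
        using EI[OF L JF(3)[OF TJ]]
          RH.res_nm[OF rGL[OF K] GL[OF L] rGL[OF L] GL[OF K] S(2) Jc[OF K TJ]]
          RH.res_tr_inj[OF GL[OF K] rGL[OF K] e[OF K] ac] by simp
    qed
  qed
  have "I \<in> tideals ?H R"
    unfolding tideals_def
  proof (intro CollectI conjI ballI impI)
    show "I \<in> extensional (subgroups ?H)" by (simp add: I_def)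
  next
    fix L assume "L \<in> subgroups ?H"
    then have L: "subgroup L ?H" by (simp add: subgroups_def)
    note t = e(1)[OF L]
    interpret RL: cring "tval R (coset_gset ?H L)" by (rule RH.val_cring[OF GL[OF L]])
    interpret JL: ideal "J L" "tval R (res_gset H (coset_gset G L))"
      using CG.tideal_ideal[OF J subgroup_HD(1)[OF L]] by simp
    show "ideal (I L) (tval R (coset_gset ?H L))"
    proof (rule cring_idealI[OF RL.cring_axioms])
      show "I L \<subseteq> carrier (tval R (coset_gset ?H L))" using I_iff[OF L] by blast
      show "\<zero>\<^bsub>tval R (coset_gset ?H L)\<^esub> \<in> I L"
        using RH.tr_zero[OF GL[OF L] rGL[OF L] t] by (simp add: I_iff[OF L])
      show "a \<oplus>\<^bsub>tval R (coset_gset ?H L)\<^esub> b \<in> I L" if "a \<in> I L" "b \<in> I L" for a b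
        using that RH.tr_add[OF GL[OF L] rGL[OF L] t, of a b] by (simp add: I_iff[OF L])
      show "x \<otimes>\<^bsub>tval R (coset_gset ?H L)\<^esub> a \<in> I L" if a: "a \<in> I L" and x: "x \<in> carrier (tval R (coset_gset ?H L))" for a x
      proof -
        have ac: "a \<in> carrier (tval R (coset_gset ?H L))" and TJ: "?T L a \<in> J L"
          using a by (simp_all add: I_iff[OF L])
        \<comment> \<open>Writing \<open>a\<close> as \<open>R_eta T_eta a\<close> makes Frobenius
          reciprocity applicable, so that \<open>T_eta(x a) = T_eta(x) T_eta(a)\<close>.\<close>
        have "?T L (x \<otimes>\<^bsub>tval R (coset_gset ?H L)\<^esub> ?E L (?T L a)) = ?T L x \<otimes>\<^bsub>tval R (res_gset H (coset_gset G L))\<^esub> ?T L a"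
          by (rule RH.tr_frobenius[OF GL[OF L] rGL[OF L] t x Jc[OF L TJ]])
        then show ?thesis
          using RH.res_tr_inj[OF GL[OF L] rGL[OF L] e[OF L] ac] ac x
            JL.I_l_closed[OF TJ RH.tr_closed[OF GL[OF L] rGL[OF L] t x]] by (simp add: I_iff[OF L])
      qed
    qed
  next
    fix K L a assume "K \<in> subgroups ?H" "L \<in> subgroups ?H" and KL: "K \<subseteq> L"
    then have K: "subgroup K ?H" and L: "subgroup L ?H" by (simp_all add: subgroups_def)
    note p = coset_proj_in_gmaps[OF grp subgroup_HD(1)[OF K] subgroup_HD(1)[OF L] KL]
      coset_proj_in_gmaps[OF RH.group K L KL] coset_proj_restrict_carrier[OF K L KL]
    show "ttr R (coset_gset ?H K) (coset_gset ?H L) (coset_proj ?H K L) a \<in> I L" if "a \<in> I K"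
      by (rule sq(2)[OF K L p that])
    show "tnm R (coset_gset ?H K) (coset_gset ?H L) (coset_proj ?H K L) a \<in> I L" if "a \<in> I K"
      by (rule sq(3)[OF K L p that])
    show "tres R (coset_gset ?H K) (coset_gset ?H L) (coset_proj ?H K L) a \<in> I K" if "a \<in> I L"
      by (rule sq(1)[OF K L p that])
  next
    fix K g a assume "K \<in> subgroups ?H" "g \<in> carrier ?H" and a: "a \<in> I K"
    then have K: "subgroup K ?H" and g: "g \<in> H" by (simp_all add: subgroups_def)
    have gG: "g \<in> carrier G" using subgroup.mem_carrier[OF H g] .
    note C = conj_subgroup_restrict_carrier[OF g, of K]
    have cs: "subgroup (conj_subgroup G g K) ?H"
      using subgroup_conj_subgroup[OF RH.group K, of g] g C by simp
    have c: "coset_conj G g K \<in> gmaps G (coset_gset G (conj_subgroup G g K)) (coset_gset G K)"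
      "coset_conj ?H g K \<in> gmaps ?H (coset_gset ?H (conj_subgroup G g K)) (coset_gset ?H K)"
      using coset_conj_in_gmaps[OF grp subgroup_HD(1)[OF K] gG] coset_conj_in_gmaps[OF RH.group K, of g] g C by simp_all
    show "tres R (coset_gset ?H (conj_subgroup ?H g K)) (coset_gset ?H K) (coset_conj ?H g K) a
        \<in> I (conj_subgroup ?H g K)"
      using sq(1)[OF cs K c coset_conj_restrict_carrier[OF K g] a] C by simp
  qed
  note I = this
  have "coind_ideal G H R I K = J K" if K: "subgroup K G" for K
  proof -
    note rGK = res_coset_gset[OF K]
    \<comment> \<open>This is the adjunction between induction and restriction: \<open>L\<close>
      fixes the image of the base point, so that image also determines a \<open>G\<close>-map out of
      \<open>G/L\<close>.\<close>
    have lift: "\<exists>F\<in>gmaps G (coset_gset G L) (coset_gset G K). f = compose (pts (coset_gset ?H L)) F (gid (coset_gset ?H L))"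
      if L: "subgroup L ?H" and f: "f \<in> gmaps ?H (coset_gset ?H L) (res_gset H (coset_gset G K))" for L f
    proof -
      note base = coset_base[OF RH.group L] and LG = subgroup_HD[OF L]
      have x: "f (L, 0) \<in> pts (coset_gset G K)" using gmap_mem[OF f base] by simp
      have fixed: "act (coset_gset G K) k (f (L, 0)) = f (L, 0)" if k: "k \<in> L" for k
      proof -
        have kH: "k \<in> H" using LG(2) k by blast
        have "act (coset_gset ?H L) k (L, 0) = (L, 0)"
          using coset_act_base[OF RH.group L] kH subgroup.mem_carrier[OF LG(1) k] k
          by (simp add: coset_join3 LG(1))
        then show ?thesis using gmap_act[OF f _ base, of k] kH by simp
      qed
      obtain F where F: "F \<in> gmaps G (coset_gset G L) (coset_gset G K)" "F (L, 0) = f (L, 0)"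
        by (rule orbit_map[OF grp fin CG.coset_gset_closed[OF K] LG(1) x fixed])
      have "f = compose (pts (coset_gset ?H L)) F (gid (coset_gset ?H L))"
        by (rule coset_gmap_eqI[OF RH.group L f compose_in_gmaps[OF GL[OF L] e(1)[OF L] gmaps_res_gset[OF H F(1)]]])
          (simp add: compose_def gid_def base F(2))
      with F(1) show ?thesis by blast
    qed
    note JK = CG.tideal_ideal[OF J K, simplified]
    have "ideal_ext ?H R I (res_gset H (coset_gset G K)) = J K"
    proof
      show "J K \<subseteq> ideal_ext ?H R I (res_gset H (coset_gset G K))"
      proof
        fix a assume a: "a \<in> J K"
        have ac: "a \<in> carrier (tval R (res_gset H (coset_gset G K)))" by (rule ideal.Icarr[OF JK a])
        have "tres R (coset_gset ?H L) (res_gset H (coset_gset G K)) f a \<in> I L"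
          if L: "subgroup L ?H" and f: "f \<in> gmaps ?H (coset_gset ?H L) (res_gset H (coset_gset G K))" for L f
        proof -
          obtain F where F: "F \<in> gmaps G (coset_gset G L) (coset_gset G K)"
            "f = compose (pts (coset_gset ?H L)) F (gid (coset_gset ?H L))" using lift[OF L f] by blast
          show ?thesis
            using EI[OF L CG.tideal_gmap(1)[OF J subgroup_HD(1)[OF L] K F(1) a, simplified]] F(2)
              RH.res_comp[OF GL[OF L] rGL[OF L] rGK e(1)[OF L] gmaps_res_gset[OF H F(1)] ac] by simp
        qed
        then show "a \<in> ideal_ext ?H R I (res_gset H (coset_gset G K))"
          using ac by (simp add: ideal_ext_def subgroups_def)
      qed
      show "ideal_ext ?H R I (res_gset H (coset_gset G K)) \<subseteq> J K"
      proof
        fix a assume a: "a \<in> ideal_ext ?H R I (res_gset H (coset_gset G K))"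
        note ac = RH.ideal_ext_carrier[OF I a]
        show "a \<in> J K"
        proof (rule RH.orbit_decomposition[OF rGK ac])
          show "\<zero>\<^bsub>tval R (res_gset H (coset_gset G K))\<^esub> \<in> J K"
            by (rule additive_subgroup.zero_closed[OF ideal.axioms(1)[OF JK]])
          show "b \<oplus>\<^bsub>tval R (res_gset H (coset_gset G K))\<^esub> c \<in> J K" if "b \<in> J K" "c \<in> J K" for b c
            by (rule additive_subgroup.a_closed[OF ideal.axioms(1)[OF JK] that])
          fix L f assume L: "subgroup L ?H" and f: "f \<in> gmaps ?H (coset_gset ?H L) (res_gset H (coset_gset G K))"
          obtain F where F: "F \<in> gmaps G (coset_gset G L) (coset_gset G K)"
            "f = compose (pts (coset_gset ?H L)) F (gid (coset_gset ?H L))" using lift[OF L f] by blast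
          let ?r = "tres R (coset_gset ?H L) (res_gset H (coset_gset G K)) f a"
          have "?r \<in> I L" by (rule RH.ideal_ext_res_coset[OF I rGK a L f])
          then have r: "?r \<in> carrier (tval R (coset_gset ?H L))" "?T L ?r \<in> J L" by (simp_all add: I_iff[OF L])
          \<comment> \<open>Since \<open>T_f = T_F T_eta\<close>, the contribution of this orbit is
            a transfer along a \<open>G\<close>-map of an element of \<open>J L\<close>.\<close>
          show "ttr R (coset_gset ?H L) (res_gset H (coset_gset G K)) f ?r \<in> J K"
            using CG.tideal_gmap(2)[OF J subgroup_HD(1)[OF L] K F(1), simplified, OF r(2)]
              RH.tr_comp[OF GL[OF L] rGL[OF L] rGK e(1)[OF L] gmaps_res_gset[OF H F(1)] r(1)]
              arg_cong[OF F(2), of "\<lambda>h. ttr R (coset_gset ?H L) (res_gset H (coset_gset G K)) h ?r"] by simp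
        qed
      qed
    qed
    then show ?thesis using coind_ideal_apply[OF K] by simp
  qed
  then have "coind_ideal G H R I = J"
    using J coind_ideal_in_tideals[OF I]
    by (intro extensionalityI[of _ "subgroups G"]) (simp_all add: tideals_def subgroups_def)
  with I show ?thesis by blast
qed

lemma bij_betw_coind_ideal:
  "bij_betw (coind_ideal G H R) (tideals (G\<lparr>carrier := H\<rparr>) R) (tideals G (coind H R))"
proof -
  have "inj_on (coind_ideal G H R) (tideals (G\<lparr>carrier := H\<rparr>) R)"
    using coind_ideal_le_iff by (intro inj_onI antisym) (metis order_refl)+
  then show ?thesis
    unfolding bij_betw_def using coind_ideal_in_tideals coind_ideal_surj by blast
qed

lemma coind_ideal_eq_iff:
  "\<lbrakk>I \<in> tideals (G\<lparr>carrier := H\<rparr>) R; J \<in> tideals (G\<lparr>carrier := H\<rparr>) R\<rbrakk> \<Longrightarrow> coind_ideal G H R I = coind_ideal G H R J \<longleftrightarrow> I = J"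
  using bij_betw_imp_inj_on[OF bij_betw_coind_ideal] by (rule inj_on_eq_iff)

section \<open>Products, prime ideals and spectra under coinduction\<close>

lemma coind_ideal_tunit: "coind_ideal G H R (tunit (G\<lparr>carrier := H\<rparr>) R) = tunit G (coind H R)"
proof -
  have "tres R (coset_gset (G\<lparr>carrier := H\<rparr>) L) (res_gset H (coset_gset G K)) f a \<in> carrier (tval R (coset_gset (G\<lparr>carrier := H\<rparr>) L))"
    if "subgroup L (G\<lparr>carrier := H\<rparr>)" "subgroup K G" "f \<in> gmaps (G\<lparr>carrier := H\<rparr>) (coset_gset (G\<lparr>carrier := H\<rparr>) L) (res_gset H (coset_gset G K))"
      "a \<in> carrier (tval R (res_gset H (coset_gset G K)))" for L K f a
    using RH.res_closed[OF RH.coset_gset_closed[OF that(1)] res_coset_gset[OF that(2)] that(3,4)] .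
  then show ?thesis
    by (auto simp: coind_ideal_def tunit_def ideal_ext_def subgroups_def restrict_def fun_eq_iff)
qed

text \<open>Both sides are conditions on products of single elements. From \<open>G\<close> to
  \<open>H\<close>, \<open>T_eta(a) T_eta(b) = T_eta(a b)\<close> by Frobenius reciprocity and
  \<open>R_eta T_eta = id\<close>. From \<open>H\<close> to \<open>G\<close>, restriction to orbits
  is multiplicative. The coinduced product ideal is never identified.\<close>

lemma tprod_coind_ideal_le_iff:
  assumes I: "I \<in> tideals (G\<lparr>carrier := H\<rparr>) R" and J: "J \<in> tideals (G\<lparr>carrier := H\<rparr>) R" and M: "M \<in> tideals (G\<lparr>carrier := H\<rparr>) R"
  shows "tprod G (coind H R) (coind_ideal G H R I) (coind_ideal G H R J) \<le> coind_ideal G H R M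
    \<longleftrightarrow> tprod (G\<lparr>carrier := H\<rparr>) R I J \<le> M"
  unfolding RH.tprod_le_iff[OF I J M]
    CG.tprod_le_iff[OF coind_ideal_in_tideals[OF I] coind_ideal_in_tideals[OF J] coind_ideal_in_tideals[OF M]]
proof (intro iffI allI impI ballI)
  fix L a b
  assume *: "\<forall>K. subgroup K G \<longrightarrow> (\<forall>a\<in>coind_ideal G H R I K. \<forall>b\<in>coind_ideal G H R J K.
      a \<otimes>\<^bsub>tval (coind H R) (coset_gset G K)\<^esub> b \<in> coind_ideal G H R M K)"
    and L: "subgroup L (G\<lparr>carrier := H\<rparr>)" and a: "a \<in> I L" and b: "b \<in> J L"
  note ac = RH.tideal_carrier[OF I L a] and bc = RH.tideal_carrier[OF J L b]
  note GL = RH.coset_gset_closed[OF L] and LG = subgroup_HD(1)[OF L] and e = eta_gmap[OF L]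
  note rGL = res_coset_gset[OF LG]
  let ?T = "ttr R (coset_gset (G\<lparr>carrier := H\<rparr>) L) (res_gset H (coset_gset G L)) (gid (coset_gset (G\<lparr>carrier := H\<rparr>) L))"
  interpret RL: cring "tval R (coset_gset (G\<lparr>carrier := H\<rparr>) L)" by (rule RH.val_cring[OF GL])
  have "?T a \<otimes>\<^bsub>tval R (res_gset H (coset_gset G L))\<^esub> ?T b \<in> coind_ideal G H R M L"
    using * LG tr_eta_in_coind_ideal[OF I L ac] tr_eta_in_coind_ideal[OF J L bc] a b by simp
  then have "?T (a \<otimes>\<^bsub>tval R (coset_gset (G\<lparr>carrier := H\<rparr>) L)\<^esub> b) \<in> coind_ideal G H R M L"
    using RH.tr_frobenius[OF GL rGL e(1) ac RH.tr_closed[OF GL rGL e(1) bc]] RH.res_tr_inj[OF GL rGL e bc] by simp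
  then show "a \<otimes>\<^bsub>tval R (coset_gset (G\<lparr>carrier := H\<rparr>) L)\<^esub> b \<in> M L"
    using tr_eta_in_coind_ideal[OF M L] ac bc by simp
next
  fix K a b
  assume *: "\<forall>L. subgroup L (G\<lparr>carrier := H\<rparr>) \<longrightarrow> (\<forall>a\<in>I L. \<forall>b\<in>J L. a \<otimes>\<^bsub>tval R (coset_gset (G\<lparr>carrier := H\<rparr>) L)\<^esub> b \<in> M L)"
    and K: "subgroup K G" and a': "a \<in> coind_ideal G H R I K" and b': "b \<in> coind_ideal G H R J K"
  note rGK = res_coset_gset[OF K]
  have a: "a \<in> ideal_ext (G\<lparr>carrier := H\<rparr>) R I (res_gset H (coset_gset G K))"
    and b: "b \<in> ideal_ext (G\<lparr>carrier := H\<rparr>) R J (res_gset H (coset_gset G K))"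
    using a' b' coind_ideal_apply[OF K] by simp_all
  note ac = RH.ideal_ext_carrier[OF I a] and bc = RH.ideal_ext_carrier[OF J b]
  interpret RK: cring "tval R (res_gset H (coset_gset G K))" by (rule RH.val_cring[OF rGK])
  have "tres R (coset_gset (G\<lparr>carrier := H\<rparr>) L) (res_gset H (coset_gset G K)) f (a \<otimes>\<^bsub>tval R (res_gset H (coset_gset G K))\<^esub> b) \<in> M L"
    if L: "subgroup L (G\<lparr>carrier := H\<rparr>)" and f: "f \<in> gmaps (G\<lparr>carrier := H\<rparr>) (coset_gset (G\<lparr>carrier := H\<rparr>) L) (res_gset H (coset_gset G K))" for L f
    using * L RH.ideal_ext_res_coset[OF I rGK a L f] RH.ideal_ext_res_coset[OF J rGK b L f]
      RH.res_mult[OF RH.coset_gset_closed[OF L] rGK f ac bc] by simp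
  then show "a \<otimes>\<^bsub>tval (coind H R) (coset_gset G K)\<^esub> b \<in> coind_ideal G H R M K"
    using coind_ideal_apply[OF K] ac bc by (simp add: ideal_ext_def subgroups_def)
qed

text \<open>Every Tambara ideal of the coinduced functor is coinduced, so quantifiers over ideals
  translate, and the order and the product condition translate with them.\<close>

lemma coind_ideal_tprimes_iff:
  assumes P: "P \<in> tideals (G\<lparr>carrier := H\<rparr>) R"
  shows "coind_ideal G H R P \<in> tprimes G (coind H R) \<longleftrightarrow> P \<in> tprimes (G\<lparr>carrier := H\<rparr>) R"
proof -
  have im: "tideals G (coind H R) = coind_ideal G H R ` tideals (G\<lparr>carrier := H\<rparr>) R"
    using bij_betw_imp_surj_on[OF bij_betw_coind_ideal] by simp
  have ne: "coind_ideal G H R P \<noteq> tunit G (coind H R) \<longleftrightarrow> P \<noteq> tunit (G\<lparr>carrier := H\<rparr>) R"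
    using coind_ideal_eq_iff[OF P tunit_in_tideals[OF RH]] coind_ideal_tunit by simp
  have "(\<forall>I\<in>tideals G (coind H R). \<forall>J\<in>tideals G (coind H R).
      tprod G (coind H R) I J \<le> coind_ideal G H R P \<longrightarrow> I \<le> coind_ideal G H R P \<or> J \<le> coind_ideal G H R P)
    \<longleftrightarrow> (\<forall>I\<in>tideals (G\<lparr>carrier := H\<rparr>) R. \<forall>J\<in>tideals (G\<lparr>carrier := H\<rparr>) R. tprod (G\<lparr>carrier := H\<rparr>) R I J \<le> P \<longrightarrow> I \<le> P \<or> J \<le> P)"
    unfolding im by (simp add: tprod_coind_ideal_le_iff[OF _ _ P] coind_ideal_le_iff[OF _ P])
  then show ?thesis
    using P coind_ideal_in_tideals[OF P] ne by (simp add: tprimes_def)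
qed

lemma bij_betw_coind_ideal_tprimes:
  "bij_betw (coind_ideal G H R) (tprimes (G\<lparr>carrier := H\<rparr>) R) (tprimes G (coind H R))"
proof -
  have sub: "tprimes (G\<lparr>carrier := H\<rparr>) R \<subseteq> tideals (G\<lparr>carrier := H\<rparr>) R" "tprimes G (coind H R) \<subseteq> tideals G (coind H R)"
    by (auto simp: tprimes_def)
  have "coind_ideal G H R ` tprimes (G\<lparr>carrier := H\<rparr>) R = tprimes G (coind H R)"
  proof (intro equalityI subsetI)
    fix Q assume "Q \<in> coind_ideal G H R ` tprimes (G\<lparr>carrier := H\<rparr>) R"
    then show "Q \<in> tprimes G (coind H R)" using coind_ideal_tprimes_iff sub(1) by blast
  next
    fix Q assume Q: "Q \<in> tprimes G (coind H R)"
    then obtain P where "P \<in> tideals (G\<lparr>carrier := H\<rparr>) R" "coind_ideal G H R P = Q"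
      using coind_ideal_surj sub(2) by blast
    then show "Q \<in> coind_ideal G H R ` tprimes (G\<lparr>carrier := H\<rparr>) R" using coind_ideal_tprimes_iff Q by blast
  qed
  then show ?thesis using bij_betw_subset[OF bij_betw_coind_ideal sub(1)] by simp
qed

text \<open>All closed sets on the coinduced side have the form \<open>V(CoInd I)\<close>, and the
  order isomorphism matches this set with \<open>V(I)\<close>. The same match yields continuity and
  closedness.\<close>

lemma homeomorphic_map_coind_ideal:
  "homeomorphic_map (nakaoka_spec (G\<lparr>carrier := H\<rparr>) R) (nakaoka_spec G (coind H R)) (coind_ideal G H R)"
proof (rule bijective_closed_imp_homeomorphic_map)
  note b = bij_betw_coind_ideal_tprimes
  note cR = closedin_nakaoka_spec[OF RH] closedin_nakaoka_spec[OF CG.tambara_functor_axioms]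
  note tR = topspace_nakaoka_spec[OF RH] topspace_nakaoka_spec[OF CG.tambara_functor_axioms]
  have pre: "{P \<in> tprimes (G\<lparr>carrier := H\<rparr>) R. coind_ideal G H R P \<in> tvanish G (coind H R) (coind_ideal G H R I)} = tvanish (G\<lparr>carrier := H\<rparr>) R I"
    if "I \<in> tideals (G\<lparr>carrier := H\<rparr>) R" for I
    using bij_betw_apply[OF b] coind_ideal_le_iff[OF that] by (auto simp: tvanish_def tprimes_def)
  show "coind_ideal G H R ` topspace (nakaoka_spec (G\<lparr>carrier := H\<rparr>) R) = topspace (nakaoka_spec G (coind H R))"
    "inj_on (coind_ideal G H R) (topspace (nakaoka_spec (G\<lparr>carrier := H\<rparr>) R))"
    using b by (simp_all add: tR bij_betw_def)
  show "continuous_map (nakaoka_spec (G\<lparr>carrier := H\<rparr>) R) (nakaoka_spec G (coind H R)) (coind_ideal G H R)"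
    unfolding continuous_map_closedin tR cR
  proof (intro conjI allI impI)
    show "coind_ideal G H R \<in> tprimes (G\<lparr>carrier := H\<rparr>) R \<rightarrow> tprimes G (coind H R)"
      using bij_betw_apply[OF b] by blast
    fix C assume "\<exists>J\<in>tideals G (coind H R). C = tvanish G (coind H R) J"
    then obtain I where "I \<in> tideals (G\<lparr>carrier := H\<rparr>) R" "C = tvanish G (coind H R) (coind_ideal G H R I)"
      using coind_ideal_surj by blast
    then show "\<exists>I\<in>tideals (G\<lparr>carrier := H\<rparr>) R. {P \<in> tprimes (G\<lparr>carrier := H\<rparr>) R. coind_ideal G H R P \<in> C} = tvanish (G\<lparr>carrier := H\<rparr>) R I"
      using pre by blast
  qed
  show "closed_map (nakaoka_spec (G\<lparr>carrier := H\<rparr>) R) (nakaoka_spec G (coind H R)) (coind_ideal G H R)"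
    unfolding closed_map_def cR
  proof (intro allI impI)
    fix C assume "\<exists>I\<in>tideals (G\<lparr>carrier := H\<rparr>) R. C = tvanish (G\<lparr>carrier := H\<rparr>) R I"
    then obtain I where I: "I \<in> tideals (G\<lparr>carrier := H\<rparr>) R" "C = tvanish (G\<lparr>carrier := H\<rparr>) R I" by blast
    have "tvanish G (coind H R) (coind_ideal G H R I) \<subseteq> coind_ideal G H R ` tprimes (G\<lparr>carrier := H\<rparr>) R"
      using bij_betw_imp_surj_on[OF b] by (auto simp: tvanish_def)
    then have "coind_ideal G H R ` C = tvanish G (coind H R) (coind_ideal G H R I)"
      using pre[OF I(1)] I(2) by blast
    then show "\<exists>J\<in>tideals G (coind H R). coind_ideal G H R ` C = tvanish G (coind H R) J"
      using coind_ideal_in_tideals[OF I(1)] by blast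
  qed
qed

end

section \<open>Preimages of Tambara ideals\<close>

text \<open>\<open>D\<close> ranges over all finite \<open>G\<close>-sets rather than over orbits:
  sums are then absorbed by coproducts, and the outcome of an exponential diagram, whose
  \<open>D\<close> is seldom transitive, has the same shape again.\<close>

definition tgenerated ::
  "'g monoid \<Rightarrow> ('g, 'r) tambara \<Rightarrow> ('g, 's) tambara \<Rightarrow> ('g gset \<Rightarrow> 'r \<Rightarrow> 's) \<Rightarrow> ('g set \<Rightarrow> 'r set) \<Rightarrow> 'g gset \<Rightarrow> 's set"
where
  "tgenerated G R S \<phi> I X = {ttr S D X u (c \<otimes>\<^bsub>tval S D\<^esub> \<phi> D i) | D u c i.
     D \<in> gsets G \<and> u \<in> gmaps G D X \<and> c \<in> carrier (tval S D) \<and> i \<in> ideal_ext G R I D}"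

definition tgenerated_ideal ::
  "'g monoid \<Rightarrow> ('g, 'r) tambara \<Rightarrow> ('g, 's) tambara \<Rightarrow> ('g gset \<Rightarrow> 'r \<Rightarrow> 's) \<Rightarrow> ('g set \<Rightarrow> 'r set) \<Rightarrow> 'g set \<Rightarrow> 's set"
where
  "tgenerated_ideal G R S \<phi> I = (\<lambda>K\<in>subgroups G. tgenerated G R S \<phi> I (coset_gset G K))"

context
  fixes G :: "'g monoid" and R :: "('g, 'r) tambara" and S :: "('g, 's) tambara" and \<phi>
  assumes R: "tambara_functor G R" and S: "tambara_functor G S" and \<phi>: "tambara_morphism G R S \<phi>"
begin

interpretation R: tambara_functor G R by (rule R)
interpretation S: tambara_functor G S by (rule S)

lemma morphism_hom: "X \<in> gsets G \<Longrightarrow> \<phi> X \<in> ring_hom (tval R X) (tval S X)"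
  using \<phi> by (simp add: tambara_morphism_def)

lemma morphism_closed: "\<lbrakk>X \<in> gsets G; a \<in> carrier (tval R X)\<rbrakk> \<Longrightarrow> \<phi> X a \<in> carrier (tval S X)"
  by (rule ring_hom_closed[OF morphism_hom])

lemma morphism_mult: "\<lbrakk>X \<in> gsets G; a \<in> carrier (tval R X); b \<in> carrier (tval R X)\<rbrakk>
    \<Longrightarrow> \<phi> X (a \<otimes>\<^bsub>tval R X\<^esub> b) = \<phi> X a \<otimes>\<^bsub>tval S X\<^esub> \<phi> X b"
  by (rule ring_hom_mult[OF morphism_hom])

lemma morphism_commute:
  assumes "X \<in> gsets G" "Y \<in> gsets G" "f \<in> gmaps G X Y"
  shows "a \<in> carrier (tval R Y) \<Longrightarrow> \<phi> X (tres R X Y f a) = tres S X Y f (\<phi> Y a)"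
    and "b \<in> carrier (tval R X) \<Longrightarrow> \<phi> Y (ttr R X Y f b) = ttr S X Y f (\<phi> X b)"
    and "b \<in> carrier (tval R X) \<Longrightarrow> \<phi> Y (tnm R X Y f b) = tnm S X Y f (\<phi> X b)"
  using \<phi> assms by (simp_all add: tambara_morphism_def)

lemma tpreimage_iff:
  "subgroup K G \<Longrightarrow> a \<in> tpreimage G R \<phi> J K \<longleftrightarrow> a \<in> carrier (tval R (coset_gset G K)) \<and> \<phi> (coset_gset G K) a \<in> J K"
  by (simp add: tpreimage_def subgroups_def)

lemma tpreimage_in_tideals:
  assumes J: "J \<in> tideals G S"
  shows "tpreimage G R \<phi> J \<in> tideals G R"
  unfolding tideals_def
proof (intro CollectI conjI ballI impI)
  show "tpreimage G R \<phi> J \<in> extensional (subgroups G)" by (simp add: tpreimage_def)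
next
  fix K assume "K \<in> subgroups G"
  then have K: "subgroup K G" by (simp add: subgroups_def)
  note X = R.coset_gset_closed[OF K]
  interpret RK: cring "tval R (coset_gset G K)" by (rule R.val_cring[OF X])
  interpret SK: cring "tval S (coset_gset G K)" by (rule S.val_cring[OF X])
  interpret JK: ideal "J K" "tval S (coset_gset G K)" by (rule S.tideal_ideal[OF J K])
  note hom = morphism_hom[OF X]
  show "ideal (tpreimage G R \<phi> J K) (tval R (coset_gset G K))"
  proof (rule cring_idealI[OF RK.cring_axioms])
    show "tpreimage G R \<phi> J K \<subseteq> carrier (tval R (coset_gset G K))" using tpreimage_iff[OF K] by blast
    show "\<zero>\<^bsub>tval R (coset_gset G K)\<^esub> \<in> tpreimage G R \<phi> J K"
      using ring_hom_zero[OF hom RK.ring_axioms SK.ring_axioms] by (simp add: tpreimage_iff[OF K])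
    show "a \<oplus>\<^bsub>tval R (coset_gset G K)\<^esub> b \<in> tpreimage G R \<phi> J K"
      if "a \<in> tpreimage G R \<phi> J K" "b \<in> tpreimage G R \<phi> J K" for a b
      using that ring_hom_add[OF hom, of a b] by (simp add: tpreimage_iff[OF K])
    show "x \<otimes>\<^bsub>tval R (coset_gset G K)\<^esub> a \<in> tpreimage G R \<phi> J K"
      if "a \<in> tpreimage G R \<phi> J K" "x \<in> carrier (tval R (coset_gset G K))" for a x
      using that morphism_mult[OF X, of x a] JK.I_l_closed morphism_closed[OF X, of x]
      by (simp add: tpreimage_iff[OF K])
  qed
next
  fix K L a assume "K \<in> subgroups G" "L \<in> subgroups G" and KL: "K \<subseteq> L"
  then have K: "subgroup K G" and L: "subgroup L G" by (simp_all add: subgroups_def)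
  note X = R.coset_gset_closed[OF K] R.coset_gset_closed[OF L] coset_proj_in_gmaps[OF R.group K L KL]
  show "ttr R (coset_gset G K) (coset_gset G L) (coset_proj G K L) a \<in> tpreimage G R \<phi> J L"
    if "a \<in> tpreimage G R \<phi> J K"
    using that morphism_commute(2)[OF X, of a] R.tr_closed[OF X, of a] S.tideal_gmap(2)[OF J K L X(3)]
    by (simp add: tpreimage_iff[OF K] tpreimage_iff[OF L])
  show "tnm R (coset_gset G K) (coset_gset G L) (coset_proj G K L) a \<in> tpreimage G R \<phi> J L"
    if "a \<in> tpreimage G R \<phi> J K"
    using that morphism_commute(3)[OF X, of a] R.nm_closed[OF X, of a] S.tideal_gmap(3)[OF J K L X(3)]
    by (simp add: tpreimage_iff[OF K] tpreimage_iff[OF L])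
  show "tres R (coset_gset G K) (coset_gset G L) (coset_proj G K L) a \<in> tpreimage G R \<phi> J K"
    if "a \<in> tpreimage G R \<phi> J L"
    using that morphism_commute(1)[OF X, of a] R.res_closed[OF X, of a] S.tideal_gmap(1)[OF J K L X(3)]
    by (simp add: tpreimage_iff[OF K] tpreimage_iff[OF L])
next
  fix K g a assume "K \<in> subgroups G" and g: "g \<in> carrier G" and a: "a \<in> tpreimage G R \<phi> J K"
  then have K: "subgroup K G" by (simp add: subgroups_def)
  note C = subgroup_conj_subgroup[OF R.group K g]
  note X = R.coset_gset_closed[OF C] R.coset_gset_closed[OF K] coset_conj_in_gmaps[OF R.group K g]
  show "tres R (coset_gset G (conj_subgroup G g K)) (coset_gset G K) (coset_conj G g K) a
      \<in> tpreimage G R \<phi> J (conj_subgroup G g K)"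
    using a morphism_commute(1)[OF X, of a] R.res_closed[OF X, of a] S.tideal_gmap(1)[OF J C K X(3)]
    by (simp add: tpreimage_iff[OF K] tpreimage_iff[OF C])
qed

lemma ideal_ext_tpreimage:
  assumes J: "J \<in> tideals G S" and X: "X \<in> gsets G" and a: "a \<in> ideal_ext G R (tpreimage G R \<phi> J) X"
  shows "\<phi> X a \<in> ideal_ext G S J X"
proof -
  note ac = R.ideal_ext_carrier[OF tpreimage_in_tideals[OF J] a]
  have "tres S (coset_gset G K) X f (\<phi> X a) \<in> J K"
    if K: "subgroup K G" and f: "f \<in> gmaps G (coset_gset G K) X" for K f
    using R.ideal_ext_res_coset[OF tpreimage_in_tideals[OF J] X a K f]
      morphism_commute(1)[OF R.coset_gset_closed[OF K] X f ac] by (simp add: tpreimage_iff[OF K])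
  then show ?thesis using morphism_closed[OF X ac] by (simp add: ideal_ext_def subgroups_def)
qed

context
  fixes I assumes I: "I \<in> tideals G R"
begin

private abbreviation "gen \<equiv> tgenerated G R S \<phi> I"

lemma tgeneratedI:
  "\<lbrakk>D \<in> gsets G; u \<in> gmaps G D X; c \<in> carrier (tval S D); i \<in> ideal_ext G R I D\<rbrakk>
    \<Longrightarrow> ttr S D X u (c \<otimes>\<^bsub>tval S D\<^esub> \<phi> D i) \<in> gen X"
  by (auto simp: tgenerated_def)

lemma tgeneratedE:
  assumes "a \<in> gen X"
  obtains D u c i where "D \<in> gsets G" "u \<in> gmaps G D X" "c \<in> carrier (tval S D)" "i \<in> ideal_ext G R I D"
    "i \<in> carrier (tval R D)" "\<phi> D i \<in> carrier (tval S D)" "c \<otimes>\<^bsub>tval S D\<^esub> \<phi> D i \<in> carrier (tval S D)"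
    "a = ttr S D X u (c \<otimes>\<^bsub>tval S D\<^esub> \<phi> D i)"
proof -
  obtain D u c i where *: "D \<in> gsets G" "u \<in> gmaps G D X" "c \<in> carrier (tval S D)" "i \<in> ideal_ext G R I D"
    "a = ttr S D X u (c \<otimes>\<^bsub>tval S D\<^esub> \<phi> D i)"
    using assms by (auto simp: tgenerated_def)
  note i = R.ideal_ext_carrier[OF I *(4)]
  note p = morphism_closed[OF *(1) i]
  show ?thesis by (rule that[OF *(1-4) i p monoid.m_closed[OF S.val_monoid[OF *(1)] *(3) p] *(5)])
qed

lemma tgenerated_carrier: "\<lbrakk>X \<in> gsets G; a \<in> gen X\<rbrakk> \<Longrightarrow> a \<in> carrier (tval S X)"
  by (erule tgeneratedE) (simp add: S.tr_closed)

lemma tgenerated_morphism: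
  assumes X: "X \<in> gsets G" and i: "i \<in> ideal_ext G R I X"
  shows "\<phi> X i \<in> gen X"
proof -
  interpret SX: cring "tval S X" by (rule S.val_cring[OF X])
  note p = morphism_closed[OF X R.ideal_ext_carrier[OF I i]]
  show ?thesis
    using tgeneratedI[OF X gid_in_gmaps[OF X] SX.one_closed i] S.tr_id[OF X p] p by simp
qed

text \<open>Two transfers into \<open>X\<close> add up to one transfer out of the coproduct of their
  sources. Coefficients and ideal elements are glued there componentwise.\<close>

lemma tgenerated_add:
  assumes X: "X \<in> gsets G" and a: "a \<in> gen X" and b: "b \<in> gen X"
  shows "a \<oplus>\<^bsub>tval S X\<^esub> b \<in> gen X"
proof -
  obtain D u c i where D: "D \<in> gsets G" "u \<in> gmaps G D X" "c \<in> carrier (tval S D)" "i \<in> ideal_ext G R I D"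
    "i \<in> carrier (tval R D)" "\<phi> D i \<in> carrier (tval S D)" "c \<otimes>\<^bsub>tval S D\<^esub> \<phi> D i \<in> carrier (tval S D)"
    "a = ttr S D X u (c \<otimes>\<^bsub>tval S D\<^esub> \<phi> D i)"
    using a by (rule tgeneratedE)
  obtain E v d j where E: "E \<in> gsets G" "v \<in> gmaps G E X" "d \<in> carrier (tval S E)" "j \<in> ideal_ext G R I E"
    "j \<in> carrier (tval R E)" "\<phi> E j \<in> carrier (tval S E)" "d \<otimes>\<^bsub>tval S E\<^esub> \<phi> E j \<in> carrier (tval S E)"
    "b = ttr S E X v (d \<otimes>\<^bsub>tval S E\<^esub> \<phi> E j)"
    using b by (rule tgeneratedE)
  obtain F k l where F: "F \<in> gsets G" and cp: "is_coproduct G D E F k l"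
    by (rule coproduct_exists[OF D(1) E(1)])
  note kl = coproductD(1,2)[OF cp]
  obtain h where h: "h \<in> gmaps G F X" "compose (pts D) h k = u" "compose (pts E) h l = v"
    by (rule coproduct_copair[OF D(1) E(1) F cp D(2) E(2)])
  obtain m where m: "m \<in> carrier (tval S F)" "tres S D F k m = c" "tres S E F l m = d"
    by (rule S.coproduct_pair[OF D(1) E(1) F cp D(3) E(3)])
  obtain n where n: "n \<in> carrier (tval R F)" "tres R D F k n = i" "tres R E F l n = j"
    by (rule R.coproduct_pair[OF D(1) E(1) F cp D(5) E(5)])
  have nI: "n \<in> ideal_ext G R I F"
    using ideal_ext_coproduct[OF R D(1) E(1) F cp n(1)] n(2,3) D(4) E(4) by simp
  note pn = morphism_closed[OF F n(1)]
  interpret SF: cring "tval S F" by (rule S.val_cring[OF F])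
  have "ttr S F X h (m \<otimes>\<^bsub>tval S F\<^esub> \<phi> F n) = a \<oplus>\<^bsub>tval S X\<^esub> b"
    using S.coproduct_tr[OF D(1) E(1) F cp X h(1) SF.m_closed[OF m(1) pn]] h(2,3) D(8) E(8)
      S.res_mult[OF D(1) F kl(1) m(1) pn] S.res_mult[OF E(1) F kl(2) m(1) pn] m(2,3)
      morphism_commute(1)[OF D(1) F kl(1) n(1)] morphism_commute(1)[OF E(1) F kl(2) n(1)] n(2,3) by simp
  then show ?thesis using tgeneratedI[OF F h(1) m(1) nI] by simp
qed

text \<open>Frobenius reciprocity moves the factor \<open>x\<close> inside the transfer, where it is
  absorbed by the coefficient.\<close>

lemma tgenerated_mult:
  assumes X: "X \<in> gsets G" and a: "a \<in> gen X" and x: "x \<in> carrier (tval S X)"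
  shows "x \<otimes>\<^bsub>tval S X\<^esub> a \<in> gen X"
proof -
  obtain D u c i where D: "D \<in> gsets G" "u \<in> gmaps G D X" "c \<in> carrier (tval S D)" "i \<in> ideal_ext G R I D"
    "i \<in> carrier (tval R D)" "\<phi> D i \<in> carrier (tval S D)" "c \<otimes>\<^bsub>tval S D\<^esub> \<phi> D i \<in> carrier (tval S D)"
    "a = ttr S D X u (c \<otimes>\<^bsub>tval S D\<^esub> \<phi> D i)"
    using a by (rule tgeneratedE)
  interpret SD: cring "tval S D" by (rule S.val_cring[OF D(1)])
  interpret SX: cring "tval S X" by (rule S.val_cring[OF X])
  note r = S.res_closed[OF D(1) X D(2) x]
  have "x \<otimes>\<^bsub>tval S X\<^esub> a = ttr S D X u ((c \<otimes>\<^bsub>tval S D\<^esub> \<phi> D i) \<otimes>\<^bsub>tval S D\<^esub> tres S D X u x)"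
    using S.tr_frobenius[OF D(1) X D(2,7) x] x S.tr_closed[OF D(1) X D(2,7)] D(8) by (simp add: SX.m_comm)
  also have "(c \<otimes>\<^bsub>tval S D\<^esub> \<phi> D i) \<otimes>\<^bsub>tval S D\<^esub> tres S D X u x = (tres S D X u x \<otimes>\<^bsub>tval S D\<^esub> c) \<otimes>\<^bsub>tval S D\<^esub> \<phi> D i"
    using r D(3,6) by (simp add: SD.m_ac)
  finally show ?thesis using tgeneratedI[OF D(1,2) SD.m_closed[OF r D(3)] D(4)] by simp
qed

text \<open>Base change pulls the transfer, its coefficient and the ideal element back to the fibre
  product.\<close>

lemma tgenerated_res:
  assumes X: "X \<in> gsets G" "Y \<in> gsets G" and f: "f \<in> gmaps G Y X" and a: "a \<in> gen X"
  shows "tres S Y X f a \<in> gen Y"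
proof -
  obtain D u c i where D: "D \<in> gsets G" "u \<in> gmaps G D X" "c \<in> carrier (tval S D)" "i \<in> ideal_ext G R I D"
    "i \<in> carrier (tval R D)" "\<phi> D i \<in> carrier (tval S D)" "c \<otimes>\<^bsub>tval S D\<^esub> \<phi> D i \<in> carrier (tval S D)"
    "a = ttr S D X u (c \<otimes>\<^bsub>tval S D\<^esub> \<phi> D i)"
    using a by (rule tgeneratedE)
  obtain P p p' where P: "P \<in> gsets G" and pb: "is_pullback G D Y X P u f p p'"
    by (rule pullback_exists[OF D(1) X(2) D(2) f])
  note p = pullbackD(3,4)[OF pb]
  show ?thesis
    using tgeneratedI[OF P p(2) S.res_closed[OF P D(1) p(1) D(3)] R.ideal_ext_res[OF I P D(1) p(1) D(4)]]
      S.res_tr[OF D(1) X(2,1) P pb D(7)] D(8) S.res_mult[OF P D(1) p(1) D(3,6)]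
      morphism_commute(1)[OF P D(1) p(1) D(5)] by simp
qed

lemma tgenerated_tr:
  assumes X: "X \<in> gsets G" "Y \<in> gsets G" and f: "f \<in> gmaps G X Y" and a: "a \<in> gen X"
  shows "ttr S X Y f a \<in> gen Y"
proof -
  obtain D u c i where D: "D \<in> gsets G" "u \<in> gmaps G D X" "c \<in> carrier (tval S D)" "i \<in> ideal_ext G R I D"
    "i \<in> carrier (tval R D)" "\<phi> D i \<in> carrier (tval S D)" "c \<otimes>\<^bsub>tval S D\<^esub> \<phi> D i \<in> carrier (tval S D)"
    "a = ttr S D X u (c \<otimes>\<^bsub>tval S D\<^esub> \<phi> D i)"
    using a by (rule tgeneratedE)
  show ?thesis
    using tgeneratedI[OF D(1) compose_in_gmaps[OF D(1,2) f] D(3,4)] S.tr_comp[OF D(1) X D(2) f D(7)] D(8) by simp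
qed

text \<open>An exponential diagram rewrites the norm of a transfer as a transfer of a norm, and
  norms are multiplicative and commute with \<open>phi\<close>. The map \<open>p'\<close> inherits
  surjectivity from \<open>f\<close>, which keeps the norm of the ideal element in the extended
  ideal.\<close>

lemma tgenerated_nm:
  assumes X: "X \<in> gsets G" "Y \<in> gsets G" and f: "f \<in> gmaps G X Y" "pts Y \<subseteq> f ` pts X" and a: "a \<in> gen X"
  shows "tnm S X Y f a \<in> gen Y"
proof -
  obtain D u c i where D: "D \<in> gsets G" "u \<in> gmaps G D X" "c \<in> carrier (tval S D)" "i \<in> ideal_ext G R I D"
    "i \<in> carrier (tval R D)" "\<phi> D i \<in> carrier (tval S D)" "c \<otimes>\<^bsub>tval S D\<^esub> \<phi> D i \<in> carrier (tval S D)"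
    "a = ttr S D X u (c \<otimes>\<^bsub>tval S D\<^esub> \<phi> D i)"
    using a by (rule tgeneratedE)
  obtain P E p p' q e where P: "P \<in> gsets G" and E: "E \<in> gsets G" and ex: "is_exponential G D X Y P E u f p p' q e"
    by (rule exponential_exists[OF D(1) X D(2) f(1)])
  have e: "e \<in> gmaps G P D" and pb: "is_pullback G X E Y P f q p p'"
    using ex by (simp_all add: is_exponential_def)
  note p = pullbackD(2,4)[OF pb]
  have surj: "pts E \<subseteq> p' ` pts P"
  proof
    fix d assume d: "d \<in> pts E"
    obtain x where "x \<in> pts X" "q d = f x" using gmap_mem[OF p(1) d] f(2) by blast
    then obtain w where "w \<in> pts P" "p' w = d" using pullbackD(6)[OF pb _ d, of x] by auto
    then show "d \<in> p' ` pts P" by blast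
  qed
  note ei = R.ideal_ext_res[OF I P D(1) e D(4)]
  note eic = R.res_closed[OF P D(1) e D(5)] and ec = S.res_closed[OF P D(1) e D(3)]
    and ep = S.res_closed[OF P D(1) e D(6)]
  show ?thesis
    using tgeneratedI[OF E p(1) S.nm_closed[OF P E p(2) ec] R.ideal_ext_nm[OF I P E p(2) surj ei]]
      S.nm_tr[OF D(1) X P E ex D(7)] D(8) S.res_mult[OF P D(1) e D(3,6)] S.nm_mult[OF P E p(2) ec ep]
      morphism_commute(1)[OF P D(1) e D(5)] morphism_commute(3)[OF P E p(2) eic] by simp
qed

lemma tgenerated_ideal_in_tideals: "tgenerated_ideal G R S \<phi> I \<in> tideals G S"
  unfolding tideals_def
proof (intro CollectI conjI ballI impI)
  show "tgenerated_ideal G R S \<phi> I \<in> extensional (subgroups G)" by (simp add: tgenerated_ideal_def)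
next
  fix K assume Ks: "K \<in> subgroups G"
  then have K: "subgroup K G" by (simp add: subgroups_def)
  note X = R.coset_gset_closed[OF K]
  have "\<zero>\<^bsub>tval R (coset_gset G K)\<^esub> \<in> ideal_ext G R I (coset_gset G K)"
    by (rule additive_subgroup.zero_closed[OF ideal.axioms(1)[OF R.ideal_ext_ideal[OF I X]]])
  then have "\<zero>\<^bsub>tval S (coset_gset G K)\<^esub> \<in> gen (coset_gset G K)"
    using tgenerated_morphism[OF X] ring_hom_zero[OF morphism_hom[OF X] R.val_ring[OF X] S.val_ring[OF X]] by metis
  then have "ideal (gen (coset_gset G K)) (tval S (coset_gset G K))"
    using tgenerated_carrier[OF X] tgenerated_add[OF X] tgenerated_mult[OF X]
    by (intro cring_idealI[OF S.val_cring[OF X]]) auto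
  then show "ideal (tgenerated_ideal G R S \<phi> I K) (tval S (coset_gset G K))"
    using Ks by (simp add: tgenerated_ideal_def)
next
  fix K L a assume KLs: "K \<in> subgroups G" "L \<in> subgroups G" and KL: "K \<subseteq> L"
  then have K: "subgroup K G" and L: "subgroup L G" by (simp_all add: subgroups_def)
  note p = coset_proj_in_gmaps[OF R.group K L KL]
  note X = R.coset_gset_closed[OF K] R.coset_gset_closed[OF L] p
  have ne: "pts (coset_gset G K) \<noteq> {}" using coset_base[OF R.group K] by blast
  have surj: "pts (coset_gset G L) \<subseteq> coset_proj G K L ` pts (coset_gset G K)"
    using gmap_coset_surj[OF R.group X(1) L p ne R.finite_group] by simp
  show "ttr S (coset_gset G K) (coset_gset G L) (coset_proj G K L) a \<in> tgenerated_ideal G R S \<phi> I L"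
    if "a \<in> tgenerated_ideal G R S \<phi> I K"
    using that KLs tgenerated_tr[OF X] by (simp add: tgenerated_ideal_def)
  show "tnm S (coset_gset G K) (coset_gset G L) (coset_proj G K L) a \<in> tgenerated_ideal G R S \<phi> I L"
    if "a \<in> tgenerated_ideal G R S \<phi> I K"
    using that KLs tgenerated_nm[OF X surj] by (simp add: tgenerated_ideal_def)
  show "tres S (coset_gset G K) (coset_gset G L) (coset_proj G K L) a \<in> tgenerated_ideal G R S \<phi> I K"
    if "a \<in> tgenerated_ideal G R S \<phi> I L"
    using that KLs tgenerated_res[OF X(2,1,3)] by (simp add: tgenerated_ideal_def)
next
  fix K g a assume Ks: "K \<in> subgroups G" and g: "g \<in> carrier G" and a: "a \<in> tgenerated_ideal G R S \<phi> I K"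
  then have K: "subgroup K G" by (simp add: subgroups_def)
  note C = subgroup_conj_subgroup[OF R.group K g]
  show "tres S (coset_gset G (conj_subgroup G g K)) (coset_gset G K) (coset_conj G g K) a
      \<in> tgenerated_ideal G R S \<phi> I (conj_subgroup G g K)"
    using a Ks C tgenerated_res[OF R.coset_gset_closed[OF K] R.coset_gset_closed[OF C] coset_conj_in_gmaps[OF R.group K g]]
    by (simp add: tgenerated_ideal_def subgroups_def)
qed

text \<open>Extension and contraction of ideals are adjoint. Primality of preimages and the
  description of preimages of closed sets both come from this equivalence.\<close>

lemma tgenerated_ideal_le_iff:
  assumes J: "J \<in> tideals G S"
  shows "tgenerated_ideal G R S \<phi> I \<le> J \<longleftrightarrow> I \<le> tpreimage G R \<phi> J"
proof
  assume le: "tgenerated_ideal G R S \<phi> I \<le> J"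
  show "I \<le> tpreimage G R \<phi> J"
  proof (rule tideals_leI[OF I tpreimage_in_tideals[OF J]], rule subsetI)
    fix K a assume Ks: "K \<in> subgroups G" and a: "a \<in> I K"
    then have K: "subgroup K G" by (simp add: subgroups_def)
    have "\<phi> (coset_gset G K) a \<in> tgenerated_ideal G R S \<phi> I K"
      using tgenerated_morphism[OF R.coset_gset_closed[OF K], of a] ideal_ext_coset_gset[OF R I Ks] a Ks
      by (simp add: tgenerated_ideal_def)
    then show "a \<in> tpreimage G R \<phi> J K"
      using le_funD[OF le, of K] R.tideal_carrier[OF I K a] by (auto simp: tpreimage_iff[OF K])
  qed
next
  assume le: "I \<le> tpreimage G R \<phi> J"
  show "tgenerated_ideal G R S \<phi> I \<le> J"
  proof (rule tideals_leI[OF tgenerated_ideal_in_tideals J], rule subsetI)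
    fix K a assume Ks: "K \<in> subgroups G" and "a \<in> tgenerated_ideal G R S \<phi> I K"
    then have K: "subgroup K G" and "a \<in> gen (coset_gset G K)" by (simp_all add: subgroups_def tgenerated_ideal_def)
    then obtain D u c i where D: "D \<in> gsets G" "u \<in> gmaps G D (coset_gset G K)" "c \<in> carrier (tval S D)"
      "i \<in> ideal_ext G R I D" "i \<in> carrier (tval R D)" "\<phi> D i \<in> carrier (tval S D)"
      "c \<otimes>\<^bsub>tval S D\<^esub> \<phi> D i \<in> carrier (tval S D)" "a = ttr S D (coset_gset G K) u (c \<otimes>\<^bsub>tval S D\<^esub> \<phi> D i)"
      by (elim tgeneratedE)
    have "i \<in> ideal_ext G R (tpreimage G R \<phi> J) D"
      using D(4) le by (auto simp: ideal_ext_def le_fun_def)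
    then have "\<phi> D i \<in> ideal_ext G S J D" by (rule ideal_ext_tpreimage[OF J D(1)])
    then have "a \<in> ideal_ext G S J (coset_gset G K)"
      using S.ideal_ext_tr[OF J D(1) S.coset_gset_closed[OF K] D(2)]
        ideal.I_l_closed[OF S.ideal_ext_ideal[OF J D(1)] _ D(3)] D(8) by simp
    then show "a \<in> J K" using ideal_ext_coset_gset[OF S J Ks] by simp
  qed
qed

end

text \<open>
  A product of two transfers \<open>T\<^sub>u(c \<phi>(i)) T\<^sub>v(d \<phi>(j))\<close> is again a transfer, of a multiple of some \<open>\<phi>(i' j')\<close>,
  by Frobenius reciprocity and the double coset formula.
\<close>

lemma tprod_tgenerated_ideal_le:
  assumes I: "I \<in> tideals G R" and J: "J \<in> tideals G R" and Q: "Q \<in> tideals G S"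
    and le: "tprod G R I J \<le> tpreimage G R \<phi> Q"
  shows "tprod G S (tgenerated_ideal G R S \<phi> I) (tgenerated_ideal G R S \<phi> J) \<le> Q"
  unfolding S.tprod_le_iff[OF tgenerated_ideal_in_tideals[OF I] tgenerated_ideal_in_tideals[OF J] Q]
proof (intro allI impI ballI)
  fix K a b assume K: "subgroup K G"
    and "a \<in> tgenerated_ideal G R S \<phi> I K" and "b \<in> tgenerated_ideal G R S \<phi> J K"
  then have a: "a \<in> tgenerated G R S \<phi> I (coset_gset G K)" and b: "b \<in> tgenerated G R S \<phi> J (coset_gset G K)"
    by (simp_all add: tgenerated_ideal_def subgroups_def)
  note X = R.coset_gset_closed[OF K]
  obtain D u c i where D: "D \<in> gsets G" "u \<in> gmaps G D (coset_gset G K)" "c \<in> carrier (tval S D)"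
    "i \<in> ideal_ext G R I D" "i \<in> carrier (tval R D)" "\<phi> D i \<in> carrier (tval S D)"
    "c \<otimes>\<^bsub>tval S D\<^esub> \<phi> D i \<in> carrier (tval S D)" "a = ttr S D (coset_gset G K) u (c \<otimes>\<^bsub>tval S D\<^esub> \<phi> D i)"
    by (rule tgeneratedE[OF I a])
  \<comment> \<open>The double coset formula enters here: the restriction of \<open>b\<close> along
    \<open>u\<close> is once more of the generated form, now as a transfer from some
    \<open>E\<close> over \<open>D\<close>.\<close>
  have "tres S D (coset_gset G K) u b \<in> tgenerated G R S \<phi> J D"
    by (rule tgenerated_res[OF J X D(1,2) b])
  then obtain E w d j where E: "E \<in> gsets G" "w \<in> gmaps G E D" "d \<in> carrier (tval S E)"
    "j \<in> ideal_ext G R J E" "j \<in> carrier (tval R E)" "\<phi> E j \<in> carrier (tval S E)"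
    "d \<otimes>\<^bsub>tval S E\<^esub> \<phi> E j \<in> carrier (tval S E)"
    "tres S D (coset_gset G K) u b = ttr S E D w (d \<otimes>\<^bsub>tval S E\<^esub> \<phi> E j)"
    by (rule tgeneratedE[OF J])
  interpret SD: cring "tval S D" by (rule S.val_cring[OF D(1)])
  interpret SE: cring "tval S E" by (rule S.val_cring[OF E(1)])
  interpret RE: cring "tval R E" by (rule R.val_cring[OF E(1)])
  note ri = R.res_closed[OF E(1) D(1) E(2) D(5)] and rI = R.ideal_ext_res[OF I E(1) D(1) E(2) D(4)]
  note rc = S.res_closed[OF E(1) D(1) E(2) D(3)]
  let ?ij = "tres R E D w i \<otimes>\<^bsub>tval R E\<^esub> j"
  \<comment> \<open>Over \<open>E\<close> both ideal elements are available, and on every orbit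
    their product lies in the product of \<open>I\<close> and \<open>J\<close>, hence in the
    preimage of \<open>Q\<close>.\<close>
  have "tres R (coset_gset G L) E f ?ij \<in> tpreimage G R \<phi> Q L"
    if L: "subgroup L G" and f: "f \<in> gmaps G (coset_gset G L) E" for L f
    using R.res_mult[OF R.coset_gset_closed[OF L] E(1) f ri E(5)] R.ideal_ext_res_coset[OF I E(1) rI L f]
      R.ideal_ext_res_coset[OF J E(1) E(4) L f] le L
    unfolding R.tprod_le_iff[OF I J tpreimage_in_tideals[OF Q]] by simp
  then have "?ij \<in> ideal_ext G R (tpreimage G R \<phi> Q) E"
    using RE.m_closed[OF ri E(5)] by (simp add: ideal_ext_def subgroups_def)
  then have "\<phi> E ?ij \<in> ideal_ext G S Q E" by (rule ideal_ext_tpreimage[OF Q E(1)])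
  then have "(d \<otimes>\<^bsub>tval S E\<^esub> tres S E D w c) \<otimes>\<^bsub>tval S E\<^esub> \<phi> E ?ij \<in> ideal_ext G S Q E"
    by (rule ideal.I_l_closed[OF S.ideal_ext_ideal[OF Q E(1)] _ SE.m_closed[OF E(3) rc]])
  also have "(d \<otimes>\<^bsub>tval S E\<^esub> tres S E D w c) \<otimes>\<^bsub>tval S E\<^esub> \<phi> E ?ij
      = (d \<otimes>\<^bsub>tval S E\<^esub> \<phi> E j) \<otimes>\<^bsub>tval S E\<^esub> tres S E D w (c \<otimes>\<^bsub>tval S D\<^esub> \<phi> D i)"
    using morphism_mult[OF E(1) ri E(5)] morphism_commute(1)[OF E(1) D(1) E(2) D(5)]
      S.res_mult[OF E(1) D(1) E(2) D(3,6)] E(3,6) rc S.res_closed[OF E(1) D(1) E(2) D(6)]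
    by (simp add: SE.m_ac)
  finally have "ttr S E D w ((d \<otimes>\<^bsub>tval S E\<^esub> \<phi> E j) \<otimes>\<^bsub>tval S E\<^esub> tres S E D w (c \<otimes>\<^bsub>tval S D\<^esub> \<phi> D i))
      \<in> ideal_ext G S Q D"
    by (rule S.ideal_ext_tr[OF Q E(1) D(1) E(2)])
  \<comment> \<open>Frobenius reciprocity is now undone twice, along \<open>w\<close> to reach
    \<open>D\<close> and along \<open>u\<close> to reach \<open>G/K\<close>.\<close>
  then have "ttr S E D w (d \<otimes>\<^bsub>tval S E\<^esub> \<phi> E j) \<otimes>\<^bsub>tval S D\<^esub> (c \<otimes>\<^bsub>tval S D\<^esub> \<phi> D i) \<in> ideal_ext G S Q D"
    by (simp only: S.tr_frobenius[OF E(1) D(1) E(2,7) D(7)])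
  then have "(c \<otimes>\<^bsub>tval S D\<^esub> \<phi> D i) \<otimes>\<^bsub>tval S D\<^esub> tres S D (coset_gset G K) u b \<in> ideal_ext G S Q D"
    using E(8) SD.m_comm[OF D(7) S.tr_closed[OF E(1) D(1) E(2,7)]] by simp
  then have "a \<otimes>\<^bsub>tval S (coset_gset G K)\<^esub> b \<in> ideal_ext G S Q (coset_gset G K)"
    unfolding D(8) S.tr_frobenius[OF D(1) X D(2,7) tgenerated_carrier[OF J X b], symmetric]
    by (rule S.ideal_ext_tr[OF Q D(1) X D(2)])
  then show "a \<otimes>\<^bsub>tval S (coset_gset G K)\<^esub> b \<in> Q K"
    using ideal_ext_coset_gset[OF S Q] K by (simp add: subgroups_def)
qed

text \<open>If the preimage were everything it would contain 1 at each level, and \<open>phi\<close>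
  preserves 1, so \<open>Q\<close> would be improper. For primality, pass from \<open>I\<close> and
  \<open>J\<close> to the Tambara ideals generated by their images and return by
  adjointness.\<close>

lemma tpreimage_in_tprimes:
  assumes Q: "Q \<in> tprimes G S"
  shows "tpreimage G R \<phi> Q \<in> tprimes G R"
proof -
  have Qi: "Q \<in> tideals G S" and ne: "Q \<noteq> tunit G S"
    and prime: "\<And>I J. \<lbrakk>I \<in> tideals G S; J \<in> tideals G S; tprod G S I J \<le> Q\<rbrakk> \<Longrightarrow> I \<le> Q \<or> J \<le> Q"
    using Q by (auto simp: tprimes_def)
  have "Q = tunit G S" if eq: "tpreimage G R \<phi> Q = tunit G R"
  proof (rule extensionalityI[of _ "subgroups G"])
    show "Q \<in> extensional (subgroups G)" using Qi by (simp add: tideals_def)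
    show "tunit G S \<in> extensional (subgroups G)" by (simp add: tunit_def)
    fix K assume Ks: "K \<in> subgroups G"
    then have K: "subgroup K G" by (simp add: subgroups_def)
    note X = R.coset_gset_closed[OF K]
    have "\<one>\<^bsub>tval R (coset_gset G K)\<^esub> \<in> tpreimage G R \<phi> Q K"
      using eq Ks monoid.one_closed[OF R.val_monoid[OF X]] by (simp add: tunit_def)
    then have "\<one>\<^bsub>tval S (coset_gset G K)\<^esub> \<in> Q K"
      using ring_hom_one[OF morphism_hom[OF X]] by (simp add: tpreimage_iff[OF K])
    then show "Q K = tunit G S K"
      using ideal.one_imp_carrier[OF S.tideal_ideal[OF Qi K]] Ks by (simp add: tunit_def)
  qed
  moreover have "I \<le> tpreimage G R \<phi> Q \<or> J \<le> tpreimage G R \<phi> Q"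
    if I: "I \<in> tideals G R" and J: "J \<in> tideals G R" and le: "tprod G R I J \<le> tpreimage G R \<phi> Q" for I J
    using prime[OF tgenerated_ideal_in_tideals[OF I] tgenerated_ideal_in_tideals[OF J]
        tprod_tgenerated_ideal_le[OF I J Qi le]]
    unfolding tgenerated_ideal_le_iff[OF I Qi] tgenerated_ideal_le_iff[OF J Qi] .
  ultimately show ?thesis
    using tpreimage_in_tideals[OF Qi] ne by (auto simp: tprimes_def)
qed

text \<open>By adjointness the inverse image of \<open>V(I)\<close> is \<open>V\<close> of the
  Tambara ideal generated by the image of \<open>I\<close>.\<close>

lemma continuous_map_tpreimage:
  "continuous_map (nakaoka_spec G S) (nakaoka_spec G R) (tpreimage G R \<phi>)"
  unfolding continuous_map_closedin topspace_nakaoka_spec[OF R] topspace_nakaoka_spec[OF S]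
    closedin_nakaoka_spec[OF R] closedin_nakaoka_spec[OF S]
proof (intro conjI allI impI)
  show "tpreimage G R \<phi> \<in> tprimes G S \<rightarrow> tprimes G R" using tpreimage_in_tprimes by blast
  fix C assume "\<exists>I\<in>tideals G R. C = tvanish G R I"
  then obtain I where I: "I \<in> tideals G R" "C = tvanish G R I" by blast
  have "{Q \<in> tprimes G S. tpreimage G R \<phi> Q \<in> C} = tvanish G S (tgenerated_ideal G R S \<phi> I)"
    using I(2) tpreimage_in_tprimes tgenerated_ideal_le_iff[OF I(1)] by (auto simp: tvanish_def tprimes_def)
  then show "\<exists>I\<in>tideals G S. {Q \<in> tprimes G S. tpreimage G R \<phi> Q \<in> C} = tvanish G S I"
    using tgenerated_ideal_in_tideals[OF I(1)] by blast
qed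

end

text \<open>Both sides impose conditions along the same maps \<open>H/L -> Res (G/K)\<close>; they
  agree because \<open>phi\<close> commutes with restriction along these maps.\<close>

lemma coind_ideal_tpreimage:
  assumes "group G" "finite (carrier G)" and H: "subgroup H G"
    and R: "tambara_functor (G\<lparr>carrier := H\<rparr>) R" and S: "tambara_functor (G\<lparr>carrier := H\<rparr>) S"
    and \<phi>: "tambara_morphism (G\<lparr>carrier := H\<rparr>) R S \<phi>"
  shows "coind_ideal G H R (tpreimage (G\<lparr>carrier := H\<rparr>) R \<phi> Q) =
    tpreimage G (coind H R) (coind_morphism H \<phi>) (coind_ideal G H S Q)"
proof (rule extensionalityI[of _ "subgroups G"])
  interpret R: tambara_functor "G\<lparr>carrier := H\<rparr>" R by (rule R)
  fix K assume Ks: "K \<in> subgroups G"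
  have X: "res_gset H (coset_gset G K) \<in> gsets (G\<lparr>carrier := H\<rparr>)"
    using Ks res_gset_in_gsets[OF H assms(1) coset_gset_in_gsets[OF assms(1,2)]] by (simp add: subgroups_def)
  have "tres R (coset_gset (G\<lparr>carrier := H\<rparr>) L) (res_gset H (coset_gset G K)) f a \<in> tpreimage (G\<lparr>carrier := H\<rparr>) R \<phi> Q L
    \<longleftrightarrow> tres S (coset_gset (G\<lparr>carrier := H\<rparr>) L) (res_gset H (coset_gset G K)) f (\<phi> (res_gset H (coset_gset G K)) a) \<in> Q L"
    if "L \<in> subgroups (G\<lparr>carrier := H\<rparr>)"
      "f \<in> gmaps (G\<lparr>carrier := H\<rparr>) (coset_gset (G\<lparr>carrier := H\<rparr>) L) (res_gset H (coset_gset G K))"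
      "a \<in> carrier (tval R (res_gset H (coset_gset G K)))" for L f a
  proof -
    have L: "subgroup L (G\<lparr>carrier := H\<rparr>)" using that(1) by (simp add: subgroups_def)
    show ?thesis
      using morphism_commute(1)[OF R S \<phi> R.coset_gset_closed[OF L] X that(2,3)]
        R.res_closed[OF R.coset_gset_closed[OF L] X that(2,3)] by (simp add: tpreimage_iff[OF R S \<phi> L])
  qed
  then show "coind_ideal G H R (tpreimage (G\<lparr>carrier := H\<rparr>) R \<phi> Q) K =
    tpreimage G (coind H R) (coind_morphism H \<phi>) (coind_ideal G H S Q) K"
    using Ks morphism_closed[OF R S \<phi> X]
    by (auto simp: coind_ideal_def tpreimage_def[of G] ideal_ext_def coind_morphism_def)
qed (simp_all add: coind_ideal_def tpreimage_def)

text \<open>Naturality takes the form of a commuting square: a morphism induces contraction maps on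
  both pairs of spectra, these are continuous, and coinduction of ideals intertwines them. The
  values of \<open>S\<close> may have a type different from those of \<open>R\<close>.\<close>

theorem theoremA:
  fixes G :: "'g monoid" and H :: "'g set" and R :: "('g, 'r) tambara"
  assumes "group G" and "finite (carrier G)" and "subgroup H G"
    and "tambara_functor (G\<lparr>carrier := H\<rparr>) R"
  shows
    "bij_betw (coind_ideal G H R) (tideals (G\<lparr>carrier := H\<rparr>) R) (tideals G (coind H R)) \<and>
     (\<forall>I \<in> tideals (G\<lparr>carrier := H\<rparr>) R. \<forall>J \<in> tideals (G\<lparr>carrier := H\<rparr>) R.
        coind_ideal G H R I \<le> coind_ideal G H R J \<longleftrightarrow> I \<le> J) \<and>
     bij_betw (coind_ideal G H R) (tprimes (G\<lparr>carrier := H\<rparr>) R) (tprimes G (coind H R)) \<and>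
     homeomorphic_map (nakaoka_spec (G\<lparr>carrier := H\<rparr>) R) (nakaoka_spec G (coind H R))
       (coind_ideal G H R) \<and>
     (\<forall>(S :: ('g, 's) tambara) \<phi>.
        tambara_functor (G\<lparr>carrier := H\<rparr>) S \<and> tambara_morphism (G\<lparr>carrier := H\<rparr>) R S \<phi> \<longrightarrow>
          continuous_map (nakaoka_spec (G\<lparr>carrier := H\<rparr>) S) (nakaoka_spec (G\<lparr>carrier := H\<rparr>) R)
            (tpreimage (G\<lparr>carrier := H\<rparr>) R \<phi>) \<and>
          continuous_map (nakaoka_spec G (coind H S)) (nakaoka_spec G (coind H R))
            (tpreimage G (coind H R) (coind_morphism H \<phi>)) \<and>
          (\<forall>\<qq> \<in> topspace (nakaoka_spec (G\<lparr>carrier := H\<rparr>) S).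
             coind_ideal G H R (tpreimage (G\<lparr>carrier := H\<rparr>) R \<phi> \<qq>) =
             tpreimage G (coind H R) (coind_morphism H \<phi>) (coind_ideal G H S \<qq>)))"
proof -
  let ?H = "G\<lparr>carrier := H\<rparr>"
  have "continuous_map (nakaoka_spec ?H S) (nakaoka_spec ?H R) (tpreimage ?H R \<phi>) \<and>
      continuous_map (nakaoka_spec G (coind H S)) (nakaoka_spec G (coind H R))
        (tpreimage G (coind H R) (coind_morphism H \<phi>)) \<and>
      (\<forall>\<qq> \<in> topspace (nakaoka_spec ?H S). coind_ideal G H R (tpreimage ?H R \<phi> \<qq>) =
         tpreimage G (coind H R) (coind_morphism H \<phi>) (coind_ideal G H S \<qq>))"
    if S: "tambara_functor ?H S" and \<phi>: "tambara_morphism ?H R S \<phi>" for S :: "('g, 's) tambara" and \<phi>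
    using continuous_map_tpreimage[OF assms(4) S \<phi>]
      continuous_map_tpreimage[OF tambara_functor_coind[OF assms] tambara_functor_coind[OF assms(1-3) S]
        tambara_morphism_coind[OF assms(1,3) \<phi>]]
      coind_ideal_tpreimage[OF assms S \<phi>] by simp
  then show ?thesis
    using bij_betw_coind_ideal[OF assms] coind_ideal_le_iff[OF assms] bij_betw_coind_ideal_tprimes[OF assms]
      homeomorphic_map_coind_ideal[OF assms] by blast
qed

end
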